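(* Let $\nu=(NE^{k_n})\cdots(NE^{k_1})$ with all $k_i\ge1$ (no two consecutive north steps). For every $\nu$-tree $T$, the vector $y(T)=\pi(\widetilde{b}(T))-\pi(\widetilde{b}(T_0))\in\mathbb{R}^{n-1}$ is given by $y(T)=(y_1,\dots,y_{n-1})$ with $y_i=\operatorname{area}(P_i(T))$ for $1\le i\le n-1$. Moreover, these coordinates determine a realization of the $\nu$-associahedron: the polytopes $\operatorname{conv}\{y(T)\mid T \text{ a } \nu\text{-tree},\ I\subseteq T\}$, for $I$ ranging over the interior faces of the $\nu$-Tamari complex, are the faces of a polytopal complex in $\mathbb{R}^{n-1}$ realizing the $\nu$-associahedron.
   Context: **Type $A$ conventions.** $W=\mathcal{S}_{r+1}$ is generated by $S=\{s_1,\dots,s_r\}$, $s_p=(p\;\,p{+}1)$, and acts linearly on $\mathbb{R}^{r+1}$ by $w(e_i)=e_{w(i)}$; the fundamental weights are $\omega_p=\sum_{q\le p}e_q$ (also written $\omega_{s_p}$). For a word $Q=(q_1,\dots,q_m)$ in $S$ and $w\in W$, the subword complex $\mathcal{SC}(Q,w)$ is the simplicial complex whose facets are the sets $I\subseteq[m]$ such that the subword $Q_{[m]\setminus I}$ is a reduced expression of $w$. For a facet $I$, $\omega(I,k):=\left(\prod Q_{\{1,\dots,k-1\}\setminus I}\right)(\omega_{q_k})$, where $\prod Q_X$ is the product, in order, of the letters at positions $X$; the brick vector is $b(I)=-\sum_{k=1}^m\omega(I,k)$. **$\nu$-trees.** $F_\nu$ is the Ferrers diagram weakly above $\nu$ inside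 the smallest axis-parallel rectangle containing $\nu$; $A_\nu$ is the set of lattice points in $F_\nu$. For $p\in A_\nu$, $d(p)$ is the lattice ($\ell_1$) distance from $p$ to the top-left corner of $F_\nu$. Two points $p,q\in A_\nu$ are $\nu$-incompatible if one is strictly southwest of the other and the smallest axis-parallel rectangle containing $p$ and $q$ lies in $F_\nu$; otherwise $\nu$-compatible. A $\nu$-tree is a maximal set of pairwise $\nu$-compatible points of $A_\nu$; its elements are nodes, and the top-left corner of $F_\nu$ (always a node) is the root. A $\nu$-tree is drawn as a rooted binary tree by connecting every non-root node to the next node in north or west direction. The $\nu$-Tamari complex is the simplicial complex of pairwise $\nu$-compatible subsets of $A_\nu$. **Rotation order.** If $q\in T$ has a next node $p$ to its north (same column) and a next node $r$ to its east (same row), a right rotation replaces $q$ by $q'$, the northeast corner of the rectangle with corners $p,q,r$. The $\nu$-Tamari lattice is the partial order on $\nu$-trees generated by right rotations (increasing); $T_0$ denotes its minimal element. **$Q_\nu$ and $w_\nu$.** Label each $p\in A_\nu$ by $s_{d(p)+1}$. $Q_\nu$ is the word obtained by reading these labels column by column from left to right, each column from bottom to top (positions of $Q_\nu$ are identified with points of $A_\nu$). $w_\nu$ is the product, in this order, of the letters at the points in the complement of a $\nu$-tree (known to be independent of the $\nu$-tree); it is known that the facets of $\mathcal{SC}(Q_\nu,w_\nu)$ are exactly the $\nu$-trees. For $\nu$ as in the claim put $N=n+\sum_{i=1}^n(k_i-1)$ and $r+1=N+2$, so $b(T)\in\mathbb{R}^{N+2}$ for each $\nu$-tree $T$; $\widetilde{b}(T)\in\mathbb{R}^N$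 is obtained from $b(T)$ by omitting its first and last coordinates. **The projection $\pi:\mathbb{R}^N\to\mathbb{R}^{n-1}$.** Define sets $\widetilde{M}_1,\dots,\widetilde{M}_n$ recursively: $\widetilde{M}_j$ is the set of the last (largest) $k_j-1$ elements of $[N]\setminus\bigcup_{i=1}^{j-1}\widetilde{M}_i$; let $M_j=\widetilde{M}_j\cup\{j\}$. For $I\subseteq[N]$ write $x_I=\sum_{i\in I}x_i$. Then $\pi=\pi_2\circ\pi_1$, where $\pi_1(x_1,\dots,x_N)=(x_{M_1},\dots,x_{M_n})$ and $\pi_2(z_1,\dots,z_n)=(z_1,z_1+z_2,\dots,z_1+\dots+z_{n-1})$. **Paths and areas.** Label the horizontal lattice lines of the Ferrers diagram from $1$ to $n-1$, from top to bottom, omitting the topmost line (so line $i$ is at height $n-i$ if $\nu$ starts at height $0$ and ends at height $n$). $P_i=P_i(T)$ is the unique shortest path in the tree $T$ connecting the root to the leftmost node of $T$ on the $i$-th horizontal line, and $\operatorname{area}(P_i)$ is the number of unit boxes to the left of $P_i$ (boxes of the Ferrers diagram between line $i$ and the topmost line lying to the left of the path). **The $\nu$-associahedron.** An interior face of the $\nu$-Tamari complex is a face not contained in its boundary (generated by codimension-one faces contained in exactly one facet). Equivalently (known), it is a set $T\setminus A$ with $T$ a $\nu$-tree and $A$ a subset of its ascents, an ascent being a node $q\in T$ such that $T$ has a node north of $q$ and a node east of $q$. The $\nu$-associahedron is a polytopal complex whose poset of non-empty faces, ordered by containment, is anti-isomorphic to the poset of interior faces of the $\nu$-Tamari complex ordered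 by containment; a realization is a polytopal complex in some $\mathbb{R}^d$ with this face poset. *)

theory Defs
  imports
    "HOL-Analysis.Analysis"
    "HOL-Library.Function_Algebras"
    "HOL-Combinatorics.Transposition"
begin

section \<open>Coordinate spaces of variable dimension\<close>

text \<open>
  The dimensions in the statement depend on the lattice path, so a vector of $R^d$ is a
  function \<open>v :: nat \<Rightarrow> real\<close> vanishing outside \<open>{1..d}\<close>. The pointwise vector space structure
  below makes the library notions \<open>convex hull\<close>, \<open>polytope\<close> and \<open>face_of\<close> available.
\<close>

instantiation "fun" :: (type, real_vector) real_vector
begin

definition scaleR_fun :: "real \<Rightarrow> ('a \<Rightarrow> 'b) \<Rightarrow> 'a \<Rightarrow> 'b"
  where "scaleR_fun c f = (\<lambda>x. c *\<^sub>R f x)"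

instance
  by standard (simp_all add: scaleR_fun_def fun_eq_iff scaleR_add_right scaleR_add_left)

end

definition coord_space :: "nat \<Rightarrow> (nat \<Rightarrow> real) set"
  where "coord_space d = {v. \<forall>i. i \<notin> {1..d} \<longrightarrow> v i = 0}"


section \<open>Lattice paths and Ferrers diagrams\<close>

text \<open>Lattice points are pairs (abscissa, ordinate); paths start at the origin.\<close>

datatype step = North | East

type_synonym point = "nat \<times> nat"

definition path_point :: "step list \<Rightarrow> nat \<Rightarrow> point"
  where "path_point \<nu> i = (count_list (take i \<nu>) East, count_list (take i \<nu>) North)"

abbreviation width :: "step list \<Rightarrow> nat"
  where "width \<nu> \<equiv> count_list \<nu> East"

abbreviation height :: "step list \<Rightarrow> nat"
  where "height \<nu> \<equiv> count_list \<nu> North"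

definition real_point :: "point \<Rightarrow> real \<times> real"
  where "real_point p = (real (fst p), real (snd p))"

definition curve :: "step list \<Rightarrow> (real \<times> real) set"
  where "curve \<nu> =
    (\<Union>i<length \<nu>. closed_segment (real_point (path_point \<nu> i)) (real_point (path_point \<nu> (Suc i))))"

definition ferrers :: "step list \<Rightarrow> (real \<times> real) set"
  where "ferrers \<nu> =
    {(x, y). x \<in> {0..real (width \<nu>)} \<and> y \<in> {0..real (height \<nu>)} \<and> (\<exists>y'\<le>y. (x, y') \<in> curve \<nu>)}"

definition lattice_points :: "step list \<Rightarrow> point set"
  where "lattice_points \<nu> = {p. real_point p \<in> ferrers \<nu>}"

definition top_left :: "step list \<Rightarrow> point"
  where "top_left \<nu> = (0, height \<nu>)"

definition root_dist :: "step list \<Rightarrow> point \<Rightarrow> nat"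
  where "root_dist \<nu> p = fst p + (height \<nu> - snd p)"


section \<open>The \<open>\<nu>\<close>-Tamari complex and \<open>\<nu>\<close>-trees\<close>

definition strictly_southwest :: "point \<Rightarrow> point \<Rightarrow> bool"
  where "strictly_southwest p q \<longleftrightarrow> fst p < fst q \<and> snd p < snd q"

definition rectangle :: "point \<Rightarrow> point \<Rightarrow> (real \<times> real) set"
  where "rectangle p q =
    {real (min (fst p) (fst q))..real (max (fst p) (fst q))} \<times>
    {real (min (snd p) (snd q))..real (max (snd p) (snd q))}"

definition incompatible :: "step list \<Rightarrow> point \<Rightarrow> point \<Rightarrow> bool"
  where "incompatible \<nu> p q \<longleftrightarrow>
    (strictly_southwest p q \<or> strictly_southwest q p) \<and> rectangle p q \<subseteq> ferrers \<nu>"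

definition tamari_complex :: "step list \<Rightarrow> point set set"
  where "tamari_complex \<nu> =
    {I. I \<subseteq> lattice_points \<nu> \<and> pairwise (\<lambda>p q. \<not> incompatible \<nu> p q) I}"

definition nu_tree :: "step list \<Rightarrow> point set \<Rightarrow> bool"
  where "nu_tree \<nu> T \<longleftrightarrow>
    T \<in> tamari_complex \<nu> \<and> (\<forall>T' \<in> tamari_complex \<nu>. T \<subseteq> T' \<longrightarrow> T' = T)"

text \<open>Codimension-one faces contained in exactly one facet; they generate the boundary.\<close>

definition boundary_ridges :: "step list \<Rightarrow> point set set"
  where "boundary_ridges \<nu> =
    {R. (\<exists>T q. nu_tree \<nu> T \<and> q \<in> T \<and> R = T - {q}) \<and> (\<exists>!T. nu_tree \<nu> T \<and> R \<subseteq> T)}"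

definition interior_faces :: "step list \<Rightarrow> point set set"
  where "interior_faces \<nu> = {I \<in> tamari_complex \<nu>. \<not> (\<exists>R \<in> boundary_ridges \<nu>. I \<subseteq> R)}"


section \<open>Rooted tree structure and rotations\<close>

definition next_north :: "point set \<Rightarrow> point \<Rightarrow> point \<Rightarrow> bool"
  where "next_north T q p \<longleftrightarrow> p \<in> T \<and> fst p = fst q \<and> snd q < snd p \<and>
    (\<forall>b. snd q < b \<and> b < snd p \<longrightarrow> (fst q, b) \<notin> T)"

definition next_east :: "point set \<Rightarrow> point \<Rightarrow> point \<Rightarrow> bool"
  where "next_east T q p \<longleftrightarrow> p \<in> T \<and> snd p = snd q \<and> fst q < fst p \<and>
    (\<forall>a. fst q < a \<and> a < fst p \<longrightarrow> (a, snd q) \<notin> T)"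

definition next_west :: "point set \<Rightarrow> point \<Rightarrow> point \<Rightarrow> bool"
  where "next_west T q p \<longleftrightarrow> p \<in> T \<and> snd p = snd q \<and> fst p < fst q \<and>
    (\<forall>a. fst p < a \<and> a < fst q \<longrightarrow> (a, snd q) \<notin> T)"

definition rotates_to :: "step list \<Rightarrow> point set \<Rightarrow> point set \<Rightarrow> bool"
  where "rotates_to \<nu> T T' \<longleftrightarrow> nu_tree \<nu> T \<and> nu_tree \<nu> T' \<and>
    (\<exists>q\<in>T. \<exists>p r. next_north T q p \<and> next_east T q r \<and>
       T' = insert (fst r, snd p) (T - {q}))"

definition rotation_le :: "step list \<Rightarrow> point set \<Rightarrow> point set \<Rightarrow> bool"
  where "rotation_le \<nu> = (rotates_to \<nu>)\<^sup>*\<^sup>*"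

definition min_tree :: "step list \<Rightarrow> point set"
  where "min_tree \<nu> = (THE T. nu_tree \<nu> T \<and> (\<forall>T'. nu_tree \<nu> T' \<longrightarrow> rotation_le \<nu> T T'))"

definition tree_edge :: "point set \<Rightarrow> point \<Rightarrow> point \<Rightarrow> bool"
  where "tree_edge T q p \<longleftrightarrow> q \<in> T \<and> (next_north T q p \<or> next_west T q p)"

definition tree_walk :: "point set \<Rightarrow> point \<Rightarrow> point \<Rightarrow> point list \<Rightarrow> bool"
  where "tree_walk T u v P \<longleftrightarrow> P \<noteq> [] \<and> set P \<subseteq> T \<and> hd P = u \<and> last P = v \<and>
    successively (\<lambda>p q. tree_edge T p q \<or> tree_edge T q p) P"

definition shortest_path :: "point set \<Rightarrow> point \<Rightarrow> point \<Rightarrow> point list"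
  where "shortest_path T u v =
    (THE P. tree_walk T u v P \<and> (\<forall>P'. tree_walk T u v P' \<longrightarrow> length P \<le> length P'))"

text \<open>Line \<open>i\<close> is the horizontal lattice line \<open>i\<close> units below the topmost one.\<close>

definition leftmost_node :: "step list \<Rightarrow> point set \<Rightarrow> nat \<Rightarrow> point"
  where "leftmost_node \<nu> T i =
    (let h = height \<nu> - i in (LEAST a. (a, h) \<in> T, h))"

definition line_path :: "step list \<Rightarrow> point set \<Rightarrow> nat \<Rightarrow> point list"
  where "line_path \<nu> T i = shortest_path T (top_left \<nu>) (leftmost_node \<nu> T i)"

text \<open>
  A unit box, given by its south-west corner \<open>(a, b)\<close>, lies to the left of a path if the path
  crosses the strip between the heights \<open>b\<close> and \<open>b + 1\<close> along a vertical edge to the right of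
  the box.
\<close>

definition unit_box_in :: "step list \<Rightarrow> point \<Rightarrow> bool"
  where "unit_box_in \<nu> c \<longleftrightarrow> rectangle c (Suc (fst c), Suc (snd c)) \<subseteq> ferrers \<nu>"

definition left_of_path :: "point \<Rightarrow> point list \<Rightarrow> bool"
  where "left_of_path c P \<longleftrightarrow>
    (\<exists>j. Suc j < length P \<and> (let u = P ! j; v = P ! Suc j in
       fst u = fst v \<and> min (snd u) (snd v) \<le> snd c \<and> Suc (snd c) \<le> max (snd u) (snd v) \<and>
       Suc (fst c) \<le> fst u))"

definition area :: "step list \<Rightarrow> nat \<Rightarrow> point list \<Rightarrow> nat"
  where "area \<nu> i P = card {c. unit_box_in \<nu> c \<and> height \<nu> - i \<le> snd c \<and> snd c < height \<nu> \<and>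
    left_of_path c P}"


section \<open>Brick vectors\<close>

text \<open>
  The letter \<open>p\<close> of a word stands for the simple transposition exchanging \<open>p\<close> and \<open>p + 1\<close>.
  A product of permutations is the composition of functions, the rightmost factor acting first.
\<close>

definition simple_refl :: "nat \<Rightarrow> nat \<Rightarrow> nat"
  where "simple_refl p = Transposition.transpose p (Suc p)"

definition word_prod :: "nat list \<Rightarrow> nat \<Rightarrow> nat"
  where "word_prod Q = foldr (\<lambda>p w. simple_refl p \<circ> w) Q id"

definition perm_act :: "(nat \<Rightarrow> nat) \<Rightarrow> (nat \<Rightarrow> real) \<Rightarrow> nat \<Rightarrow> real"
  where "perm_act w v = (\<lambda>j. v (inv w j))"

definition unit_vec :: "nat \<Rightarrow> nat \<Rightarrow> real"
  where "unit_vec i = (\<lambda>j. if j = i then 1 else 0)"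

lemma perm_act_unit_vec: "bij w \<Longrightarrow> perm_act w (unit_vec i) = unit_vec (w i)"
  by (auto simp: perm_act_def unit_vec_def fun_eq_iff bij_is_inj bij_is_surj surj_f_inv_f)

definition fundamental_weight :: "nat \<Rightarrow> nat \<Rightarrow> real"
  where "fundamental_weight p = (\<Sum>q\<in>{1..p}. unit_vec q)"

text \<open>Positions in a word are counted from \<open>0\<close>.\<close>

definition weight_at :: "nat list \<Rightarrow> nat set \<Rightarrow> nat \<Rightarrow> nat \<Rightarrow> real"
  where "weight_at Q I k =
    perm_act (word_prod (nths Q ({..<k} - I))) (fundamental_weight (Q ! k))"

definition brick_vector :: "nat list \<Rightarrow> nat set \<Rightarrow> nat \<Rightarrow> real"
  where "brick_vector Q I = - (\<Sum>k<length Q. weight_at Q I k)"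

definition reading_order :: "step list \<Rightarrow> point list"
  where "reading_order \<nu> = filter (\<lambda>p. p \<in> lattice_points \<nu>)
    (concat (map (\<lambda>a. map (\<lambda>b. (a, b)) [0..<Suc (height \<nu>)]) [0..<Suc (width \<nu>)]))"

definition Q_word :: "step list \<Rightarrow> nat list"
  where "Q_word \<nu> = map (\<lambda>p. Suc (root_dist \<nu> p)) (reading_order \<nu>)"

definition positions :: "step list \<Rightarrow> point set \<Rightarrow> nat set"
  where "positions \<nu> T = {k. k < length (reading_order \<nu>) \<and> reading_order \<nu> ! k \<in> T}"

definition tree_brick_vector :: "step list \<Rightarrow> point set \<Rightarrow> nat \<Rightarrow> real"
  where "tree_brick_vector \<nu> T = brick_vector (Q_word \<nu>) (positions \<nu> T)"

text \<open>Omits the first and the last coordinate of a vector of $R^{N+2}$.\<close>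

definition trim :: "nat \<Rightarrow> (nat \<Rightarrow> real) \<Rightarrow> nat \<Rightarrow> real"
  where "trim N v = (\<lambda>i. if i \<in> {1..N} then v (Suc i) else 0)"


section \<open>The projection\<close>

definition last_elements :: "nat \<Rightarrow> nat set \<Rightarrow> nat set"
  where "last_elements c A = {x \<in> A. card {y \<in> A. x < y} < c}"

fun M_tilde :: "nat \<Rightarrow> (nat \<Rightarrow> nat) \<Rightarrow> nat \<Rightarrow> nat set"
  where "M_tilde N k j = last_elements (k j - 1) ({1..N} - (\<Union>i\<in>{1..<j}. M_tilde N k i))"

declare M_tilde.simps [simp del]

definition M_set :: "nat \<Rightarrow> (nat \<Rightarrow> nat) \<Rightarrow> nat \<Rightarrow> nat set"
  where "M_set N k j = insert j (M_tilde N k j)"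

definition proj1 :: "nat \<Rightarrow> nat \<Rightarrow> (nat \<Rightarrow> nat) \<Rightarrow> (nat \<Rightarrow> real) \<Rightarrow> nat \<Rightarrow> real"
  where "proj1 n N k x = (\<lambda>j. if j \<in> {1..n} then \<Sum>i\<in>M_set N k j. x i else 0)"

definition proj2 :: "nat \<Rightarrow> (nat \<Rightarrow> real) \<Rightarrow> nat \<Rightarrow> real"
  where "proj2 n z = (\<lambda>i. if i \<in> {1..n - 1} then \<Sum>j=1..i. z j else 0)"

definition proj :: "nat \<Rightarrow> nat \<Rightarrow> (nat \<Rightarrow> nat) \<Rightarrow> (nat \<Rightarrow> real) \<Rightarrow> nat \<Rightarrow> real"
  where "proj n N k = proj2 n \<circ> proj1 n N k"


section \<open>The coordinates attached to the composition \<open>(k\<^sub>1, \<dots>, k\<^sub>n)\<close>\<close>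

text \<open>The path $(N E^{k_n}) \cdots (N E^{k_1})$.\<close>

definition nu_path :: "nat \<Rightarrow> (nat \<Rightarrow> nat) \<Rightarrow> step list"
  where "nu_path n k = concat (map (\<lambda>i. North # replicate (k i) East) (rev [1..<Suc n]))"

definition N_dim :: "nat \<Rightarrow> (nat \<Rightarrow> nat) \<Rightarrow> nat"
  where "N_dim n k = n + (\<Sum>i=1..n. k i - 1)"

definition y_coords :: "nat \<Rightarrow> (nat \<Rightarrow> nat) \<Rightarrow> point set \<Rightarrow> nat \<Rightarrow> real"
  where "y_coords n k T =
    (let \<nu> = nu_path n k; N = N_dim n k;
         q = (\<lambda>T. proj n N k (trim N (tree_brick_vector \<nu> T)))
     in q T - q (min_tree \<nu>))"

definition cell :: "nat \<Rightarrow> (nat \<Rightarrow> nat) \<Rightarrow> point set \<Rightarrow> (nat \<Rightarrow> real) set"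
  where "cell n k I = convex hull {y_coords n k T |T. nu_tree (nu_path n k) T \<and> I \<subseteq> T}"


section \<open>Polytopal complexes and realizations\<close>

text \<open>A nonempty polytopal complex contains the empty set, since it is a face of every polytope.\<close>

definition polytopal_complex :: "nat \<Rightarrow> (nat \<Rightarrow> real) set set \<Rightarrow> bool"
  where "polytopal_complex d C \<longleftrightarrow> finite C \<and>
    (\<forall>P\<in>C. polytope P \<and> P \<subseteq> coord_space d) \<and>
    (\<forall>P\<in>C. \<forall>F. F face_of P \<longrightarrow> F \<in> C) \<and>
    (\<forall>P\<in>C. \<forall>P'\<in>C. (P \<inter> P') face_of P \<and> (P \<inter> P') face_of P')"

definition order_anti_iso :: "('a set \<Rightarrow> 'b set) \<Rightarrow> 'a set set \<Rightarrow> 'b set set \<Rightarrow> bool"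
  where "order_anti_iso \<phi> X Y \<longleftrightarrow> bij_betw \<phi> X Y \<and>
    (\<forall>I\<in>X. \<forall>J\<in>X. \<phi> I \<subseteq> \<phi> J \<longleftrightarrow> J \<subseteq> I)"

text \<open>
  The polytopal complex \<open>C\<close> in $R^d$ realizes the \<open>\<nu>\<close>-associahedron, \<open>\<phi>\<close> identifying the
  interior faces of the \<open>\<nu>\<close>-Tamari complex with the non-empty faces of \<open>C\<close>.
\<close>

definition realizes_nu_associahedron ::
    "step list \<Rightarrow> nat \<Rightarrow> (nat \<Rightarrow> real) set set \<Rightarrow> (point set \<Rightarrow> (nat \<Rightarrow> real) set) \<Rightarrow> bool"
  where "realizes_nu_associahedron \<nu> d C \<phi> \<longleftrightarrow>
    polytopal_complex d C \<and> order_anti_iso \<phi> (interior_faces \<nu>) (C - {{}})"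

end

theory Submission
  imports Defs
begin

text \<open>
  Between line \<open>i\<close> and the topmost line, and left of the end of line \<open>i\<close>, the Ferrers diagram is a
  rectangle. Compatible points of a rectangle are never strictly southwest of each other, so the
  nodes of a tree form a staircase there, and the path from the root to the leftmost node of line
  \<open>i\<close> follows it (\<open>area_line_path\<close>). The area to the left of the path is therefore the sum, over
  the strips between consecutive horizontal lines, of the abscissa at which the staircase crosses
  the strip. Both halves of the theorem start from this formula for the area.

  \<^emph>\<open>The brick vectors.\<close> The sets \<open>M_tilde\<close> are intervals, so coordinate \<open>i\<close> of the projection sums
  the brick vector over all coordinates except the first, the last and an interval
  (\<open>proj_apply\<close>). In the pipe dream of a tree the pipes numbered by this interval are those that
  enter line \<open>i\<close> from below, save the one at the end of the line. Their course can be described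
  explicitly: in the rectangle above line \<open>i\<close> they use the vertical edges off the staircase and the
  horizontal edges on it. This description is verified one point at a time (\<open>pipes_at_point\<close>,
  \<open>free_positions_prefix\<close>). Counting positions then gives the area plus a term that depends only
  on the shape (\<open>free_count_eq\<close>, \<open>proj_brick_vector\<close>). The minimal tree has the whole first column as
  nodes, so its areas vanish, and subtracting its vector removes the shape term
  (\<open>y_coords_tree_point\<close>).

  \<^emph>\<open>The polytopal complex.\<close> Write \<open>y\<^sub>h\<close> for the coordinate of the line at height \<open>h\<close>. For the
  point of a tree, in every column \<open>a\<close> the expression \<open>y\<^sub>h + h * a\<close> takes its minimum over the rows
  that meet the column exactly at the nodes of the tree (\<open>tight_tree_point\<close>). So the points of the
  trees are vertices of an arrangement of tropical hyperplanes, one for each column. An arbitrary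
  point \<open>v\<close> has as tight set the points of the diagram at which these minima are attained. It is
  always a set of compatible points, since \<open>h * a\<close> is supermodular (\<open>tight_face\<close>). The cell of \<open>I\<close>
  consists of all \<open>v\<close> whose tight set contains \<open>I\<close>. A face is interior exactly if it contains
  the root and meets every row and every column (\<open>interior_iff\<close>); the link to ridges is that a
  node can be flipped if without it the tree still has this property. For such
  \<open>I\<close> the cell is bounded, and moving a point away from the point of a tree until another point of
  the diagram becomes tight shows by induction that the cell is the convex hull of the points of the
  trees containing \<open>I\<close> (\<open>tight_cell_hull\<close>). Strictly between two points of such a cell the tight
  set is the intersection of their tight sets (\<open>tight_between\<close>). Hence the faces of cells are cells,
  intersections of cells are common faces, and every interior face is the tight set of a point of its
  cell, so that containment of cells reverses containment of faces (\<open>realization\<close>).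
\<close>

section \<open>The Ferrers diagram as a staircase of lattice points\<close>

text \<open>A prefix of the path that has entered \<open>h\<close> of the blocks \<open>N E\<^sup>k\<close> has at most the east steps of
  these blocks.\<close>
lemma east_count_le_blocks:
  "count_list (take t (concat (map (\<lambda>k. North # replicate k East) ks))) East
    \<le> sum_list (take (count_list (take t (concat (map (\<lambda>k. North # replicate k East) ks))) North) ks)"
proof (induction ks arbitrary: t)
  case Nil
  then show ?case by simp
next
  case (Cons k ks)
  show ?case
  proof (cases t)
    case 0
    then show ?thesis by simp
  next
    case (Suc t')
    have "count_list (replicate m x) y = (if x = y then m else 0)" for m and x y :: step
      by (induction m) auto
    with Suc Cons[of "t' - k"] show ?thesis
      by (simp add: take_replicate)
  qed
qed

lemma counts_of_full_blocks:
  "count_list (concat (map (\<lambda>k. North # replicate k East) ks)) East = sum_list ks"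
  "count_list (concat (map (\<lambda>k. North # replicate k East) ks)) North = length ks"
proof -
  have *: "count_list (replicate m x) y = (if x = y then m else 0)" for m and x y :: step
    by (induction m) auto
  show "count_list (concat (map (\<lambda>k. North # replicate k East) ks)) East = sum_list ks"
    "count_list (concat (map (\<lambda>k. North # replicate k East) ks)) North = length ks"
    by (induction ks) (simp_all add: *)
qed

lemma vertex_in_curve:
  assumes "i \<le> length \<nu>" and "\<nu> \<noteq> []"
  shows "real_point (path_point \<nu> i) \<in> curve \<nu>"
proof (cases "i = length \<nu>")
  case True
  then have "i \<noteq> 0" using assms by simp
  then obtain j where j: "i = Suc j" using not0_implies_Suc by blast
  then have "j < length \<nu>" using True by simp
  show ?thesis unfolding curve_def j(1) by (rule UN_I[of j]) (use \<open>j < length \<nu>\<close> in auto)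
next
  case False
  then have "i < length \<nu>" using assms by simp
  then show ?thesis unfolding curve_def by (intro UN_I[of i]) auto
qed

lemma path_point_Suc:
  assumes "i < length \<nu>"
  shows "path_point \<nu> (Suc i) =
    (case \<nu> ! i of East \<Rightarrow> (Suc (fst (path_point \<nu> i)), snd (path_point \<nu> i))
      | North \<Rightarrow> (fst (path_point \<nu> i), Suc (snd (path_point \<nu> i))))"
  using assms by (auto simp: path_point_def take_Suc_conv_app_nth split: step.splits)

lemma in_step_segment:
  fixes x y :: real
  assumes "i < length \<nu>"
    and "(x, y) \<in> closed_segment (real_point (path_point \<nu> i)) (real_point (path_point \<nu> (Suc i)))"
  shows "\<nu> ! i = East \<and> y = snd (path_point \<nu> i) \<and> fst (path_point \<nu> i) \<le> x \<and> x \<le> fst (path_point \<nu> (Suc i))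
      \<or> \<nu> ! i = North \<and> x = fst (path_point \<nu> i) \<and> snd (path_point \<nu> i) \<le> y"
proof -
  have "\<exists>u\<ge>0. u \<le> 1 \<and>
    (x, y) = (1 - u) *\<^sub>R real_point (path_point \<nu> i) + u *\<^sub>R real_point (path_point \<nu> (Suc i))"
    using assms(2) by (simp only: in_segment(1))
  then obtain u where u: "0 \<le> u" "u \<le> 1"
    "(x, y) = (1 - u) *\<^sub>R real_point (path_point \<nu> i) + u *\<^sub>R real_point (path_point \<nu> (Suc i))"
    by (elim exE conjE)
  obtain X Y where P: "path_point \<nu> i = (X, Y)" by fastforce
  show ?thesis
  proof (cases "\<nu> ! i")
    case North
    then have "x = (1 - u) * X + u * X" "y = (1 - u) * Y + u * (Y + 1)"
      using u(3) path_point_Suc[OF assms(1)] P by (simp_all add: real_point_def)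
    then have "x = X" "y = Y + u" by (simp_all add: algebra_simps)
    then show ?thesis using North P u by simp
  next
    case East
    then have "x = (1 - u) * X + u * (X + 1)" "y = (1 - u) * Y + u * Y"
      using u(3) path_point_Suc[OF assms(1)] P by (simp_all add: real_point_def)
    then have "x = X + u" "y = Y" by (simp_all add: algebra_simps)
    then show ?thesis using East P u path_point_Suc[OF assms(1)] by simp
  qed
qed

lemma east_segment:
  fixes x :: real
  assumes "i < length \<nu>" and "\<nu> ! i = East"
    and "real (fst (path_point \<nu> i)) \<le> x" and "x \<le> fst (path_point \<nu> i) + 1"
  shows "(x, real (snd (path_point \<nu> i))) \<in> curve \<nu>"
proof -
  have "(x, real (snd (path_point \<nu> i))) \<in>
      closed_segment (real_point (path_point \<nu> i)) (real_point (path_point \<nu> (Suc i)))"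
    unfolding in_segment
    by (rule exI[of _ "x - fst (path_point \<nu> i)"])
      (use assms path_point_Suc[OF assms(1)] in \<open>auto simp: real_point_def algebra_simps\<close>)
  then show ?thesis using assms(1) unfolding curve_def by auto
qed

text \<open>The path never turns south or west, so at every abscissa that it has passed it runs weakly below
  its current height.\<close>
lemma curve_below_vertex:
  fixes x :: real
  assumes "\<nu> \<noteq> []" and "i \<le> length \<nu>" and "0 \<le> x" and "x \<le> fst (path_point \<nu> i)"
  shows "\<exists>y. y \<le> real (snd (path_point \<nu> i)) \<and> (x, y) \<in> curve \<nu>"
  using assms(2,4)
proof (induction i)
  case 0
  then have "x = 0" using assms(3) by (simp add: path_point_def)
  then show ?case using vertex_in_curve[of 0 \<nu>] assms(1) by (auto simp: path_point_def real_point_def)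
next
  case (Suc i)
  then have i: "i < length \<nu>" by simp
  note s = path_point_Suc[OF i]
  show ?case
  proof (cases "x \<le> fst (path_point \<nu> i)")
    case True
    then obtain y where "y \<le> real (snd (path_point \<nu> i))" "(x, y) \<in> curve \<nu>"
      using Suc by auto
    then show ?thesis using s by (intro exI[of _ y]) (auto split: step.splits)
  next
    case False
    then have "\<nu> ! i = East" using s Suc.prems by (cases "\<nu> ! i") auto
    then have "(x, real (snd (path_point \<nu> i))) \<in> curve \<nu>"
      using east_segment[OF i] False Suc.prems s by auto
    then show ?thesis using s \<open>\<nu> ! i = East\<close> by auto
  qed
qed

lemma curve_below:
  fixes x y :: real
  assumes "(x, y) \<in> curve \<nu>" and "0 \<le> x'" and "x' \<le> x"
  shows "\<exists>y'\<le>y. (x', y') \<in> curve \<nu>"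
proof -
  obtain i where i: "i < length \<nu>"
    "(x, y) \<in> closed_segment (real_point (path_point \<nu> i)) (real_point (path_point \<nu> (Suc i)))"
    using assms(1) unfolding curve_def by auto
  then have "\<nu> \<noteq> []" by auto
  consider (E) "\<nu> ! i = East" "y = snd (path_point \<nu> i)" "fst (path_point \<nu> i) \<le> x" "x \<le> fst (path_point \<nu> (Suc i))"
    | (N) "\<nu> ! i = North" "x = fst (path_point \<nu> i)" "snd (path_point \<nu> i) \<le> y"
    using in_step_segment[OF i] by blast
  then show ?thesis
  proof cases
    case E
    show ?thesis
    proof (cases "x' \<le> fst (path_point \<nu> i)")
      case True
      then show ?thesis using curve_below_vertex[of \<nu> i x'] assms(2) i(1) \<open>\<nu> \<noteq> []\<close> E(2) by auto
    next
      case False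
      then have "(x', y) \<in> curve \<nu>"
        using east_segment[OF i(1) E(1), of x'] E assms(3) path_point_Suc[OF i(1)] by auto
      then show ?thesis by auto
    qed
  next
    case N
    then obtain y' where "y' \<le> real (snd (path_point \<nu> i))" "(x', y') \<in> curve \<nu>"
      using curve_below_vertex[of \<nu> i x'] assms(2,3) i(1) \<open>\<nu> \<noteq> []\<close> by auto
    then show ?thesis using N(3) by (intro exI[of _ y']) simp
  qed
qed

text \<open>The south-east corner is the critical point of a rectangle: the diagram is closed under moving
  west and north.\<close>
lemma rectangle_subset_ferrers_iff:
  "rectangle p q \<subseteq> ferrers \<nu> \<longleftrightarrow>
    max (snd p) (snd q) \<le> height \<nu> \<and> (max (fst p) (fst q), min (snd p) (snd q)) \<in> lattice_points \<nu>"
proof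
  assume sub: "rectangle p q \<subseteq> ferrers \<nu>"
  have "(real (max (fst p) (fst q)), real (min (snd p) (snd q))) \<in> rectangle p q"
    and "(real (max (fst p) (fst q)), real (max (snd p) (snd q))) \<in> rectangle p q"
    by (auto simp: rectangle_def)
  with sub have "(real (max (fst p) (fst q)), real (min (snd p) (snd q))) \<in> ferrers \<nu>"
    and "(real (max (fst p) (fst q)), real (max (snd p) (snd q))) \<in> ferrers \<nu>" by blast+
  then show "max (snd p) (snd q) \<le> height \<nu> \<and> (max (fst p) (fst q), min (snd p) (snd q)) \<in> lattice_points \<nu>"
    by (auto simp: lattice_points_def real_point_def ferrers_def)
next
  assume a: "max (snd p) (snd q) \<le> height \<nu> \<and> (max (fst p) (fst q), min (snd p) (snd q)) \<in> lattice_points \<nu>"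
  let ?X = "real (max (fst p) (fst q))" and ?Y = "real (min (snd p) (snd q))"
  have X: "?X \<le> real (width \<nu>)" using a by (auto simp: lattice_points_def real_point_def ferrers_def)
  obtain y' where y': "y' \<le> ?Y" "(?X, y') \<in> curve \<nu>"
    using a by (auto simp: lattice_points_def real_point_def ferrers_def)
  show "rectangle p q \<subseteq> ferrers \<nu>"
  proof
    fix z assume "z \<in> rectangle p q"
    then obtain x y where z: "z = (x, y)" "real (min (fst p) (fst q)) \<le> x" "x \<le> ?X" "?Y \<le> y"
      "y \<le> real (max (snd p) (snd q))" by (auto simp: rectangle_def)
    have "0 \<le> x" using z(2) by (rule order_trans[rotated]) simp
    moreover have "0 \<le> y" using z(4) by (rule order_trans[rotated]) simp
    moreover obtain y'' where "y'' \<le> y'" "(x, y'') \<in> curve \<nu>"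
      using curve_below[OF y'(2) \<open>0 \<le> x\<close> z(3)] by auto
    moreover have "y \<le> real (height \<nu>)" using z(5) a by (meson of_nat_le_iff order_trans)
    ultimately show "z \<in> ferrers \<nu>"
      using z X y'(1) by (auto simp: ferrers_def intro!: exI[of _ y''])
  qed
qed

locale composition_path =
  fixes n :: nat and k :: "nat \<Rightarrow> nat"
  assumes n_pos: "n \<ge> 1" and k_pos: "\<And>i. i \<in> {1..n} \<Longrightarrow> k i \<ge> 1"
begin

abbreviation "\<nu> \<equiv> nu_path n k"

abbreviation "A \<equiv> lattice_points \<nu>"

definition row_length :: "nat \<Rightarrow> nat"
  where "row_length h = (\<Sum>i\<in>{n - h<..n}. k i)"

lemma row_length_0 [simp]: "row_length 0 = 0"
  by (simp add: row_length_def)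

lemma row_length_Suc: "h < n \<Longrightarrow> row_length (Suc h) = row_length h + k (n - h)"
proof -
  assume "h < n"
  then have "{n - Suc h<..n} = insert (n - h) {n - h<..n}" by auto
  then show ?thesis by (simp add: row_length_def)
qed

lemma row_length_step: "h < n \<Longrightarrow> Suc (row_length h) \<le> row_length (Suc h)"
  using row_length_Suc[of h] k_pos[of "n - h"] n_pos by auto

text \<open>As all \<open>k i\<close> are positive, the rows grow strictly from bottom to top, so below the end of a row
  there is no point of the diagram.\<close>
lemma row_length_gap: "h \<le> h' \<Longrightarrow> h' \<le> n \<Longrightarrow> row_length h + (h' - h) \<le> row_length h'"
proof (induction h' rule: dec_induct)
  case base
  then show ?case by simp
next
  case (step m)
  then show ?case using row_length_step[of m] by auto
qed

lemma row_length_mono: "h \<le> h' \<Longrightarrow> h' \<le> n \<Longrightarrow> row_length h \<le> row_length h'"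
  using row_length_gap[of h h'] by linarith

lemma row_length_less: "h < h' \<Longrightarrow> h' \<le> n \<Longrightarrow> row_length h < row_length h'"
  using row_length_gap[of h h'] by linarith

lemma nu_path_blocks: "\<nu> = concat (map (\<lambda>c. North # replicate c East) (map k (rev [1..<Suc n])))"
  by (simp add: nu_path_def o_def)

lemma height_nu [simp]: "height \<nu> = n"
  unfolding nu_path_blocks counts_of_full_blocks by simp

lemma sum_list_take_blocks:
  assumes "h \<le> n" shows "sum_list (take h (map k (rev [1..<Suc n]))) = row_length h"
  using assms
proof (induction h)
  case 0
  then show ?case by simp
next
  case (Suc h)
  then have "rev [1..<Suc n] ! h = n - h" by (simp add: rev_nth del: upt_Suc)
  moreover have "take (Suc h) (map k (rev [1..<Suc n])) = take h (map k (rev [1..<Suc n])) @ [map k (rev [1..<Suc n]) ! h]"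
    using Suc.prems by (intro take_Suc_conv_app_nth) simp
  ultimately show ?case using Suc row_length_Suc[of h] by (simp del: upt_Suc)
qed

lemma width_nu [simp]: "width \<nu> = row_length n"
  unfolding nu_path_blocks counts_of_full_blocks using sum_list_take_blocks[of n] by (simp del: upt_Suc)

lemma N_dim_eq: "N_dim n k = row_length n"
proof -
  have "N_dim n k = (\<Sum>i=1..n. 1 + (k i - 1))" unfolding N_dim_def sum.distrib by simp
  also have "\<dots> = (\<Sum>i=1..n. k i)" by (rule sum.cong) (use k_pos in force)+
  also have "{1..n} = {n - n<..n}" by auto
  finally show ?thesis by (simp add: row_length_def)
qed

lemma vertex_bound:
  "fst (path_point \<nu> t) \<le> row_length (snd (path_point \<nu> t))" "snd (path_point \<nu> t) \<le> n"
proof -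
  show le: "snd (path_point \<nu> t) \<le> n"
  proof -
    have "height \<nu> = count_list (take t \<nu>) North + count_list (drop t \<nu>) North"
      by (metis append_take_drop_id count_list_append)
    then show ?thesis by (simp add: path_point_def)
  qed
  show "fst (path_point \<nu> t) \<le> row_length (snd (path_point \<nu> t))"
    using east_count_le_blocks[of t "map k (rev [1..<Suc n])"] sum_list_take_blocks[OF le]
    unfolding path_point_def fst_conv snd_conv nu_path_blocks[symmetric] by simp
qed

lemma row_end_vertex:
  assumes "h \<le> n" shows "\<exists>t\<le>length \<nu>. path_point \<nu> t = (row_length h, h)"
proof -
  define blk where "blk = (\<lambda>c. North # replicate c East)"
  define ks where "ks = map k (rev [1..<Suc n])"
  have \<nu>: "\<nu> = concat (map blk (take h ks)) @ concat (map blk (drop h ks))"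
    unfolding nu_path_blocks ks_def[symmetric] blk_def[symmetric]
    by (metis append_take_drop_id concat_append map_append)
  have "length ks = n" by (simp add: ks_def)
  then have "path_point \<nu> (length (concat (map blk (take h ks)))) = (row_length h, h)"
    using assms sum_list_take_blocks[OF assms, folded ks_def]
    unfolding path_point_def \<nu> by (simp add: blk_def counts_of_full_blocks)
  then show ?thesis using \<nu> by (metis le_add1 length_append)
qed

lemma nu_nonempty: "\<nu> \<noteq> []"
  using height_nu n_pos by force

lemma lattice_iff: "(a, h) \<in> A \<longleftrightarrow> h \<le> n \<and> a \<le> row_length h"
proof
  assume "(a, h) \<in> A"
  then obtain y where h: "h \<le> n" and y: "y \<le> real h" "(real a, y) \<in> curve \<nu>"
    by (auto simp: lattice_points_def real_point_def ferrers_def)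
  obtain i where i: "i < length \<nu>"
    "(real a, y) \<in> closed_segment (real_point (path_point \<nu> i)) (real_point (path_point \<nu> (Suc i)))"
    using y(2) unfolding curve_def by auto
  have "a \<le> row_length h"
    using in_step_segment[OF i]
  proof (elim disjE conjE)
    assume *: "\<nu> ! i = East" "y = snd (path_point \<nu> i)" "real a \<le> fst (path_point \<nu> (Suc i))"
    then have "a \<le> row_length (snd (path_point \<nu> (Suc i)))" "snd (path_point \<nu> (Suc i)) \<le> h"
      using vertex_bound(1)[of "Suc i"] y(1) path_point_Suc[OF i(1)] by auto
    then show ?thesis using row_length_mono h by (meson order_trans)
  next
    assume *: "real a = real (fst (path_point \<nu> i))" "real (snd (path_point \<nu> i)) \<le> y"
    then have "a \<le> row_length (snd (path_point \<nu> i))" "snd (path_point \<nu> i) \<le> h"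
      using vertex_bound(1)[of i] y(1) by auto
    then show ?thesis using row_length_mono h by (meson order_trans)
  qed
  then show "h \<le> n \<and> a \<le> row_length h" using h by simp
next
  assume h: "h \<le> n \<and> a \<le> row_length h"
  then obtain t where t: "t \<le> length \<nu>" "path_point \<nu> t = (row_length h, h)"
    using row_end_vertex by blast
  have "\<exists>y. y \<le> real h \<and> (real a, y) \<in> curve \<nu>"
    using curve_below_vertex[OF nu_nonempty t(1), of "real a"] t(2) h by simp
  moreover have "a \<le> row_length n" using h row_length_mono[of h n] by simp
  ultimately show "(a, h) \<in> A"
    using h by (auto simp: lattice_points_def real_point_def ferrers_def)
qed

lemma lattice_mono: "(a, h) \<in> A \<Longrightarrow> a' \<le> a \<Longrightarrow> h \<le> h' \<Longrightarrow> h' \<le> n \<Longrightarrow> (a', h') \<in> A"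
  unfolding lattice_iff using row_length_mono[of h h'] by auto

lemma lattice_finite: "finite A"
proof (rule finite_subset)
  show "A \<subseteq> {..row_length n} \<times> {..n}" using lattice_iff row_length_mono[of _ n] by force
qed simp

lemma incompatible_iff:
  assumes "(a, h) \<in> A" "(a', h') \<in> A"
  shows "incompatible \<nu> (a, h) (a', h') \<longleftrightarrow>
    a < a' \<and> h < h' \<and> (a', h) \<in> A \<or> a' < a \<and> h' < h \<and> (a, h') \<in> A"
  using assms unfolding incompatible_def rectangle_subset_ferrers_iff strictly_southwest_def
  by (auto simp: lattice_iff max_def min_def)

lemma unit_box_iff: "unit_box_in \<nu> (a, h) \<longleftrightarrow> (Suc a, h) \<in> A \<and> h < n"
  unfolding unit_box_in_def rectangle_subset_ferrers_iff by (auto simp: lattice_iff)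

section \<open>Compatible sets and maximal compatible sets\<close>

lemma face_iff:
  "I \<in> tamari_complex \<nu> \<longleftrightarrow>
    I \<subseteq> A \<and> (\<forall>a h a' h'. (a, h) \<in> I \<longrightarrow> (a', h') \<in> I \<longrightarrow> a < a' \<longrightarrow> h < h' \<longrightarrow> (a', h) \<notin> A)"
  (is "_ \<longleftrightarrow> _ \<and> ?C")
proof -
  have "pairwise (\<lambda>p q. \<not> incompatible \<nu> p q) I \<longleftrightarrow> ?C" if "I \<subseteq> A"
  proof
    assume pw: "pairwise (\<lambda>p q. \<not> incompatible \<nu> p q) I"
    show ?C
    proof (intro allI impI)
      fix a h a' h' assume *: "(a, h) \<in> I" "(a', h') \<in> I" "a < a'" "h < h'"
      then have "\<not> incompatible \<nu> (a, h) (a', h')" using pw unfolding pairwise_def by auto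
      then show "(a', h) \<notin> A" using * incompatible_iff[of a h a' h'] that by blast
    qed
  next
    assume C: ?C
    show "pairwise (\<lambda>p q. \<not> incompatible \<nu> p q) I"
    proof (rule pairwiseI)
      fix p q assume *: "p \<in> I" "q \<in> I"
      obtain a h a' h' where pq: "p = (a, h)" "q = (a', h')" by fastforce
      show "\<not> incompatible \<nu> p q"
        using * C that incompatible_iff[of a h a' h'] unfolding pq by blast
    qed
  qed
  then show ?thesis unfolding tamari_complex_def by blast
qed

lemma face_in_lattice: "I \<in> tamari_complex \<nu> \<Longrightarrow> (a, h) \<in> I \<Longrightarrow> (a, h) \<in> A"
  using face_iff by blast

lemma face_height: "I \<in> tamari_complex \<nu> \<Longrightarrow> (a, h) \<in> I \<Longrightarrow> h \<le> n"
  using face_in_lattice lattice_iff by blast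

lemma face_no_clash:
  "I \<in> tamari_complex \<nu> \<Longrightarrow> (a, h) \<in> I \<Longrightarrow> (a', h') \<in> I \<Longrightarrow> a < a' \<Longrightarrow> h < h' \<Longrightarrow> (a', h) \<in> A \<Longrightarrow> False"
  using face_iff by blast

lemma face_subset: "I \<in> tamari_complex \<nu> \<Longrightarrow> J \<subseteq> I \<Longrightarrow> J \<in> tamari_complex \<nu>"
  unfolding face_iff by blast

lemma face_insertI:
  assumes "I \<in> tamari_complex \<nu>" and "(a, h) \<in> A"
    and "\<And>a' h'. (a', h') \<in> I \<Longrightarrow> a' < a \<Longrightarrow> h' < h \<Longrightarrow> (a, h') \<notin> A"
    and "\<And>a' h'. (a', h') \<in> I \<Longrightarrow> a < a' \<Longrightarrow> h < h' \<Longrightarrow> (a', h) \<notin> A"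
  shows "insert (a, h) I \<in> tamari_complex \<nu>"
  using assms unfolding face_iff by (simp; metis less_irrefl)

lemma tree_face: "nu_tree \<nu> T \<Longrightarrow> T \<in> tamari_complex \<nu>"
  by (simp add: nu_tree_def)

lemma tree_maximal: "nu_tree \<nu> T \<Longrightarrow> J \<in> tamari_complex \<nu> \<Longrightarrow> T \<subseteq> J \<Longrightarrow> J = T"
  unfolding nu_tree_def by blast

lemma tree_memI:
  assumes "nu_tree \<nu> T" and "(a, h) \<in> A"
    and "\<And>a' h'. (a', h') \<in> T \<Longrightarrow> a' < a \<Longrightarrow> h' < h \<Longrightarrow> (a, h') \<notin> A"
    and "\<And>a' h'. (a', h') \<in> T \<Longrightarrow> a < a' \<Longrightarrow> h < h' \<Longrightarrow> (a', h) \<notin> A"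
  shows "(a, h) \<in> T"
proof -
  have "insert (a, h) T \<in> tamari_complex \<nu>"
    by (rule face_insertI[OF tree_face[OF assms(1)] assms(2)]) (fact assms(3,4))+
  then show ?thesis using tree_maximal[OF assms(1)] by blast
qed

lemma finite_faces: "finite (tamari_complex \<nu>)"
proof (rule finite_subset)
  show "tamari_complex \<nu> \<subseteq> Pow A" by (auto simp: tamari_complex_def)
  show "finite (Pow A)" using lattice_finite by blast
qed

lemma face_finite: "I \<in> tamari_complex \<nu> \<Longrightarrow> finite I"
  unfolding tamari_complex_def by (auto intro: finite_subset[OF _ lattice_finite])

lemma face_extends_to_tree:
  assumes "I \<in> tamari_complex \<nu>" obtains T where "nu_tree \<nu> T" "I \<subseteq> T"
proof -
  obtain T where "T \<in> tamari_complex \<nu>" "I \<subseteq> T" "\<forall>J\<in>tamari_complex \<nu>. T \<subseteq> J \<longrightarrow> T = J"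
    using finite_has_maximal2[OF finite_faces assms] by metis
  then have "nu_tree \<nu> T" unfolding nu_tree_def by metis
  with \<open>I \<subseteq> T\<close> show thesis by (rule that[rotated])
qed

text \<open>The root and the ends of the rows are compatible with every point of the diagram.\<close>
lemma root_in_tree: "nu_tree \<nu> T \<Longrightarrow> (0, n) \<in> T"
proof (rule tree_memI)
  fix a' h' assume "nu_tree \<nu> T" "(a', h') \<in> T" "n < h'"
  then show "(a', n) \<notin> A" using face_height[OF tree_face] by (metis leD)
qed (auto simp: lattice_iff)

lemma row_end_in_tree:
  assumes "nu_tree \<nu> T" and "h \<le> n" shows "(row_length h, h) \<in> T"
proof (rule tree_memI[OF assms(1)])
  fix a' h' assume "h' < h"
  then show "(row_length h, h') \<notin> A" using row_length_less[of h' h] assms(2) by (auto simp: lattice_iff)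
qed (use assms(2) in \<open>auto simp: lattice_iff\<close>)

text \<open>The main source of nodes: the lowest row with a node to the left of column \<open>a\<close>, among the
  rows that meet the column, meets it in a node. A conflict from the south-west would come from a
  lower such row, and a conflict from the north-east would already conflict with the node on the
  left.\<close>
lemma column_node:
  assumes T: "nu_tree \<nu> T" and A: "(a, h) \<in> A" and left: "(b, h) \<in> T" "b < a"
    and none: "\<And>a' h'. (a', h') \<in> T \<Longrightarrow> a' < a \<Longrightarrow> h' < h \<Longrightarrow> (a, h') \<notin> A"
  shows "(a, h) \<in> T"
proof (rule tree_memI[OF T A none])
  fix a' h' assume *: "(a', h') \<in> T" "a < a'" "h < h'"
  then show "(a', h) \<notin> A" using face_no_clash[OF tree_face[OF T] left(1) *(1)] left(2) by auto
qed

lemma column_node_above: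
  assumes T: "nu_tree \<nu> T" and "0 < a" "m < n" and A: "(a, Suc m) \<in> A"
    and none: "\<And>a' h'. (a', h') \<in> T \<Longrightarrow> a' < a \<Longrightarrow> h' \<le> m \<Longrightarrow> (a, h') \<notin> A"
  obtains h where "m < h" "(a, h) \<in> T"
proof -
  define P where "P = (\<lambda>h. m < h \<and> (\<exists>b<a. (b, h) \<in> T))"
  have "P n" using assms(2,3) root_in_tree[OF T] unfolding P_def by auto
  then have L: "P (LEAST h. P h)" and Ln: "(LEAST h. P h) \<le> n" by (auto intro: LeastI Least_le)
  then obtain b where b: "m < (LEAST h. P h)" "b < a" "(b, LEAST h. P h) \<in> T" unfolding P_def by blast
  have "(a, LEAST h. P h) \<in> T"
  proof (rule column_node[OF T _ b(3,2)])
    show "(a, LEAST h. P h) \<in> A" using lattice_mono[OF A, of a] b(1) Ln by auto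
    fix a' h' assume *: "(a', h') \<in> T" "a' < a" "h' < (LEAST h. P h)"
    have "\<not> P h'" using not_less_Least[OF *(3)] .
    then have "h' \<le> m" unfolding P_def using * by auto
    then show "(a, h') \<notin> A" using none * by blast
  qed
  then show thesis using that b(1) by blast
qed

text \<open>To the left of a leftmost node, neither its own row nor, by compatibility, the rows below
  contain nodes, so the next row with a node on the left lies higher.\<close>
lemma leftmost_has_north:
  assumes T: "nu_tree \<nu> T" and q: "(a, h) \<in> T" "h < n" and left: "\<And>a'. a' < a \<Longrightarrow> (a', h) \<notin> T"
  obtains h' where "h < h'" "(a, h') \<in> T"
proof (cases "a = 0")
  case True
  then show thesis using that[of n] root_in_tree[OF T] q by auto
next
  case False
  have A: "(a, h) \<in> A" using face_in_lattice[OF tree_face[OF T] q(1)] .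
  show thesis
  proof (rule column_node_above[OF T, of a h])
    show "(a, Suc h) \<in> A" using lattice_mono[OF A] q(2) by auto
    fix a' h' assume *: "(a', h') \<in> T" "a' < a" "h' \<le> h"
    show "(a, h') \<notin> A"
      using face_no_clash[OF tree_face[OF T] *(1) q(1) *(2)] * left by (cases "h' = h") auto
  qed (use False q that in auto)
qed

text \<open>Rows below the lowest point of the column do not meet it, so the condition on nodes to the left
  is void there.\<close>
lemma column_nonempty:
  assumes T: "nu_tree \<nu> T" and a: "a \<le> row_length n"
  obtains h where "(a, h) \<in> T"
proof (cases "a = 0")
  case True
  then show thesis using that[of n] root_in_tree[OF T] by auto
next
  case False
  define h where "h = (LEAST h. (a, h) \<in> A)"
  have "(a, n) \<in> A" using a by (simp add: lattice_iff)
  then have h: "(a, h) \<in> A" "h \<le> n" unfolding h_def by (auto intro: LeastI Least_le)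
  have "h \<noteq> 0"
  proof
    assume "h = 0"
    then show False using h(1) False by (simp add: lattice_iff)
  qed
  then obtain m where m: "h = Suc m" using not0_implies_Suc by blast
  show thesis
  proof (rule column_node_above[OF T, of a m])
    fix a' h' assume "h' \<le> m"
    then have "h' < (LEAST h. (a, h) \<in> A)" using m h_def by simp
    then show "(a, h') \<notin> A" by (rule not_less_Least)
  qed (use False h m that in auto)
qed

lemma not_north_and_west:
  assumes "I \<in> tamari_complex \<nu>" "(a, h) \<in> I" "(a, h') \<in> I" "h < h'" "(b, h) \<in> I" "b < a"
  shows False
  using face_no_clash[OF assms(1,5,3,6,4)] face_in_lattice[OF assms(1,2)] by blast

text \<open>Every node other than the root has either a node to its west or a node to its north, never
  both. Counting nodes by rows and by columns therefore counts only the root twice.\<close>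
lemma card_tree:
  assumes T: "nu_tree \<nu> T" shows "card T = n + row_length n + 1"
proof -
  note face = tree_face[OF T]
  define L where "L = {(a, h) \<in> T. \<forall>b<a. (b, h) \<notin> T}"
  define U where "U = {(a, h) \<in> T. \<forall>g>h. (a, g) \<notin> T}"
  have fin: "finite T" using face_finite[OF face] .
  have finL: "finite L" "finite U" by (auto simp: L_def U_def intro: finite_subset[OF _ fin])
  have "bij_betw snd L {0..n}"
  proof (rule bij_betw_imageI)
    show "inj_on snd L"
    proof (rule inj_onI)
      fix p q assume "p \<in> L" "q \<in> L" "snd p = snd q"
      then show "p = q" unfolding L_def by (cases p; cases q; simp) (metis linorder_neqE_nat)
    qed
    show "snd ` L = {0..n}"
    proof
      show "snd ` L \<subseteq> {0..n}" using face_height[OF face] by (auto simp: L_def)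
      show "{0..n} \<subseteq> snd ` L"
      proof
        fix h assume "h \<in> {0..n}"
        then have ex: "(row_length h, h) \<in> T" using row_end_in_tree[OF T] by simp
        then have "((LEAST a. (a, h) \<in> T), h) \<in> L"
          unfolding L_def using LeastI[of "\<lambda>a. (a, h) \<in> T"] not_less_Least by auto
        then show "h \<in> snd ` L" by force
      qed
    qed
  qed
  then have cL: "card L = n + 1" using bij_betw_same_card by fastforce
  have "bij_betw fst U {0..row_length n}"
  proof (rule bij_betw_imageI)
    show "inj_on fst U"
    proof (rule inj_onI)
      fix p q assume "p \<in> U" "q \<in> U" "fst p = fst q"
      then show "p = q" unfolding U_def by (cases p; cases q; simp) (metis linorder_neqE_nat)
    qed
    show "fst ` U = {0..row_length n}"
    proof
      show "fst ` U \<subseteq> {0..row_length n}"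
        using face_in_lattice[OF face] row_length_mono[of _ n] by (fastforce simp: U_def lattice_iff)
      show "{0..row_length n} \<subseteq> fst ` U"
      proof
        fix a assume "a \<in> {0..row_length n}"
        then obtain h where h: "(a, h) \<in> T" using column_nonempty[OF T] by auto
        define g where "g = Max {h. (a, h) \<in> T}"
        have fin': "finite {h. (a, h) \<in> T}"
          using face_height[OF face] by (meson finite_nat_set_iff_bounded_le mem_Collect_eq)
        have "(a, g) \<in> T" unfolding g_def using Max_in[OF fin'] h by blast
        moreover have "(a, g') \<notin> T" if "g < g'" for g'
          using Max_ge[OF fin', of g'] that unfolding g_def by auto
        ultimately have "(a, g) \<in> U" unfolding U_def by auto
        then show "a \<in> fst ` U" by force
      qed
    qed
  qed
  then have cU: "card U = row_length n + 1" using bij_betw_same_card by fastforce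
  have "L \<union> U = T"
  proof
    show "T \<subseteq> L \<union> U"
    proof
      fix q assume q: "q \<in> T"
      obtain a h where ah: "q = (a, h)" by fastforce
      show "q \<in> L \<union> U"
        using not_north_and_west[OF face, of a h] q unfolding ah L_def U_def by blast
    qed
  qed (auto simp: L_def U_def)
  moreover have "L \<inter> U = {(0, n)}"
  proof
    show "{(0, n)} \<subseteq> L \<inter> U"
      using root_in_tree[OF T] face_height[OF face] by (force simp: L_def U_def)
    show "L \<inter> U \<subseteq> {(0, n)}"
    proof
      fix q assume q: "q \<in> L \<inter> U"
      obtain a h where ah: "q = (a, h)" by fastforce
      have *: "(a, h) \<in> T" "\<And>b. b < a \<Longrightarrow> (b, h) \<notin> T" "\<And>g. h < g \<Longrightarrow> (a, g) \<notin> T"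
        using q unfolding ah L_def U_def by auto
      have "h = n"
        using leftmost_has_north[OF T *(1) _ *(2)] *(3) face_height[OF face *(1)] by (metis le_neq_implies_less)
      moreover have "a = 0" using *(2) root_in_tree[OF T] \<open>h = n\<close> by blast
      ultimately show "q \<in> {(0, n)}" using ah by simp
    qed
  qed
  ultimately have "card T + 1 = card L + card U" using card_Un_Int[OF finL] by simp
  then show ?thesis using cL cU by simp
qed

text \<open>All trees have the same number of nodes, so counting certifies maximality.\<close>
lemma tree_by_card:
  assumes "I \<in> tamari_complex \<nu>" and "card I = n + row_length n + 1"
  shows "nu_tree \<nu> I"
proof -
  obtain T where "nu_tree \<nu> T" "I \<subseteq> T" using face_extends_to_tree[OF assms(1)] .
  then have "I = T" using card_tree assms(2) face_finite[OF tree_face] card_subset_eq by metis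
  then show ?thesis using \<open>nu_tree \<nu> T\<close> by simp
qed

section \<open>Rotations\<close>

lemma next_north_exists:
  assumes "(a, h') \<in> T" "h < h'" obtains p where "next_north T (a, h) (a, p)"
proof -
  define p where "p = (LEAST p. h < p \<and> (a, p) \<in> T)"
  have "h < p \<and> (a, p) \<in> T" unfolding p_def by (rule LeastI) (use assms in auto)
  moreover have "(a, b) \<notin> T" if "h < b" "b < p" for b using not_less_Least[of b "\<lambda>p. h < p \<and> (a, p) \<in> T"] that
    unfolding p_def by auto
  ultimately show thesis using that unfolding next_north_def by auto
qed

lemma next_east_exists:
  assumes "(c', h) \<in> T" "a < c'" obtains c where "next_east T (a, h) (c, h)"
proof -
  define c where "c = (LEAST c. a < c \<and> (c, h) \<in> T)"
  have "a < c \<and> (c, h) \<in> T" unfolding c_def by (rule LeastI) (use assms in auto)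
  moreover have "(b, h) \<notin> T" if "a < b" "b < c" for b using not_less_Least[of b "\<lambda>c. a < c \<and> (c, h) \<in> T"] that
    unfolding c_def by auto
  ultimately show thesis using that unfolding next_east_def by auto
qed

text \<open>A conflict with the new corner of the rectangle would already be a conflict with one of the
  three old ones, or contradict that they are neighbours.\<close>
lemma right_flip_face:
  assumes I: "I \<in> tamari_complex \<nu>" and q: "(a, h) \<in> I"
    and north: "next_north I (a, h) (a, p)" and east: "next_east I (a, h) (c, h)"
  shows "insert (c, p) (I - {(a, h)}) \<in> tamari_complex \<nu>" and "(c, p) \<notin> I"
proof -
  have p: "(a, p) \<in> I" "h < p" "\<And>b. h < b \<Longrightarrow> b < p \<Longrightarrow> (a, b) \<notin> I"
    using north by (auto simp: next_north_def)
  have c: "(c, h) \<in> I" "a < c" "\<And>b. a < b \<Longrightarrow> b < c \<Longrightarrow> (b, h) \<notin> I"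
    using east by (auto simp: next_east_def)
  have A: "(c, h) \<in> A" "p \<le> n" using face_in_lattice[OF I c(1)] face_height[OF I p(1)] by auto
  then have cA: "(c, g) \<in> A" if "h \<le> g" "g \<le> p" for g
    using lattice_mono[OF A(1), of c g] that by auto
  show "(c, p) \<notin> I" using face_no_clash[OF I q _ c(2) p(2)] A by blast
  show "insert (c, p) (I - {(a, h)}) \<in> tamari_complex \<nu>"
  proof (rule face_insertI)
    show "I - {(a, h)} \<in> tamari_complex \<nu>" using face_subset[OF I] by blast
    show "(c, p) \<in> A" using cA p(2) by simp
  next
    fix b j assume *: "(b, j) \<in> I - {(a, h)}" "b < c" "j < p"
    show "(c, j) \<notin> A"
    proof
      assume cj: "(c, j) \<in> A"
      have b: "(b, j) \<in> I" using * by simp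
      consider "j < h" | "j = h" | "h < j" by linarith
      then show False
      proof cases
        case 1
        then show False using face_no_clash[OF I b c(1) *(2)] cj by blast
      next
        case 2
        then have "b < a" using * c(3) by (metis DiffD1 DiffD2 linorder_neqE_nat singletonI)
        then show False using not_north_and_west[OF I q p(1,2)] b 2 by blast
      next
        case 3
        have "b \<noteq> a" using p(3) 3 *(3) b by blast
        moreover have "\<not> b < a"
          using face_no_clash[OF I b p(1) _ *(3)] lattice_mono[OF cj, of a j] c(2) face_height[OF I b] by auto
        moreover have "\<not> a < b"
          using face_no_clash[OF I q b _ 3] lattice_mono[OF A(1), of b h] *(2) p(2) A(2) by auto
        ultimately show False by linarith
      qed
    qed
  next
    fix b j assume *: "(b, j) \<in> I - {(a, h)}" "c < b" "p < j"
    then show "(b, p) \<notin> A" using face_no_clash[OF I p(1), of b j] c(2) by auto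
  qed
qed

text \<open>The inverse move, for the same reason.\<close>
lemma left_flip_face:
  assumes I: "I \<in> tamari_complex \<nu>" and q: "(a, h) \<in> I"
    and b: "(b, h) \<in> I" "b < a" "\<And>c. b < c \<Longrightarrow> c < a \<Longrightarrow> (c, h) \<notin> I"
    and s: "(a, s) \<in> I" "s < h" "\<And>g. s < g \<Longrightarrow> g < h \<Longrightarrow> (a, g) \<notin> I"
  shows "insert (b, s) (I - {(a, h)}) \<in> tamari_complex \<nu>" and "(b, s) \<notin> I"
proof -
  have A: "(a, s) \<in> A" "h \<le> n" using face_in_lattice[OF I s(1)] face_height[OF I q(1)] by auto
  show "(b, s) \<notin> I" using face_no_clash[OF I _ q b(2) s(2)] A by blast
  show "insert (b, s) (I - {(a, h)}) \<in> tamari_complex \<nu>"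
  proof (rule face_insertI)
    show "I - {(a, h)} \<in> tamari_complex \<nu>" using face_subset[OF I] by blast
    show "(b, s) \<in> A" using lattice_mono[OF A(1), of b s] b(2) s(2) A(2) by simp
  next
    fix c j assume *: "(c, j) \<in> I - {(a, h)}" "c < b" "j < s"
    then show "(b, j) \<notin> A" using face_no_clash[OF I, of c j b h] b(1) s(2) by auto
  next
    fix c j assume *: "(c, j) \<in> I - {(a, h)}" "b < c" "s < j"
    show "(c, s) \<notin> A"
    proof
      assume cs: "(c, s) \<in> A"
      have c: "(c, j) \<in> I" using * by simp
      have jn: "j \<le> n" using face_height[OF I c] .
      consider "h < j" | "j = h" | "j < h" by linarith
      then show False
      proof cases
        case 1
        then show False using face_no_clash[OF I b(1) c *(2)] lattice_mono[OF cs, of c h] s(2) A(2) by auto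
      next
        case 2
        then have "a < c" using * b(3) by (metis DiffD1 DiffD2 linorder_neqE_nat singletonI)
        then show False using face_no_clash[OF I s(1) c _ *(3)] cs by blast
      next
        case 3
        have "c \<noteq> a" using s(3) 3 *(3) c by blast
        moreover have "\<not> a < c" using face_no_clash[OF I s(1) c _ *(3)] cs by blast
        moreover have "\<not> c < a"
          using face_no_clash[OF I c q _ 3] lattice_mono[OF A(1), of a j] *(3) jn by auto
        ultimately show False by linarith
      qed
    qed
  qed
qed

lemma nearest_west:
  assumes "(b', h) \<in> T" "b' < (a::nat)"
  obtains b where "(b, h) \<in> T" "b < a" "\<And>c. b < c \<Longrightarrow> c < a \<Longrightarrow> (c, h) \<notin> T"
proof -
  define b where "b = Max {b. b < a \<and> (b, h) \<in> T}"
  have fin: "finite {b. b < a \<and> (b, h) \<in> T}" by simp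
  have "b < a \<and> (b, h) \<in> T" using Max_in[OF fin] assms unfolding b_def by blast
  moreover have "(c, h) \<notin> T" if "b < c" "c < a" for c
    using Max_ge[OF fin, of c] that unfolding b_def by (auto simp flip: not_less)
  ultimately show thesis using that by blast
qed

lemma nearest_south:
  assumes "(a, s') \<in> T" "s' < (h::nat)"
  obtains s where "(a, s) \<in> T" "s < h" "\<And>g. s < g \<Longrightarrow> g < h \<Longrightarrow> (a, g) \<notin> T"
proof -
  define s where "s = Max {s. s < h \<and> (a, s) \<in> T}"
  have fin: "finite {s. s < h \<and> (a, s) \<in> T}" by simp
  have "s < h \<and> (a, s) \<in> T" using Max_in[OF fin] assms unfolding s_def by blast
  moreover have "(a, g) \<notin> T" if "s < g" "g < h" for g
    using Max_ge[OF fin, of g] that unfolding s_def by (auto simp flip: not_less)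
  ultimately show thesis using that by blast
qed

text \<open>A node with a west and a south neighbour can be moved to the opposite corner, and this undoes
  a right rotation. The sum of the coordinates drops, so repeating this ends.\<close>
lemma left_rotation:
  assumes T: "nu_tree \<nu> T" and q: "(a, h) \<in> T" and "(b', h) \<in> T" "b' < a" and "(a, s') \<in> T" "s' < h"
  obtains T' where "rotates_to \<nu> T' T" and "(\<Sum>p\<in>T'. fst p + snd p) < (\<Sum>p\<in>T. fst p + snd p)"
proof -
  note face = tree_face[OF T]
  obtain b where b: "(b, h) \<in> T" "b < a" "\<And>c. b < c \<Longrightarrow> c < a \<Longrightarrow> (c, h) \<notin> T"
    using nearest_west assms(3,4) by metis
  obtain s where s: "(a, s) \<in> T" "s < h" "\<And>g. s < g \<Longrightarrow> g < h \<Longrightarrow> (a, g) \<notin> T"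
    using nearest_south assms(5,6) by metis
  define T' where "T' = insert (b, s) (T - {(a, h)})"
  note flip = left_flip_face[OF face q b s]
  have fin: "finite T" using face_finite[OF face] .
  have "card T' = card T"
    unfolding T'_def using flip(2) card_Suc_Diff1[OF fin q] fin by simp
  then have T': "nu_tree \<nu> T'" using tree_by_card[of T'] flip(1) card_tree[OF T] unfolding T'_def by simp
  have A: "(a, s) \<in> A" using face_in_lattice[OF face s(1)] .
  have "next_north T' (b, s) (b, h)"
  proof -
    have "(b, g) \<notin> T" if "s < g" "g < h" for g
    proof
      assume g: "(b, g) \<in> T"
      then show False using face_no_clash[OF face g q b(2) that(2)] lattice_mono[OF A, of a g] that(1)
          face_height[OF face g] by auto
    qed
    then show ?thesis using b s unfolding next_north_def T'_def by auto
  qed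
  moreover have "next_east T' (b, s) (a, s)"
  proof -
    have "(c, s) \<notin> T" if "b < c" "c < a" for c
      using face_no_clash[OF face _ q that(2) s(2)] A by auto
    then show ?thesis using b s unfolding next_east_def T'_def by auto
  qed
  moreover have "T = insert (a, h) (T' - {(b, s)})" using q flip(2) unfolding T'_def by auto
  moreover have "(b, s) \<in> T'" unfolding T'_def by simp
  ultimately have rot: "rotates_to \<nu> T' T"
    unfolding rotates_to_def using T T' by (intro conjI bexI[of _ "(b, s)"] exI[of _ "(b, h)"] exI[of _ "(a, s)"]) auto
  have "(\<Sum>p\<in>T'. fst p + snd p) = b + s + (\<Sum>p\<in>T - {(a, h)}. fst p + snd p)"
    unfolding T'_def using fin flip(2) by simp
  moreover have "(\<Sum>p\<in>T. fst p + snd p) = a + h + (\<Sum>p\<in>T - {(a, h)}. fst p + snd p)"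
    using sum.remove[OF fin q, of "\<lambda>p. fst p + snd p"] by simp
  ultimately show thesis using that[OF rot] b(2) s(2) by linarith
qed

section \<open>The minimal tree\<close>

text \<open>Trees without a node that could be moved by a left rotation. There is just one, and it is the
  least element of the rotation order.\<close>
definition bottom :: "point set \<Rightarrow> bool"
  where "bottom T \<longleftrightarrow> nu_tree \<nu> T \<and>
    \<not> (\<exists>a h b s. (a, h) \<in> T \<and> (b, h) \<in> T \<and> b < a \<and> (a, s) \<in> T \<and> s < h)"

text \<open>A row whose leftmost node is off the first column leads to a node that can be moved by a left
  rotation.\<close>
lemma bottom_first_column:
  assumes "bottom T" and "h \<le> n" shows "(0, h) \<in> T"
proof -
  have T: "nu_tree \<nu> T" and no: "\<And>a h b s. (a, h) \<in> T \<Longrightarrow> (b, h) \<in> T \<Longrightarrow> b < a \<Longrightarrow> (a, s) \<in> T \<Longrightarrow> s < h \<Longrightarrow> False"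
    using assms(1) unfolding bottom_def by blast+
  note face = tree_face[OF T]
  define a where "a = (LEAST a. (a, h) \<in> T)"
  have a: "(a, h) \<in> T" unfolding a_def by (rule LeastI[of _ "row_length h"]) (rule row_end_in_tree[OF T assms(2)])
  have left: "(a', h) \<notin> T" if "a' < a" for a' using not_less_Least that unfolding a_def by blast
  show ?thesis
  proof (cases "a = 0 \<or> h = n")
    case True
    then show ?thesis using a root_in_tree[OF T] by auto
  next
    case False
    then have "h < n" using assms(2) by simp
    \<comment> \<open>A leftmost node has a node to its north, so its column contains at least two nodes; the top one
      has a node to its south and, lacking a north neighbour, a node to its west.\<close>
    define t where "t = Max {g. (a, g) \<in> T}"
    have fin: "finite {g. (a, g) \<in> T}"
      using face_height[OF face] by (meson finite_nat_set_iff_bounded_le mem_Collect_eq)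
    have t: "(a, t) \<in> T" using Max_in[OF fin] a unfolding t_def by blast
    have top: "(a, g) \<notin> T" if "t < g" for g using Max_ge[OF fin, of g] that unfolding t_def by auto
    obtain h' where "h < h'" "(a, h') \<in> T" using leftmost_has_north[OF T a \<open>h < n\<close> left] .
    then have "h < t" using top by (meson not_less order_less_le_trans)
    obtain b where "b < a" "(b, t) \<in> T"
    proof (cases "t = n")
      case True
      then show thesis using that[of 0] root_in_tree[OF T] False by auto
    next
      case False
      then have "t < n" using face_height[OF face t] by simp
      then show thesis using leftmost_has_north[OF T t] top that by blast
    qed
    then show ?thesis using no[OF t _ _ a] \<open>h < t\<close> by blast
  qed
qed

text \<open>With the first column full, a node off the first column can only be the lowest point of its
  column, and such a point is compatible with every tree that contains the first column.\<close>
lemma bottom_unique: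
  assumes B: "bottom T" "bottom T'" shows "T = T'"
proof -
  have sub: "T' \<subseteq> T" if B: "bottom T" "bottom T'" for T T'
  proof
    fix q assume q: "q \<in> T'"
    obtain a h where ah: "q = (a, h)" by fastforce
    have T: "nu_tree \<nu> T" "nu_tree \<nu> T'" using B unfolding bottom_def by auto
    note face = T[THEN tree_face]
    have A: "(a, h) \<in> A" using face_in_lattice[OF face(2)] q ah by blast
    then have hn: "h \<le> n" by (simp add: lattice_iff)
    have "(a, h) \<in> T"
    proof (cases "a = 0")
      case True
      then show ?thesis using bottom_first_column[OF B(1) hn] by simp
    next
      case False
      show ?thesis
      proof (rule tree_memI[OF T(1) A])
        fix a' h' assume "h' < h"
        then show "(a, h') \<notin> A"
          using face_no_clash[OF face(2) bottom_first_column[OF B(2), of h'], of a h] q ah False hn by auto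
      next
        fix a' h' assume "(a', h') \<in> T" "a < a'" "h < h'"
        then show "(a', h) \<notin> A"
          using face_no_clash[OF face(1) bottom_first_column[OF B(1) hn]] by auto
      qed
    qed
    then show "q \<in> T" using ah by simp
  qed
  show ?thesis using sub[OF B] sub[OF B(2,1)] by blast
qed

lemma bottom_below:
  assumes "nu_tree \<nu> T" shows "\<exists>T0. bottom T0 \<and> rotation_le \<nu> T0 T"
  using assms
proof (induction "\<Sum>p\<in>T. fst p + snd p" arbitrary: T rule: less_induct)
  case less
  show ?case
  proof (cases "bottom T")
    case True
    then show ?thesis unfolding rotation_le_def by blast
  next
    case False
    then obtain a h b s where "(a, h) \<in> T" "(b, h) \<in> T" "b < a" "(a, s) \<in> T" "s < h"
      using less.prems unfolding bottom_def by blast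
    from left_rotation[OF less.prems this] obtain T' where T': "rotates_to \<nu> T' T" "(\<Sum>p\<in>T'. fst p + snd p) < (\<Sum>p\<in>T. fst p + snd p)"
      .
    then obtain T0 where "bottom T0" "rotation_le \<nu> T0 T'"
      using less.hyps[OF T'(2)] unfolding rotates_to_def by blast
    then show ?thesis using T'(1) unfolding rotation_le_def by (meson rtranclp.rtrancl_into_rtrancl)
  qed
qed

lemma nothing_rotates_to_bottom:
  assumes "bottom T" shows "\<not> rotates_to \<nu> T' T"
proof
  assume "rotates_to \<nu> T' T"
  then obtain q p r where *: "next_north T' q p" "next_east T' q r" "T = insert (fst r, snd p) (T' - {q})"
    unfolding rotates_to_def by blast
  obtain a h where q: "q = (a, h)" by fastforce
  have "(fst r, snd p) \<in> T" "(a, snd p) \<in> T" "a < fst r" "(fst r, h) \<in> T" "h < snd p"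
    using * unfolding q next_north_def next_east_def by (cases p; cases r; auto)+
  then show False using assms unfolding bottom_def by blast
qed

lemma bottom_min_tree: "bottom (min_tree \<nu>)"
proof -
  have "{} \<in> tamari_complex \<nu>" by (simp add: tamari_complex_def)
  then obtain T where "nu_tree \<nu> T" using face_extends_to_tree by metis
  then obtain T0 where T0: "bottom T0" using bottom_below by metis
  have least: "rotation_le \<nu> T0 T" if "nu_tree \<nu> T" for T
    using bottom_below[OF that] bottom_unique[OF T0] by blast
  have "min_tree \<nu> = T0"
    unfolding min_tree_def
  proof (rule the_equality)
    show "nu_tree \<nu> T0 \<and> (\<forall>T'. nu_tree \<nu> T' \<longrightarrow> rotation_le \<nu> T0 T')"
      using T0 least unfolding bottom_def by blast
    fix T1 assume T1: "nu_tree \<nu> T1 \<and> (\<forall>T'. nu_tree \<nu> T' \<longrightarrow> rotation_le \<nu> T1 T')"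
    then have "rotation_le \<nu> T1 T0" using T0 unfolding bottom_def by blast
    then show "T1 = T0"
      unfolding rotation_le_def by cases (use nothing_rotates_to_bottom[OF T0] in auto)
  qed
  then show ?thesis using T0 by simp
qed

section \<open>The staircase of a tree and its area\<close>

text \<open>Between the heights \<open>h\<close> and \<open>n\<close> and left of the end of row \<open>h\<close> the diagram is a
  rectangle, so there the nodes of a tree lie on a staircase. This is the abscissa at which the
  staircase crosses the strip between the heights \<open>g\<close> and \<open>g + 1\<close>.\<close>
definition staircase :: "point set \<Rightarrow> nat \<Rightarrow> nat \<Rightarrow> nat"
  where "staircase T h g = Min {a. \<exists>m\<in>{h..g}. (a, m) \<in> T}"

definition staircase_area :: "point set \<Rightarrow> nat \<Rightarrow> nat"
  where "staircase_area T h = (\<Sum>g\<in>{h..<n}. staircase T h g)"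

lemma
  assumes T: "nu_tree \<nu> T" and "h \<le> g" "h \<le> n"
  shows staircase_attained: "\<exists>m\<in>{h..g}. (staircase T h g, m) \<in> T"
    and staircase_le: "\<And>a m. (a, m) \<in> T \<Longrightarrow> m \<in> {h..g} \<Longrightarrow> staircase T h g \<le> a"
proof -
  have "{a. \<exists>m\<in>{h..g}. (a, m) \<in> T} \<subseteq> fst ` T" by force
  then have fin: "finite {a. \<exists>m\<in>{h..g}. (a, m) \<in> T}"
    using face_finite[OF tree_face[OF T]] finite_subset by blast
  have "row_length h \<in> {a. \<exists>m\<in>{h..g}. (a, m) \<in> T}"
    using row_end_in_tree[OF T assms(3)] assms(2) by (auto intro!: bexI[of _ h])
  then show "\<exists>m\<in>{h..g}. (staircase T h g, m) \<in> T"
    using Min_in[OF fin] unfolding staircase_def by blast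
  show "\<And>a m. (a, m) \<in> T \<Longrightarrow> m \<in> {h..g} \<Longrightarrow> staircase T h g \<le> a"
    unfolding staircase_def using Min_le[OF fin] by blast
qed

lemma staircase_area_split:
  assumes "h \<le> t" "t \<le> n"
  shows "staircase_area T h = (\<Sum>g\<in>{h..<t}. staircase T h g) + (\<Sum>g\<in>{t..<n}. staircase T h g)"
  unfolding staircase_area_def using sum.atLeastLessThan_concat[OF assms] by metis

lemma staircase_ge_of_node_above:
  assumes T: "nu_tree \<nu> T" and q: "(a, t) \<in> T" and A: "(a, h) \<in> A"
    and "h \<le> m" "m < t" "(b, m) \<in> T"
  shows "a \<le> b"
proof (rule ccontr)
  assume "\<not> a \<le> b"
  then show False
    using face_no_clash[OF tree_face[OF T] assms(6) q] lattice_mono[OF A, of a m] assms(4,5)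
      face_height[OF tree_face[OF T] assms(6)] by auto
qed

text \<open>The staircases of two rows are compared strip by strip. If the node \<open>(a, t)\<close> lies above row \<open>h\<close>,
  then the staircase of row \<open>h\<close> stays weakly right of column \<open>a\<close> up to height \<open>t\<close>, and weakly
  right of the staircase of row \<open>t\<close> from there on.\<close>
lemma potential_below:
  assumes T: "nu_tree \<nu> T" and q: "(a, t) \<in> T" and A: "(a, h) \<in> A" and "h < t"
  shows "staircase_area T t + t * a \<le> staircase_area T h + h * a"
    and "(a, h) \<notin> T \<Longrightarrow> staircase_area T t + t * a < staircase_area T h + h * a"
proof -
  have tn: "t \<le> n" using face_height[OF tree_face[OF T] q] .
  have hn: "h \<le> n" using \<open>h < t\<close> tn by simp
  have low: "a \<le> staircase T h g" if g: "g \<in> {h..<t}" for g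
  proof -
    obtain m where "m \<in> {h..g}" "(staircase T h g, m) \<in> T"
      using staircase_attained[OF T, of h g] g hn by auto
    then show ?thesis using staircase_ge_of_node_above[OF T q A, of m] that by auto
  qed
  have high: "staircase T t g \<le> staircase T h g" if g: "g \<in> {t..<n}" for g
  proof -
    obtain m where m: "m \<in> {h..g}" "(staircase T h g, m) \<in> T"
      using staircase_attained[OF T, of h g] g hn \<open>h < t\<close> by auto
    show ?thesis
    proof (cases "t \<le> m")
      case True
      then show ?thesis using staircase_le[OF T, of t g _ m] m that tn by auto
    next
      case False
      then have "a \<le> staircase T h g" using staircase_ge_of_node_above[OF T q A, of m] m by auto
      moreover have "staircase T t g \<le> a" using staircase_le[OF T, of t g a t] q that tn by auto
      ultimately show ?thesis by simp
    qed
  qed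
  have t: "staircase_area T t \<le> (\<Sum>g\<in>{t..<n}. staircase T h g)"
    unfolding staircase_area_def using high by (rule sum_mono)
  have "(t - h) * a = (\<Sum>g\<in>{h..<t}. a)" by simp
  also have "\<dots> \<le> (\<Sum>g\<in>{h..<t}. staircase T h g)" using low by (rule sum_mono)
  finally have 1: "(t - h) * a \<le> (\<Sum>g\<in>{h..<t}. staircase T h g)" .
  have th: "t * a = h * a + (t - h) * a" using \<open>h < t\<close> by (simp flip: distrib_right)
  show "staircase_area T t + t * a \<le> staircase_area T h + h * a"
    using t 1 th staircase_area_split[of h t T] \<open>h < t\<close> tn by linarith
  assume notin: "(a, h) \<notin> T"
  have "(staircase T h h, h) \<in> T" using staircase_attained[OF T, of h h] hn by auto
  then have "a \<noteq> staircase T h h" using notin by auto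
  then have "a < staircase T h h" using low[of h] \<open>h < t\<close> by auto
  then have "(\<Sum>g\<in>{h..<t}. a) < (\<Sum>g\<in>{h..<t}. staircase T h g)"
    using low \<open>h < t\<close> by (intro sum_strict_mono_ex1) auto
  then show "staircase_area T t + t * a < staircase_area T h + h * a"
    using t th staircase_area_split[of h t T] \<open>h < t\<close> tn by simp
qed

text \<open>If the node \<open>(a, t)\<close> lies below row \<open>h\<close>, then the staircase of row \<open>t\<close> stays weakly left of
  column \<open>a\<close> up to height \<open>h\<close>, and weakly left of the staircase of row \<open>h\<close> from there on.\<close>
lemma potential_above:
  assumes T: "nu_tree \<nu> T" and q: "(a, t) \<in> T" and "t < h" "h \<le> n"
  shows "staircase_area T t + t * a \<le> staircase_area T h + h * a"
    and "(a, h) \<notin> T \<Longrightarrow> staircase_area T t + t * a < staircase_area T h + h * a"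
proof -
  have tn: "t \<le> n" using assms(3,4) by simp
  have low: "staircase T t g \<le> a" if "t \<le> g" for g
    using staircase_le[OF T, of t g a t] q that tn by auto
  have high: "staircase T t g \<le> staircase T h g" if g: "g \<in> {h..<n}" for g
  proof -
    obtain m where "m \<in> {h..g}" "(staircase T h g, m) \<in> T"
      using staircase_attained[OF T, of h g] g assms(4) by auto
    then show ?thesis using staircase_le[OF T, of t g _ m] that tn assms(3) by auto
  qed
  have ht: "h * a = t * a + (\<Sum>g\<in>{t..<h}. a)" using \<open>t < h\<close> by (simp flip: distrib_right)
  have 1: "(\<Sum>g\<in>{t..<h}. staircase T t g) \<le> (\<Sum>g\<in>{t..<h}. a)"
    using low by (intro sum_mono) simp
  have 2: "(\<Sum>g\<in>{h..<n}. staircase T t g) \<le> staircase_area T h"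
    unfolding staircase_area_def using high by (rule sum_mono)
  note split = staircase_area_split[of t h T]
  show "staircase_area T t + t * a \<le> staircase_area T h + h * a"
    using 1 2 ht split assms(3,4) by linarith
  assume notin: "(a, h) \<notin> T"
  show "staircase_area T t + t * a < staircase_area T h + h * a"
  proof (cases "staircase T t (h - 1) = a")
    case False
    then have "(\<Sum>g\<in>{t..<h}. staircase T t g) < (\<Sum>g\<in>{t..<h}. a)"
      using low \<open>t < h\<close> le_neq_implies_less[OF low[of "h - 1"] False]
      by (intro sum_strict_mono_ex1) (auto intro!: bexI[of _ "h - 1"])
    then show ?thesis using 2 ht split assms(3,4) by linarith
  next
    case True
    \<comment> \<open>All nodes in the rows from \<open>t\<close> to \<open>h - 1\<close> lie weakly right of column \<open>a\<close>, so a
      node of row \<open>h\<close> to the left of the column would make \<open>(a, h)\<close> a node.\<close>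
    have right: "a \<le> b" if "(b, m) \<in> T" "t \<le> m" "m < h" for b m
      using staircase_le[OF T, of t "h - 1" b m] that True tn by auto
    define l where "l = staircase T h h"
    have l: "(l, h) \<in> T" using staircase_attained[OF T, of h h] assms(4) unfolding l_def by auto
    have "\<not> l < a"
    proof
      assume la: "l < a"
      have "(a, h) \<in> T"
      proof (rule column_node[OF T _ l la])
        show "(a, h) \<in> A"
          using lattice_mono[OF face_in_lattice[OF tree_face[OF T] q], of a h] assms(3,4) by simp
        fix a' h' assume *: "(a', h') \<in> T" "a' < a" "h' < h"
        then have "h' < t" using right[OF *(1)] by force
        then show "(a, h') \<notin> A" using face_no_clash[OF tree_face[OF T] *(1) q *(2)] by blast
      qed
      then show False using notin by simp
    qed
    then have la: "a < l" using l notin by (metis linorder_neqE_nat)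
    have "h \<noteq> n"
    proof
      assume "h = n"
      then have "l \<le> 0" using staircase_le[OF T, of h h 0 h] root_in_tree[OF T] unfolding l_def by auto
      then show False using la by simp
    qed
    then have "staircase T t h < staircase T h h" "h < n"
      using low[of h] la assms(3,4) unfolding l_def by auto
    then have "(\<Sum>g\<in>{h..<n}. staircase T t g) < staircase_area T h"
      unfolding staircase_area_def using high by (intro sum_strict_mono_ex1) auto
    then show ?thesis using 1 ht split assms(3,4) by linarith
  qed
qed

lemma staircase_area_bottom:
  assumes "bottom T" "h \<le> n" shows "staircase_area T h = 0"
proof -
  have T: "nu_tree \<nu> T" using assms(1) by (simp add: bottom_def)
  have "staircase T h g = 0" if "g \<in> {h..<n}" for g
    using staircase_le[OF T, of h g 0 h] bottom_first_column[OF assms] that by auto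
  then show ?thesis by (simp add: staircase_area_def)
qed

section \<open>Tight sets\<close>

text \<open>The point \<open>v\<close> has one coordinate for each row, and column \<open>a\<close> compares the values
  \<open>v (n - h) + h * a\<close> of the rows that meet it; this is the position of \<open>v\<close> relative to a tropical
  hyperplane. The rows at height \<open>0\<close> and \<open>n\<close> have the indices \<open>n\<close> and \<open>0\<close>, where the vectors of
  \<open>coord_space (n - 1)\<close> vanish.\<close>
definition tight :: "(nat \<Rightarrow> real) \<Rightarrow> point set"
  where "tight v = {(a, h) \<in> A. \<forall>h'. (a, h') \<in> A \<longrightarrow> v (n - h) + real (h * a) \<le> v (n - h') + real (h' * a)}"

definition tree_point :: "point set \<Rightarrow> nat \<Rightarrow> real"
  where "tree_point T = (\<lambda>i. if i \<in> {1..n - 1} then real (staircase_area T (n - i)) else 0)"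

lemma tree_point_in_space: "tree_point T \<in> coord_space (n - 1)"
  by (simp add: tree_point_def coord_space_def)

lemma tree_point_row:
  assumes T: "nu_tree \<nu> T" and "h \<le> n"
  shows "tree_point T (n - h) = real (staircase_area T h)"
proof -
  consider "h = n" | "h = 0" | "h < n" "h \<noteq> 0" using assms(2) by linarith
  then show ?thesis
  proof cases
    case 1
    then show ?thesis by (simp add: tree_point_def staircase_area_def)
  next
    case 2
    have "staircase T 0 g = 0" for g
      using staircase_le[OF T, of 0 g 0 0] row_end_in_tree[OF T, of 0] by simp
    then show ?thesis using 2 n_pos by (auto simp: tree_point_def staircase_area_def)
  next
    case 3
    then show ?thesis by (auto simp: tree_point_def)
  qed
qed

lemma tightD: "(a, h) \<in> tight v \<Longrightarrow> (a, h') \<in> A \<Longrightarrow> v (n - h) + real (h * a) \<le> v (n - h') + real (h' * a)"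
  by (simp add: tight_def)

lemma tight_in_lattice: "(a, h) \<in> tight v \<Longrightarrow> (a, h) \<in> A"
  by (simp add: tight_def)

lemma tightI:
  "(a, h) \<in> A \<Longrightarrow> (\<And>h'. (a, h') \<in> A \<Longrightarrow> v (n - h) + real (h * a) \<le> v (n - h') + real (h' * a)) \<Longrightarrow> (a, h) \<in> tight v"
  by (simp add: tight_def)

lemma tight_eq:
  "(a, h) \<in> tight v \<Longrightarrow> (a, h') \<in> tight v \<Longrightarrow> v (n - h) + real (h * a) = v (n - h') + real (h' * a)"
  using tightD tight_in_lattice by (meson antisym)

text \<open>The function \<open>h * a\<close> is strictly supermodular: adding the two inequalities for the
  corners of a rectangle gives a contradiction for an incompatible pair.\<close>
lemma tight_face: "tight v \<in> tamari_complex \<nu>"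
  unfolding face_iff
proof (intro conjI allI impI notI)
  show "tight v \<subseteq> A" by (auto simp: tight_def)
  fix a h a' h' assume *: "(a, h) \<in> tight v" "(a', h') \<in> tight v" "a < a'" "h < h'" "(a', h) \<in> A"
  have "(a, h') \<in> A"
    using lattice_mono[OF tight_in_lattice[OF *(2)], of a h'] tight_in_lattice[OF *(2)] *(3) lattice_iff by auto
  then have "v (n - h) + real (h * a) \<le> v (n - h') + real (h' * a)"
    "v (n - h') + real (h' * a') \<le> v (n - h) + real (h * a')"
    using tightD[OF *(1)] tightD[OF *(2,5)] by auto
  then have "real (h * a + h' * a') \<le> real (h' * a + h * a')" by simp
  then have "h * a + h' * a' \<le> h' * a + h * a'" by linarith
  moreover obtain x y where "a' = a + Suc x" "h' = h + Suc y"
    using *(3,4) by (metis less_iff_Suc_add add_Suc_right)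
  ultimately show False by (simp add: algebra_simps)
qed

lemma tight_tree_point:
  assumes T: "nu_tree \<nu> T" shows "tight (tree_point T) = T"
proof -
  note face = tree_face[OF T]
  have le: "staircase_area T t + t * a \<le> staircase_area T h + h * a" if "(a, t) \<in> T" "(a, h) \<in> A" for a t h
    using potential_below(1)[OF T that] potential_above(1)[OF T that(1), of h] that(2) lattice_iff
    by (cases t h rule: linorder_cases) auto
  have less: "staircase_area T t + t * a < staircase_area T h + h * a"
    if "(a, t) \<in> T" "(a, h) \<in> A" "(a, h) \<notin> T" for a t h
    using potential_below(2)[OF T that(1,2) _ that(3)] potential_above(2)[OF T that(1) _ _ that(3)] that lattice_iff
    by (cases t h rule: linorder_cases) auto
  have val: "tree_point T (n - h) + real (h * a) = real (staircase_area T h + h * a)" if "(a, h) \<in> A" for a h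
    using tree_point_row[OF T, of h] that lattice_iff by simp
  show ?thesis
  proof
    show "T \<subseteq> tight (tree_point T)"
    proof
      fix q assume q: "q \<in> T"
      obtain a t where at: "q = (a, t)" by fastforce
      then have A: "(a, t) \<in> A" using face_in_lattice[OF face] q by blast
      have "(a, t) \<in> tight (tree_point T)"
      proof (rule tightI[OF A])
        fix h' assume A': "(a, h') \<in> A"
        have "staircase_area T t + t * a \<le> staircase_area T h' + h' * a" using le[of a t h'] q at A' by simp
        then show "tree_point T (n - t) + real (t * a) \<le> tree_point T (n - h') + real (h' * a)"
          unfolding val[OF A] val[OF A'] by (rule of_nat_mono)
      qed
      then show "q \<in> tight (tree_point T)" using at by simp
    qed
    show "tight (tree_point T) \<subseteq> T"
    proof (rule ccontr)
      assume "\<not> tight (tree_point T) \<subseteq> T"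
      then obtain a h where ah: "(a, h) \<in> tight (tree_point T)" "(a, h) \<notin> T" by auto
      have A: "(a, h) \<in> A" using tight_in_lattice[OF ah(1)] .
      then have "a \<le> row_length n" using row_length_mono[of h n] lattice_iff by force
      then obtain t where t: "(a, t) \<in> T" using column_nonempty[OF T] by metis
      then have A': "(a, t) \<in> A" using face_in_lattice[OF face] by blast
      have "real (staircase_area T h + h * a) \<le> real (staircase_area T t + t * a)"
        using tightD[OF ah(1) A'] val[OF A] val[OF A'] by linarith
      then show False using less[OF t A ah(2)] by linarith
    qed
  qed
qed

text \<open>A leftmost node and a node to its north express the coordinate of their lower row by that of the
  upper one, so the tree determines all coordinates, beginning with the row of the root.\<close>
lemma point_of_tight_tree:
  assumes T: "nu_tree \<nu> T" and v: "v \<in> coord_space (n - 1)" and sub: "T \<subseteq> tight v"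
  shows "v = tree_point T"
proof -
  have row: "v (n - h) = tree_point T (n - h)" if "h \<le> n" for h
    using that
  proof (induction "n - h" arbitrary: h rule: less_induct)
    case less
    show ?case
    proof (cases "h = n")
      case True
      then show ?thesis using v tree_point_in_space[of T] by (simp add: coord_space_def)
    next
      case False
      define a where "a = (LEAST a. (a, h) \<in> T)"
      have a: "(a, h) \<in> T" unfolding a_def
        by (rule LeastI[of _ "row_length h"]) (rule row_end_in_tree[OF T less.prems])
      have left: "(a', h) \<notin> T" if "a' < a" for a' using not_less_Least that unfolding a_def by blast
      have "h < n" using False less.prems by simp
      obtain h' where h': "h < h'" "(a, h') \<in> T" using leftmost_has_north[OF T a \<open>h < n\<close> left] .
      have "h' \<le> n" using face_height[OF tree_face[OF T] h'(2)] .
      then have "v (n - h') = tree_point T (n - h')" using less.hyps[of h'] h'(1) by auto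
      moreover have "v (n - h) + real (h * a) = v (n - h') + real (h' * a)"
        using tight_eq[of a h v h'] a h'(2) sub by auto
      moreover have "tree_point T (n - h) + real (h * a) = tree_point T (n - h') + real (h' * a)"
        using tight_eq[of a h "tree_point T" h'] a h'(2) tight_tree_point[OF T] by auto
      ultimately show ?thesis by linarith
    qed
  qed
  show ?thesis
  proof
    fix i
    show "v i = tree_point T i"
    proof (cases "i \<le> n")
      case True
      then show ?thesis using row[of "n - i"] by simp
    next
      case False
      then show ?thesis using v tree_point_in_space[of T] by (simp add: coord_space_def)
    qed
  qed
qed

section \<open>Interior faces\<close>

text \<open>This will turn out to describe the interior faces.\<close>
definition covering :: "point set \<Rightarrow> bool"
  where "covering I \<longleftrightarrow> (0, n) \<in> I \<and> (\<forall>h\<le>n. \<exists>a. (a, h) \<in> I) \<and> (\<forall>a\<le>row_length n. \<exists>h. (a, h) \<in> I)"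

lemma covering_mono: "covering I \<Longrightarrow> I \<subseteq> J \<Longrightarrow> covering J"
  unfolding covering_def by (meson subsetD)

text \<open>If the rest of the row and of the column of a node stays covered, then the node has either
  a north and an east neighbour or a west and a south neighbour, and can be flipped.\<close>
lemma covering_flip:
  assumes T: "nu_tree \<nu> T" and q: "q \<in> T" and I: "covering I" "I \<subseteq> T - {q}"
  obtains T' where "nu_tree \<nu> T'" "T - {q} \<subseteq> T'" "q \<notin> T'"
proof -
  note face = tree_face[OF T]
  obtain a h where ah: "q = (a, h)" by fastforce
  have hn: "h \<le> n" using face_height[OF face] q ah by blast
  have an: "a \<le> row_length n"
    using face_in_lattice[OF face] q ah row_length_mono[of h n] lattice_iff by force
  obtain a' where "(a', h) \<in> I" using I(1) hn unfolding covering_def by metis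
  then have a': "(a', h) \<in> T" "a' \<noteq> a" using I(2) ah by auto
  obtain h' where "(a, h') \<in> I" using I(1) an unfolding covering_def by metis
  then have h': "(a, h') \<in> T" "h' \<noteq> h" using I(2) ah by auto
  have root: "(a, h) \<noteq> (0, n)" using I ah unfolding covering_def by blast
  note result = that
  have flipped: thesis if x: "insert x (T - {(a, h)}) \<in> tamari_complex \<nu>" "x \<notin> T" for x
  proof -
    obtain T' where T': "nu_tree \<nu> T'" "insert x (T - {(a, h)}) \<subseteq> T'" using face_extends_to_tree[OF x(1)] .
    have "(a, h) \<notin> T'"
    proof
      assume "(a, h) \<in> T'"
      then have "T \<subseteq> T'" using T'(2) by blast
      then show False using tree_maximal[OF T tree_face[OF T'(1)]] T'(2) x(2) by blast
    qed
    then show thesis using result[OF T'(1)] T'(2) ah by auto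
  qed
  show thesis
  proof (cases "\<exists>g>h. (a, g) \<in> T")
    case True
    then obtain g where g: "h < g" "(a, g) \<in> T" by blast
    then have "\<not> a' < a" using not_north_and_west[OF face _ g(2,1) a'(1)] q ah by blast
    then have "a < a'" using a'(2) by simp
    obtain p where p: "next_north T (a, h) (a, p)" using next_north_exists[OF g(2,1)] .
    obtain c where c: "next_east T (a, h) (c, h)" using next_east_exists[OF a'(1) \<open>a < a'\<close>] .
    show thesis using flipped[of "(c, p)"] right_flip_face[OF face _ p c] q ah by blast
  next
    case False
    then have "h' < h" using h' by (metis linorder_neqE_nat)
    obtain b' where "(b', h) \<in> T" "b' < a"
    proof (cases "h = n")
      case True
      then show thesis using that[of 0] root root_in_tree[OF T] by auto
    next
      case False': False
      then have "h < n" using hn by simp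
      then show thesis using leftmost_has_north[OF T, of a h] q ah False that by blast
    qed
    then obtain b where b: "(b, h) \<in> T" "b < a" "\<And>c. b < c \<Longrightarrow> c < a \<Longrightarrow> (c, h) \<notin> T"
      using nearest_west by metis
    obtain s where s: "(a, s) \<in> T" "s < h" "\<And>g. s < g \<Longrightarrow> g < h \<Longrightarrow> (a, g) \<notin> T"
      using nearest_south[OF h'(1) \<open>h' < h\<close>] by metis
    show thesis using flipped[of "(b, s)"] left_flip_face[OF face _ b s] q ah by blast
  qed
qed

text \<open>Removing a node that lies in every tree gives a boundary ridge.\<close>
lemma interior_contains_forced:
  assumes I: "I \<in> interior_faces \<nu>" and forced: "\<And>T. nu_tree \<nu> T \<Longrightarrow> p \<in> T"
  shows "p \<in> I"
proof (rule ccontr)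
  assume p: "p \<notin> I"
  have face: "I \<in> tamari_complex \<nu>" using I by (simp add: interior_faces_def)
  obtain T where T: "nu_tree \<nu> T" "I \<subseteq> T" using face_extends_to_tree[OF face] .
  have "T - {p} \<in> boundary_ridges \<nu>"
    unfolding boundary_ridges_def
  proof (intro CollectI conjI)
    show "\<exists>T' q. nu_tree \<nu> T' \<and> q \<in> T' \<and> T - {p} = T' - {q}" using T(1) forced by blast
    show "\<exists>!T'. nu_tree \<nu> T' \<and> T - {p} \<subseteq> T'"
    proof (rule ex1I[of _ T])
      show "nu_tree \<nu> T \<and> T - {p} \<subseteq> T" using T by blast
      fix T' assume T': "nu_tree \<nu> T' \<and> T - {p} \<subseteq> T'"
      then have "T \<subseteq> T'" using forced by blast
      then show "T' = T" using tree_maximal[OF T(1)] T' tree_face by blast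
    qed
  qed
  moreover have "I \<subseteq> T - {p}" using T(2) p by blast
  ultimately show False using I unfolding interior_faces_def by blast
qed

text \<open>A face that misses a column is extended as far as possible without using the
  column. Such an extension determines the node of the column in every tree around it, so it is
  a boundary ridge.\<close>
lemma interior_covers_column:
  assumes I: "I \<in> interior_faces \<nu>" and a: "a \<le> row_length n"
  shows "\<exists>h. (a, h) \<in> I"
proof (rule ccontr)
  assume none: "\<nexists>h. (a, h) \<in> I"
  have face: "I \<in> tamari_complex \<nu>" using I by (simp add: interior_faces_def)
  have root: "(0, n) \<in> I" using interior_contains_forced[OF I] root_in_tree by blast
  have ends: "(row_length h, h) \<in> I" if "h \<le> n" for h
    using interior_contains_forced[OF I] row_end_in_tree[OF _ that] by blast
  have "a \<noteq> 0" using root none by (intro notI) simp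
  define S where "S = {J \<in> tamari_complex \<nu>. \<forall>h. (a, h) \<notin> J}"
  have "finite S" unfolding S_def using finite_faces by simp
  have "I \<in> S" unfolding S_def using face none by blast
  obtain J where J: "J \<in> S" "I \<subseteq> J" "\<And>K. K \<in> S \<Longrightarrow> J \<subseteq> K \<Longrightarrow> J = K"
    using finite_has_maximal2[OF \<open>finite S\<close> \<open>I \<in> S\<close>] by (elim bexE conjE) blast
  have Ja: "(a, h) \<notin> J" for h using J(1) unfolding S_def by blast
  have faceJ: "J \<in> tamari_complex \<nu>" using J(1) unfolding S_def by blast
  have rest: "(b, h) \<in> J" if "nu_tree \<nu> T" "J \<subseteq> T" "(b, h) \<in> T" "b \<noteq> a" for T b h
  proof -
    have "{(b, h) \<in> T. b \<noteq> a} \<in> S"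
      unfolding S_def using face_subset[OF tree_face[OF that(1)], of "{(b, h) \<in> T. b \<noteq> a}"] by auto
    moreover have "J \<subseteq> {(b, h) \<in> T. b \<noteq> a}" using that(2) Ja by auto
    ultimately show ?thesis using J(3) that(3,4) by blast
  qed
  define P where "P = (\<lambda>h. (a, h) \<in> A \<and> (\<exists>b<a. (b, h) \<in> J))"
  define j where "j = (LEAST h. P h)"
  have "P n" unfolding P_def using a root J(2) \<open>a \<noteq> 0\<close> by (auto simp: lattice_iff)
  then have "P j" unfolding j_def by (rule LeastI)
  have below: "\<not> P h" if "h < j" for h using not_less_Least that unfolding j_def by blast
  obtain b where b: "(a, j) \<in> A" "b < a" "(b, j) \<in> J" using \<open>P j\<close> unfolding P_def by blast
  have mem: "(a, j) \<in> T" if T: "nu_tree \<nu> T" "J \<subseteq> T" for T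
  proof (rule column_node[OF T(1) b(1) _ b(2)])
    show "(b, j) \<in> T" using b(3) T(2) by blast
    fix a' h' assume *: "(a', h') \<in> T" "a' < a" "h' < j"
    then have "(a', h') \<in> J" using rest[OF T *(1)] by blast
    then show "(a, h') \<notin> A" using below[OF *(3)] *(2) unfolding P_def by blast
  qed
  obtain T where T: "nu_tree \<nu> T" "J \<subseteq> T" using face_extends_to_tree[OF faceJ] .
  note faceT = tree_face[OF T(1)]
  have single: "i = j" if i: "(a, i) \<in> T" for i
  proof (rule ccontr)
    assume "i \<noteq> j"
    have bT: "(b, j) \<in> T" using b(3) T(2) by blast
    have "\<not> j < i" using face_no_clash[OF faceT bT i b(2)] b(1) by blast
    then have "i < j" using \<open>i \<noteq> j\<close> by simp
    have "i \<le> n" using face_height[OF faceT i] .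
    have "a \<noteq> row_length i" using ends[OF \<open>i \<le> n\<close>] none by blast
    then have "a < row_length i" using face_in_lattice[OF faceT i] by (simp add: lattice_iff)
    then obtain c where c: "next_east T (a, i) (c, i)"
      using next_east_exists[OF row_end_in_tree[OF T(1) \<open>i \<le> n\<close>]] by metis
    obtain p where p: "next_north T (a, i) (a, p)" using next_north_exists[OF mem[OF T] \<open>i < j\<close>] .
    have "a < c" using c by (simp add: next_east_def)
    note flip = right_flip_face[OF faceT i p c]
    have "insert (c, p) J \<in> tamari_complex \<nu>"
      by (rule face_subset[OF flip(1)]) (use T(2) Ja in auto)
    then have "insert (c, p) J \<in> S" unfolding S_def using Ja \<open>a < c\<close> by auto
    then have "J = insert (c, p) J" using J(3)[of "insert (c, p) J"] by blast
    then show False using flip(2) T(2) by blast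
  qed
  have "J = T - {(a, j)}"
  proof
    show "J \<subseteq> T - {(a, j)}" using T(2) Ja by auto
    show "T - {(a, j)} \<subseteq> J" using rest[OF T] single by force
  qed
  have "J \<in> boundary_ridges \<nu>"
    unfolding boundary_ridges_def
  proof (intro CollectI conjI)
    show "\<exists>T' q. nu_tree \<nu> T' \<and> q \<in> T' \<and> J = T' - {q}" using T mem[OF T] \<open>J = T - {(a, j)}\<close> by blast
    show "\<exists>!T'. nu_tree \<nu> T' \<and> J \<subseteq> T'"
    proof (rule ex1I[of _ T])
      show "nu_tree \<nu> T \<and> J \<subseteq> T" using T by blast
      fix T' assume T': "nu_tree \<nu> T' \<and> J \<subseteq> T'"
      then have "T \<subseteq> T'" using mem[of T'] \<open>J = T - {(a, j)}\<close> by blast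
      then show "T' = T" using tree_maximal[OF T(1)] T' tree_face by blast
    qed
  qed
  then show False using I J(2) unfolding interior_faces_def by blast
qed

text \<open>A covering set cannot be contained in a boundary ridge: the node removed from the ridge could be
  flipped, giving a second tree around the ridge.\<close>
lemma interior_iff: "I \<in> interior_faces \<nu> \<longleftrightarrow> I \<in> tamari_complex \<nu> \<and> covering I"
proof
  assume I: "I \<in> interior_faces \<nu>"
  then have "I \<in> tamari_complex \<nu>" by (simp add: interior_faces_def)
  moreover have "(0, n) \<in> I" using interior_contains_forced[OF I] root_in_tree by blast
  moreover have "(row_length h, h) \<in> I" if "h \<le> n" for h
    using interior_contains_forced[OF I] row_end_in_tree[OF _ that] by blast
  ultimately show "I \<in> tamari_complex \<nu> \<and> covering I"
    using interior_covers_column[OF I] unfolding covering_def by blast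
next
  assume I: "I \<in> tamari_complex \<nu> \<and> covering I"
  have "\<not> I \<subseteq> R" if R: "R \<in> boundary_ridges \<nu>" for R
  proof
    assume sub: "I \<subseteq> R"
    have "\<exists>T q. nu_tree \<nu> T \<and> q \<in> T \<and> R = T - {q}" and uniq: "\<exists>!T. nu_tree \<nu> T \<and> R \<subseteq> T"
      using R unfolding boundary_ridges_def mem_Collect_eq by (rule conjunct1, rule conjunct2)
    then obtain T q where T: "nu_tree \<nu> T" "q \<in> T" "R = T - {q}" by (elim exE conjE)
    obtain T' where "nu_tree \<nu> T'" "T - {q} \<subseteq> T'" "q \<notin> T'"
      using covering_flip[OF T(1,2), of I] I sub T(3) by metis
    moreover have "T - {q} \<subseteq> T" by blast
    ultimately have "T' = T" using uniq T(1) unfolding T(3) by metis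
    then show False using T(2) \<open>q \<notin> T'\<close> by blast
  qed
  then show "I \<in> interior_faces \<nu>" using I unfolding interior_faces_def by blast
qed

section \<open>The polytopal complex of tight cells\<close>

definition tight_cell :: "point set \<Rightarrow> (nat \<Rightarrow> real) set"
  where "tight_cell I = {v \<in> coord_space (n - 1). I \<subseteq> tight v}"

lemma coord_space_comb:
  "v \<in> coord_space d \<Longrightarrow> w \<in> coord_space d \<Longrightarrow> a *\<^sub>R v + b *\<^sub>R w \<in> coord_space d"
  by (simp add: coord_space_def scaleR_fun_def)

text \<open>In every column \<open>v\<close> and \<open>w\<close> share a tight row. Relative to it the other rows have
  nonnegative excess for both, and a strict convex combination vanishes only if both excesses do.\<close>
lemma tight_between:
  assumes I: "covering I" and v: "I \<subseteq> tight v" and w: "I \<subseteq> tight w" and u: "0 < u" "u < 1"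
  shows "tight ((1 - u) *\<^sub>R v + u *\<^sub>R w) = tight v \<inter> tight w"
proof -
  define m where "m = (1 - u) *\<^sub>R v + u *\<^sub>R w"
  have m: "m i + c = (1 - u) * (v i + c) + u * (w i + c)" for i c
    by (simp add: m_def scaleR_fun_def algebra_simps)
  have "(a, h) \<in> tight m \<longleftrightarrow> (a, h) \<in> tight v \<and> (a, h) \<in> tight w" for a h
  proof
    assume *: "(a, h) \<in> tight v \<and> (a, h) \<in> tight w"
    show "(a, h) \<in> tight m"
    proof (rule tightI)
      show "(a, h) \<in> A" using * tight_in_lattice by blast
      fix h' assume "(a, h') \<in> A"
      then have "v (n - h) + real (h * a) \<le> v (n - h') + real (h' * a)"
        "w (n - h) + real (h * a) \<le> w (n - h') + real (h' * a)" using * tightD by blast+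
      then show "m (n - h) + real (h * a) \<le> m (n - h') + real (h' * a)"
        unfolding m using u add_mono[OF mult_left_mono[of _ _ "1 - u"] mult_left_mono[of _ _ u]] by simp
    qed
  next
    assume *: "(a, h) \<in> tight m"
    then have A: "(a, h) \<in> A" by (rule tight_in_lattice)
    then have "a \<le> row_length n" using row_length_mono[of h n] lattice_iff by force
    then obtain g where g: "(a, g) \<in> I" using I unfolding covering_def by metis
    then have gv: "(a, g) \<in> tight v" and gw: "(a, g) \<in> tight w" using v w by auto
    have le: "v (n - g) + real (g * a) \<le> v (n - h) + real (h * a)"
      "w (n - g) + real (g * a) \<le> w (n - h) + real (h * a)"
      using tightD[OF gv A] tightD[OF gw A] .
    have ge: "m (n - h) + real (h * a) \<le> m (n - g) + real (g * a)"
      using tightD[OF * tight_in_lattice[OF gv]] .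
    have p1: "(1 - u) * (v (n - g) + real (g * a)) \<le> (1 - u) * (v (n - h) + real (h * a))"
      using u le(1) by (intro mult_left_mono) auto
    have p2: "u * (w (n - g) + real (g * a)) \<le> u * (w (n - h) + real (h * a))"
      using u le(2) by (intro mult_left_mono) auto
    have "(1 - u) * (v (n - g) + real (g * a)) = (1 - u) * (v (n - h) + real (h * a))"
      "u * (w (n - g) + real (g * a)) = u * (w (n - h) + real (h * a))"
      using p1 p2 ge unfolding m by linarith+
    then have eq: "v (n - g) + real (g * a) = v (n - h) + real (h * a)"
      "w (n - g) + real (g * a) = w (n - h) + real (h * a)"
      using u by auto
    show "(a, h) \<in> tight v \<and> (a, h) \<in> tight w"
      using tightD[OF gv] tightD[OF gw] unfolding eq by (intro conjI tightI A)
  qed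
  then show ?thesis unfolding m_def[symmetric] by auto
qed

lemma convex_tight_cell:
  assumes "covering I" shows "convex (tight_cell I)"
proof (rule convexI)
  fix v w :: "nat \<Rightarrow> real" and a b :: real
  assume *: "v \<in> tight_cell I" "w \<in> tight_cell I" "0 \<le> a" "0 \<le> b" "a + b = 1"
  consider "b = 0" | "b = 1" | "0 < b" "b < 1" using * by linarith
  then show "a *\<^sub>R v + b *\<^sub>R w \<in> tight_cell I"
  proof cases
    case 3
    moreover have a: "a = 1 - b" using * by simp
    ultimately show ?thesis
      using *(1,2) tight_between[OF assms, of v w b] coord_space_comb[of v "n - 1" w "1 - b" b]
      unfolding tight_cell_def a by simp
  qed (use * in auto)
qed

lemma tree_point_in_cell:
  "nu_tree \<nu> T \<Longrightarrow> tree_point T \<in> tight_cell I \<longleftrightarrow> I \<subseteq> T"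
  using tree_point_in_space[of T] by (simp add: tight_cell_def tight_tree_point)

text \<open>The equations and inequalities of a covering set have no recession direction: the root bounds
  all coordinates from below and a node of each row bounds its coordinate from above.\<close>
lemma no_recession:
  assumes J: "covering J" "J \<subseteq> A" and e: "e \<in> coord_space (n - 1)"
    and mono: "\<And>a h h'. (a, h) \<in> J \<Longrightarrow> (a, h') \<in> A \<Longrightarrow> e (n - h) \<le> e (n - h')"
  shows "e = 0"
proof
  fix i
  have e0: "e 0 = 0" using e by (simp add: coord_space_def)
  show "e i = 0 i"
  proof (cases "i \<le> n")
    case True
    define h where "h = n - i"
    have h: "h \<le> n" "n - h = i" using True by (auto simp: h_def)
    have "e (n - n) \<le> e (n - h)" using J(1) h by (intro mono[of 0]) (auto simp: covering_def lattice_iff)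
    moreover obtain a where a: "(a, h) \<in> J" using J(1) h unfolding covering_def by metis
    moreover have "(a, n) \<in> A" using lattice_mono[of a h a n] a J(2) h by auto
    ultimately have "e (n - h) = 0" using mono[OF a, of n] e0 by simp
    then show ?thesis using h by simp
  next
    case False
    then show ?thesis using e by (simp add: coord_space_def)
  qed
qed

text \<open>A point whose tight set is not a tree is pushed away from the point of some tree containing the
  tight set. The motion keeps all tight rows tight and, as there is no recession direction, ends when
  another row becomes tight.\<close>
lemma push_away_from_tree_point:
  assumes v: "v \<in> coord_space (n - 1)" and cov: "covering (tight v)"
    and T: "nu_tree \<nu> T" "tight v \<subset> T"
  obtains t where "0 < t" "tight v \<subset> tight (v + t *\<^sub>R (v - tree_point T))"
proof -
  define p where "p = tree_point T"
  define e where "e = v - p"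
  have e_space: "e \<in> coord_space (n - 1)"
    using v tree_point_in_space[of T] by (simp add: e_def p_def coord_space_def)
  have tp: "tight p = T" using tight_tree_point[OF T(1)] by (simp add: p_def)
  have "e \<noteq> 0" using tp T(2) by (auto simp: e_def)
  define slack where "slack = (\<lambda>(a, h, h'). v (n - h') + real (h' * a) - (v (n - h) + real (h * a)))"
  define rate where "rate = (\<lambda>(a :: nat, h, h'). e (n - h) - e (n - h'))"
  define B where "B = {(a, h, h'). (a, h) \<in> tight v \<and> (a, h') \<in> A \<and> 0 < rate (a, h, h')}"
  have finB: "finite B"
  proof (rule finite_subset)
    show "B \<subseteq> fst ` A \<times> snd ` A \<times> snd ` A"
      using tight_in_lattice unfolding B_def by force
  qed (use lattice_finite in simp)
  have "B \<noteq> {}"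
  proof
    assume "B = {}"
    then have "e (n - h) \<le> e (n - h')" if "(a, h) \<in> tight v" "(a, h') \<in> A" for a h h'
      using that unfolding B_def rate_def by (auto simp: not_less)
    moreover have "tight v \<subseteq> A" by (auto simp: tight_def)
    ultimately have "e = 0" using no_recession[OF cov _ e_space] by metis
    then show False using \<open>e \<noteq> 0\<close> by simp
  qed
  have slack_pos: "0 < slack (a, h, h')" if b: "(a, h, h') \<in> B" for a h h'
  proof (rule ccontr)
    assume "\<not> 0 < slack (a, h, h')"
    moreover have ah: "(a, h) \<in> tight v" "(a, h') \<in> A" "0 < rate (a, h, h')" using b by (auto simp: B_def)
    ultimately have eq: "v (n - h') + real (h' * a) = v (n - h) + real (h * a)"
      using tightD[OF ah(1,2)] by (simp add: slack_def)
    have "(a, h') \<in> tight v"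
      by (rule tightI[OF ah(2)], unfold eq) (rule tightD[OF ah(1)])
    then have "p (n - h') + real (h' * a) = p (n - h) + real (h * a)"
      using tight_eq[of a h' p h] ah(1) T(2) tp by blast
    then show False using eq ah(3) by (simp add: rate_def e_def)
  qed
  define t where "t = Min ((\<lambda>b. slack b / rate b) ` B)"
  have "t \<in> (\<lambda>b. slack b / rate b) ` B"
    unfolding t_def using finB \<open>B \<noteq> {}\<close> by (intro Min_in) auto
  then obtain a0 h0 h0' where b0: "(a0, h0, h0') \<in> B" "t = slack (a0, h0, h0') / rate (a0, h0, h0')"
    by auto
  have r0: "0 < rate (a0, h0, h0')" using b0(1) by (simp add: B_def)
  then have t_pos: "0 < t" using b0 slack_pos by simp
  define w where "w = v + t *\<^sub>R e"
  have w: "w (n - h) = v (n - h) + t * e (n - h)" for h by (simp add: w_def scaleR_fun_def)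
  have gap: "w (n - h') + real (h' * a) - (w (n - h) + real (h * a)) = slack (a, h, h') - t * rate (a, h, h')" for a h h'
    by (simp add: w slack_def rate_def algebra_simps)
  have sub: "tight v \<subseteq> tight w"
  proof
    fix q assume q: "q \<in> tight v"
    obtain a h where ah: "q = (a, h)" by fastforce
    have "(a, h) \<in> tight w"
    proof (rule tightI)
      show "(a, h) \<in> A" using q ah tight_in_lattice by blast
      fix h' assume A: "(a, h') \<in> A"
      have s: "0 \<le> slack (a, h, h')" using tightD[of a h v h'] q ah A by (simp add: slack_def)
      have "t * rate (a, h, h') \<le> slack (a, h, h')"
      proof (cases "0 < rate (a, h, h')")
        case True
        then have "(a, h, h') \<in> B" using q ah A by (simp add: B_def)
        then have "t \<le> slack (a, h, h') / rate (a, h, h')" unfolding t_def using finB by (intro Min_le) auto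
        then show ?thesis using True by (simp add: pos_le_divide_eq)
      next
        case False
        then have "t * rate (a, h, h') \<le> 0" using t_pos by (simp add: mult_le_0_iff)
        then show ?thesis using s by linarith
      qed
      then show "w (n - h) + real (h * a) \<le> w (n - h') + real (h' * a)" using gap[of h' a h] by linarith
    qed
    then show "q \<in> tight w" using ah by simp
  qed
  have "w (n - h0') + real (h0' * a0) = w (n - h0) + real (h0 * a0)"
    using gap[of h0' a0 h0] b0(2) r0 by simp
  moreover have "(a0, h0) \<in> tight w" using sub b0(1) by (auto simp: B_def)
  ultimately have new: "(a0, h0') \<in> tight w"
    using b0(1) tightD[of a0 h0 w] by (intro tightI) (auto simp: B_def)
  have "(a0, h0') \<notin> tight v"
  proof
    assume "(a0, h0') \<in> tight v"
    then have "slack (a0, h0, h0') = 0" using tight_eq[of a0 h0' v h0] b0(1) by (simp add: slack_def B_def)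
    then show False using slack_pos[OF b0(1)] by simp
  qed
  then have "tight v \<subset> tight w" using sub new by blast
  then show thesis using that t_pos by (simp add: w_def e_def p_def)
qed

lemma tight_cell_hull:
  assumes I: "covering I"
  shows "tight_cell I = convex hull (tree_point ` {T. nu_tree \<nu> T \<and> I \<subseteq> T})"
proof
  show "convex hull (tree_point ` {T. nu_tree \<nu> T \<and> I \<subseteq> T}) \<subseteq> tight_cell I"
    by (rule hull_minimal) (use tree_point_in_cell convex_tight_cell[OF I] in auto)
  have finA: "finite A" by (rule lattice_finite)
  show "tight_cell I \<subseteq> convex hull (tree_point ` {T. nu_tree \<nu> T \<and> I \<subseteq> T})"
  proof
    fix v assume "v \<in> tight_cell I"
    then show "v \<in> convex hull (tree_point ` {T. nu_tree \<nu> T \<and> I \<subseteq> T})"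
    proof (induction "card A - card (tight v)" arbitrary: v rule: less_induct)
      case less
      have v: "v \<in> coord_space (n - 1)" "I \<subseteq> tight v" using less.prems by (auto simp: tight_cell_def)
      obtain T where T: "nu_tree \<nu> T" "tight v \<subseteq> T" using face_extends_to_tree[OF tight_face] .
      have p: "tree_point T \<in> convex hull (tree_point ` {T. nu_tree \<nu> T \<and> I \<subseteq> T})"
        using T v(2) by (intro hull_inc) auto
      show ?case
      proof (cases "tight v = T")
        case True
        then have "v = tree_point T" using point_of_tight_tree[OF T(1) v(1)] by simp
        then show ?thesis using p by simp
      next
        case False
        then have "tight v \<subset> T" using T(2) by blast
        then obtain t where t: "0 < t" "tight v \<subset> tight (v + t *\<^sub>R (v - tree_point T))"
          using push_away_from_tree_point[OF v(1) covering_mono[OF I v(2)] T(1)] by metis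
        define w where "w = v + t *\<^sub>R (v - tree_point T)"
        have sub: "tight w \<subseteq> A" by (auto simp: tight_def)
        then have "card (tight v) < card (tight w)" "card (tight w) \<le> card A"
          using t(2) psubset_card_mono[of "tight w" "tight v"] card_mono[OF finA sub] finite_subset[OF sub finA]
          by (auto simp: w_def)
        then have less': "card A - card (tight w) < card A - card (tight v)" by linarith
        have "w \<in> tight_cell I"
          using v t(2) tree_point_in_space[of T] unfolding w_def tight_cell_def
          by (auto simp: coord_space_def scaleR_fun_def)
        then have w: "w \<in> convex hull (tree_point ` {T. nu_tree \<nu> T \<and> I \<subseteq> T})"
          using less.hyps[OF less'] by blast
        \<comment> \<open>The point lies between the point that it was pushed to and the point of the tree.\<close>
        have "(1 / (1 + t)) *\<^sub>R w + (t / (1 + t)) *\<^sub>R tree_point T = v"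
        proof -
          have "w + t *\<^sub>R tree_point T = (1 + t) *\<^sub>R v" by (simp add: w_def algebra_simps)
          moreover have "(1 / (1 + t)) *\<^sub>R w + (t / (1 + t)) *\<^sub>R tree_point T
            = (1 / (1 + t)) *\<^sub>R (w + t *\<^sub>R tree_point T)" by (simp add: scaleR_add_right)
          ultimately show ?thesis using t(1) by simp
        qed
        moreover have "1 / (1 + t) + t / (1 + t) = 1" using t(1) by (simp flip: add_divide_distrib)
        ultimately show ?thesis
          using convexD[OF convex_convex_hull w p, of "1 / (1 + t)" "t / (1 + t)"] t(1) by simp
      qed
    qed
  qed
qed

text \<open>Every interior face is the exact tight set of some point: as long as a further point is
  tight, averaging with the tree that avoids it by a flip removes it.\<close>
lemma interior_point:
  assumes I: "covering I" "I \<in> tamari_complex \<nu>"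
  obtains v where "v \<in> coord_space (n - 1)" "tight v = I"
proof -
  obtain T where T: "nu_tree \<nu> T" "I \<subseteq> T" using face_extends_to_tree[OF I(2)] .
  then have "tree_point T \<in> tight_cell I" using tree_point_in_cell by blast
  then obtain v where v: "v \<in> tight_cell I"
    and least: "\<And>w. w \<in> tight_cell I \<Longrightarrow> card (tight v) \<le> card (tight w)"
    using ex_has_least_nat[of "\<lambda>v. v \<in> tight_cell I" _ "\<lambda>v. card (tight v)"] by metis
  have vI: "v \<in> coord_space (n - 1)" "I \<subseteq> tight v" using v by (auto simp: tight_cell_def)
  have "tight v \<subseteq> I"
  proof
    fix q assume q: "q \<in> tight v"
    show "q \<in> I"
    proof (rule ccontr)
      assume "q \<notin> I"
      obtain T where T: "nu_tree \<nu> T" "tight v \<subseteq> T" using face_extends_to_tree[OF tight_face] .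
      then have "q \<in> T" "I \<subseteq> T - {q}" using q vI(2) \<open>q \<notin> I\<close> by auto
      then obtain T' where T': "nu_tree \<nu> T'" "T - {q} \<subseteq> T'" "q \<notin> T'"
        using covering_flip[OF T(1) _ I(1)] by metis
      define w where "w = (1 - 1/2) *\<^sub>R v + (1/2) *\<^sub>R tree_point T'"
      have "I \<subseteq> T'" using \<open>I \<subseteq> T - {q}\<close> T'(2) by blast
      then have w: "tight w = tight v \<inter> T'"
        unfolding w_def using tight_between[OF I(1) vI(2), of "tree_point T'" "1/2"] tight_tree_point[OF T'(1)] by simp
      have "w \<in> coord_space (n - 1)" unfolding w_def using vI(1) tree_point_in_space by (rule coord_space_comb)
      then have "w \<in> tight_cell I" using w vI(2) \<open>I \<subseteq> T'\<close> by (simp add: tight_cell_def)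
      moreover have "card (tight w) < card (tight v)"
        using w q T'(3) face_finite[OF tight_face] by (intro psubset_card_mono) auto
      ultimately show False using least by fastforce
    qed
  qed
  then show thesis using that vI by blast
qed

lemma tight_cell_subset_iff:
  assumes "I \<in> interior_faces \<nu>" "J \<in> interior_faces \<nu>"
  shows "tight_cell I \<subseteq> tight_cell J \<longleftrightarrow> J \<subseteq> I"
proof
  assume sub: "tight_cell I \<subseteq> tight_cell J"
  obtain v where "v \<in> coord_space (n - 1)" "tight v = I"
    using interior_point assms(1) interior_iff by metis
  then show "J \<subseteq> I" using sub unfolding tight_cell_def by blast
qed (auto simp: tight_cell_def)

text \<open>A segment through a point at which a point of the diagram is tight has it tight at both ends.\<close>
lemma tight_cell_face_of:
  assumes I: "covering I" and J: "I \<subseteq> J"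
  shows "tight_cell J face_of tight_cell I"
  unfolding face_of_def
proof (intro conjI ballI impI)
  show "tight_cell J \<subseteq> tight_cell I" using J by (auto simp: tight_cell_def)
  show "convex (tight_cell J)" using convex_tight_cell[OF covering_mono[OF I J]] .
  fix v w x assume *: "v \<in> tight_cell I" "w \<in> tight_cell I" "x \<in> tight_cell J" "x \<in> open_segment v w"
  then obtain u where u: "0 < u" "u < 1" "x = (1 - u) *\<^sub>R v + u *\<^sub>R w" unfolding in_segment by blast
  then have "tight x = tight v \<inter> tight w" using tight_between[OF I _ _ u(1,2), of v w] * by (simp add: tight_cell_def)
  then have sub: "J \<subseteq> tight v" "J \<subseteq> tight w" using * by (auto simp: tight_cell_def)
  show "v \<in> tight_cell J" "w \<in> tight_cell J" using * sub by (auto simp: tight_cell_def)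
qed

text \<open>A face is the cell of the smallest tight set that occurs in it. A point \<open>v\<close> with this tight set
  can be moved a little away from any other point \<open>w\<close> of that cell without leaving it, so \<open>v\<close> is
  inside a segment that ends in \<open>w\<close>, and the face contains \<open>w\<close>.\<close>
lemma face_is_tight_cell:
  assumes I: "covering I" and F: "F face_of tight_cell I" "F \<noteq> {}"
  obtains J where "J \<in> interior_faces \<nu>" "I \<subseteq> J" "F = tight_cell J"
proof -
  obtain x0 where "x0 \<in> F" using F(2) by blast
  then obtain v where v: "v \<in> F" and least: "\<And>w. w \<in> F \<Longrightarrow> card (tight v) \<le> card (tight w)"
    using ex_has_least_nat[of "\<lambda>v. v \<in> F" _ "\<lambda>v. card (tight v)"] by metis
  have FI: "F \<subseteq> tight_cell I" and convF: "convex F"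
    and face: "\<And>a b x. a \<in> tight_cell I \<Longrightarrow> b \<in> tight_cell I \<Longrightarrow> x \<in> F \<Longrightarrow> x \<in> open_segment a b \<Longrightarrow> a \<in> F \<and> b \<in> F"
    using F(1) unfolding face_of_def by auto
  have vI: "v \<in> coord_space (n - 1)" "I \<subseteq> tight v" using v FI by (auto simp: tight_cell_def)
  have cov: "covering (tight v)" using covering_mono[OF I vI(2)] .
  have "F = tight_cell (tight v)"
  proof
    show "F \<subseteq> tight_cell (tight v)"
    proof
      fix w assume w: "w \<in> F"
      then have wI: "w \<in> coord_space (n - 1)" "I \<subseteq> tight w" using FI by (auto simp: tight_cell_def)
      define m where "m = (1 - 1/2) *\<^sub>R v + (1/2) *\<^sub>R w"
      have "m \<in> F" unfolding m_def using convexD_alt[OF convF v w, of "1/2"] by simp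
      then have "card (tight v) \<le> card (tight m)" using least by blast
      moreover have m: "tight m = tight v \<inter> tight w"
        unfolding m_def using tight_between[OF I vI(2) wI(2), of "1/2"] by simp
      ultimately have "tight m = tight v"
        using card_seteq[of "tight v" "tight m"] face_finite[OF tight_face] by blast
      then show "w \<in> tight_cell (tight v)" using wI m by (auto simp: tight_cell_def)
    qed
    show "tight_cell (tight v) \<subseteq> F"
    proof
      fix w assume w: "w \<in> tight_cell (tight v)"
      then have wv: "w \<in> coord_space (n - 1)" "tight v \<subseteq> tight w" by (auto simp: tight_cell_def)
      show "w \<in> F"
      proof (cases "w = v")
        case True
        then show ?thesis using v by simp
      next
        case False
        define e where "e = v - w"
        define slack where "slack = (\<lambda>(a, h, h'). v (n - h') + real (h' * a) - (v (n - h) + real (h * a)))"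
        define rate where "rate = (\<lambda>(a :: nat, h, h'). \<bar>e (n - h) - e (n - h')\<bar>)"
        define B where "B = {(a, h, h'). (a, h) \<in> tight v \<and> (a, h') \<in> A \<and> (a, h') \<notin> tight v}"
        have finB: "finite B"
        proof (rule finite_subset)
          show "B \<subseteq> fst ` A \<times> snd ` A \<times> snd ` A"
            using tight_in_lattice unfolding B_def by force
        qed (use lattice_finite in simp)
        have pos: "0 < slack b / (1 + rate b)" if "b \<in> B" for b
        proof -
          obtain a h h' where b: "b = (a, h, h')" by (cases b)
          have ah: "(a, h) \<in> tight v" "(a, h') \<in> A" "(a, h') \<notin> tight v" using that by (auto simp: b B_def)
          have "slack b \<noteq> 0"
          proof
            assume "slack b = 0"
            then have eq: "v (n - h') + real (h' * a) = v (n - h) + real (h * a)" by (simp add: b slack_def)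
            have "(a, h') \<in> tight v"
              by (rule tightI[OF ah(2)], unfold eq) (rule tightD[OF ah(1)])
            then show False using ah(3) by simp
          qed
          moreover have "0 \<le> slack b" using tightD[OF ah(1,2)] by (simp add: b slack_def)
          moreover have "0 < 1 + rate b" by (simp add: b rate_def add_pos_nonneg)
          ultimately show ?thesis by simp
        qed
        \<comment> \<open>The \<open>1\<close> keeps the minimum defined when no inequality is strict, and \<open>1 + rate b\<close> keeps the
          denominators positive.\<close>
        define t where "t = Min (insert 1 ((\<lambda>b. slack b / (1 + rate b)) ` B))"
        have t_pos: "0 < t" unfolding t_def using finB pos by simp
        define x where "x = v + t *\<^sub>R e"
        have xv: "x (n - h) = v (n - h) + t * e (n - h)" for h by (simp add: x_def scaleR_fun_def)
        have "tight v \<subseteq> tight x"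
        proof
          fix q assume q: "q \<in> tight v"
          obtain a h where ah: "q = (a, h)" by fastforce
          have "(a, h) \<in> tight x"
          proof (rule tightI)
            show "(a, h) \<in> A" using q ah tight_in_lattice by blast
            fix h' assume A: "(a, h') \<in> A"
            show "x (n - h) + real (h * a) \<le> x (n - h') + real (h' * a)"
            proof (cases "(a, h') \<in> tight v")
              case True
              then have eqs: "v (n - h) + real (h * a) = v (n - h') + real (h' * a)"
                "w (n - h) + real (h * a) = w (n - h') + real (h' * a)"
                using tight_eq[of a h v h'] tight_eq[of a h w h'] q ah wv(2) by auto
              then have "e (n - h) = e (n - h')" by (simp add: e_def)
              then show ?thesis using eqs(1) by (simp add: xv)
            next
              case False
              then have b: "(a, h, h') \<in> B" using q ah A by (simp add: B_def)
              have "t \<le> slack (a, h, h') / (1 + rate (a, h, h'))"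
                unfolding t_def using finB b by (intro Min_le) auto
              moreover have r: "0 \<le> rate (a, h, h')" by (simp add: rate_def)
              ultimately have "t * (1 + rate (a, h, h')) \<le> slack (a, h, h')"
                by (simp add: pos_le_divide_eq)
              moreover have "t * rate (a, h, h') \<le> t * (1 + rate (a, h, h'))" using t_pos by simp
              moreover have "t * (e (n - h) - e (n - h')) \<le> t * rate (a, h, h')"
                using t_pos by (intro mult_left_mono) (auto simp: rate_def)
              ultimately have "t * (e (n - h) - e (n - h')) \<le> slack (a, h, h')" by linarith
              then show ?thesis by (simp add: xv slack_def algebra_simps)
            qed
          qed
          then show "q \<in> tight x" using ah by simp
        qed
        then have xI: "x \<in> tight_cell I"
          using vI wv(1) by (auto simp: tight_cell_def x_def e_def coord_space_def scaleR_fun_def)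
        have wI: "w \<in> tight_cell I" using wv vI(2) by (auto simp: tight_cell_def)
        have "v \<in> open_segment w x"
          unfolding in_segment
        proof (intro conjI exI[of _ "1 / (1 + t)"])
          have "t *\<^sub>R w + x = (1 + t) *\<^sub>R v" by (simp add: x_def e_def algebra_simps)
          moreover have "1 - 1 / (1 + t) = t / (1 + t)" using t_pos by (simp add: field_simps)
          then have "(1 - 1 / (1 + t)) *\<^sub>R w + (1 / (1 + t)) *\<^sub>R x = (1 / (1 + t)) *\<^sub>R (t *\<^sub>R w + x)"
            by (simp add: scaleR_add_right)
          ultimately show "v = (1 - 1 / (1 + t)) *\<^sub>R w + (1 / (1 + t)) *\<^sub>R x" using t_pos by simp
          show "w \<noteq> x"
          proof
            assume "w = x"
            then have "(1 + t) *\<^sub>R (v - w) = 0" by (simp add: x_def e_def algebra_simps)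
            then show False using t_pos False by simp
          qed
        qed (use t_pos in auto)
        then show ?thesis using face[OF wI xI v] by blast
      qed
    qed
  qed
  moreover have "tight v \<in> interior_faces \<nu>" using interior_iff tight_face cov by blast
  ultimately show thesis using that vI(2) by blast
qed

lemma realization:
  assumes cell: "\<And>I. I \<in> interior_faces \<nu> \<Longrightarrow> \<phi> I = tight_cell I"
  shows "realizes_nu_associahedron \<nu> (n - 1) (insert {} (\<phi> ` interior_faces \<nu>)) \<phi>"
proof -
  let ?F = "interior_faces \<nu>"
  have img: "\<phi> ` ?F = tight_cell ` ?F" using cell by (intro image_cong) auto
  have finF: "finite ?F" using finite_subset[OF _ finite_faces] unfolding interior_faces_def by auto
  have finT: "finite {T. nu_tree \<nu> T \<and> I \<subseteq> T}" for I
    by (rule finite_subset[OF _ finite_faces]) (use tree_face in auto)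
  have cov: "covering I" if "I \<in> ?F" for I using that interior_iff by blast
  have nonempty: "tight_cell I \<noteq> {}" if "I \<in> ?F" for I
  proof -
    have I: "covering I" "I \<in> tamari_complex \<nu>" using that interior_iff by blast+
    obtain v where "v \<in> coord_space (n - 1)" "tight v = I" using interior_point[OF I] .
    then show ?thesis by (auto simp: tight_cell_def)
  qed
  have "polytopal_complex (n - 1) (insert {} (tight_cell ` ?F))"
    unfolding polytopal_complex_def
  proof (intro conjI ballI allI impI)
    show "finite (insert {} (tight_cell ` ?F))" using finF by simp
  next
    fix P assume "P \<in> insert {} (tight_cell ` ?F)"
    then show "polytope P" unfolding polytope_def
    proof
      assume "P = {}"
      then show "\<exists>v. finite v \<and> P = convex hull v" by (intro exI[of _ "{}"]) simp
    next
      assume "P \<in> tight_cell ` ?F"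
      then obtain I where "I \<in> ?F" "P = tight_cell I" by blast
      then show "\<exists>v. finite v \<and> P = convex hull v"
        using tight_cell_hull[OF cov[of I]] finT[of I] by blast
    qed
  next
    fix P assume "P \<in> insert {} (tight_cell ` ?F)"
    then show "P \<subseteq> coord_space (n - 1)" by (auto simp: tight_cell_def)
  next
    fix P F assume P: "P \<in> insert {} (tight_cell ` ?F)" and F: "F face_of P"
    show "F \<in> insert {} (tight_cell ` ?F)"
    proof (cases "F = {}")
      case False
      then have "P \<noteq> {}" using face_of_imp_subset[OF F] by blast
      then obtain I where I: "I \<in> ?F" "P = tight_cell I" using P by blast
      obtain J where "J \<in> ?F" "F = tight_cell J"
        using face_is_tight_cell[OF cov[OF I(1)] _ False] F I(2) by metis
      then show ?thesis by blast
    qed simp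
  next
    have "(P \<inter> P') face_of P" if P: "P \<in> insert {} (tight_cell ` ?F)" "P' \<in> insert {} (tight_cell ` ?F)" for P P'
    proof (cases "P = {} \<or> P' = {}")
      case True
      then show ?thesis by auto
    next
      case False
      then obtain I I' where I: "I \<in> ?F" "P = tight_cell I" "P' = tight_cell I'" using P by blast
      have "P \<inter> P' = tight_cell (I \<union> I')" unfolding I(2,3) by (auto simp: tight_cell_def)
      then show ?thesis using tight_cell_face_of[OF cov[OF I(1)], of "I \<union> I'"] I(2) by simp
    qed
    note face = this
    fix P P' assume P: "P \<in> insert {} (tight_cell ` ?F)" "P' \<in> insert {} (tight_cell ` ?F)"
    show "(P \<inter> P') face_of P" using face[OF P] .
    show "(P \<inter> P') face_of P'" using face[OF P(2,1)] by (simp add: Int_commute)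
  qed
  moreover have "order_anti_iso \<phi> ?F (insert {} (\<phi> ` ?F) - {{}})"
    unfolding order_anti_iso_def
  proof (intro conjI ballI)
    show order: "\<phi> I \<subseteq> \<phi> J \<longleftrightarrow> J \<subseteq> I" if "I \<in> ?F" "J \<in> ?F" for I J
      using tight_cell_subset_iff[OF that] cell that by simp
    show "bij_betw \<phi> ?F (insert {} (\<phi> ` ?F) - {{}})"
    proof (rule bij_betw_imageI)
      show "inj_on \<phi> ?F" using order by (intro inj_onI) blast
      show "\<phi> ` ?F = insert {} (\<phi> ` ?F) - {{}}" using nonempty cell by auto
    qed
  qed
  ultimately show ?thesis unfolding realizes_nu_associahedron_def img by blast
qed

section \<open>Paths from the root\<close>

text \<open>Paths that leave the root and only descend to children; they are the shortest walks.\<close>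
inductive descent :: "point set \<Rightarrow> point \<Rightarrow> point list \<Rightarrow> bool" for T
  where descent_root: "descent T (0, n) [(0, n)]"
  | descent_step: "descent T p P \<Longrightarrow> tree_edge T q p \<Longrightarrow> descent T q (P @ [q])"

lemma parent_exists:
  assumes T: "nu_tree \<nu> T" and q: "q \<in> T" "q \<noteq> (0, n)"
  obtains p where "tree_edge T q p"
proof -
  obtain a h where ah: "q = (a, h)" by fastforce
  have face: "T \<in> tamari_complex \<nu>" using tree_face[OF T] .
  show thesis
  proof (cases "\<exists>b<a. (b, h) \<in> T")
    case True
    then obtain b' where "(b', h) \<in> T" "b' < a" by blast
    then obtain b where "(b, h) \<in> T" "b < a" "\<And>c. b < c \<Longrightarrow> c < a \<Longrightarrow> (c, h) \<notin> T"
      using nearest_west by metis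
    then have "next_west T q (b, h)" unfolding next_west_def ah by auto
    then show thesis using that q(1) unfolding tree_edge_def by blast
  next
    case False
    have "h < n"
    proof (rule ccontr)
      assume "\<not> h < n"
      then have "h = n" using face_height[OF face] q(1) ah by (metis le_neq_implies_less)
      then show False using False root_in_tree[OF T] q(2) ah by (cases "a = 0") auto
    qed
    then obtain h' where h': "h < h'" "(a, h') \<in> T" using leftmost_has_north[OF T, of a h] q(1) ah False by metis
    obtain p where "next_north T (a, h) (a, p)" using next_north_exists[OF h'(2,1)] .
    then show thesis using that q(1) ah unfolding tree_edge_def by blast
  qed
qed

text \<open>A node with neighbours to its north and to its west would make these two incompatible.\<close>
lemma parent_unique:
  assumes T: "nu_tree \<nu> T" and "tree_edge T q p" "tree_edge T q p'"
  shows "p = p'"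
proof -
  obtain a h where ah: "q = (a, h)" by fastforce
  have q: "(a, h) \<in> T" using assms(2) ah by (simp add: tree_edge_def)
  have n: "p = p'" if "next_north T q p" "next_north T q p'" for p p'
    using that unfolding next_north_def ah by (cases p; cases p'; simp) (metis linorder_neqE_nat)
  have w: "p = p'" if "next_west T q p" "next_west T q p'" for p p'
    using that unfolding next_west_def ah by (cases p; cases p'; simp) (metis linorder_neqE_nat)
  have nw: False if "next_north T q p" "next_west T q p'" for p p'
    using that not_north_and_west[OF tree_face[OF T] q, of "snd p" "fst p'"]
    unfolding next_north_def next_west_def ah by (cases p; cases p'; auto)
  show ?thesis using assms(2,3) n w nw unfolding tree_edge_def by blast
qed

lemma root_no_parent:
  assumes T: "nu_tree \<nu> T" shows "\<not> tree_edge T (0, n) p"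
  using face_height[OF tree_face[OF T], of "fst p" "snd p"]
  unfolding tree_edge_def next_north_def next_west_def by auto

lemma tree_edge_monotone:
  assumes "tree_edge T q p" shows "fst p \<le> fst q" "snd q \<le> snd p" "p \<in> T" "q \<in> T"
    and "fst p + (n - snd p) < fst q + (n - snd q) \<or> n < snd p"
  using assms unfolding tree_edge_def next_north_def next_west_def by auto

lemma descent_exists:
  assumes T: "nu_tree \<nu> T" and "v \<in> T" shows "\<exists>P. descent T v P"
  using assms(2)
proof (induction "fst v + (n - snd v)" arbitrary: v rule: less_induct)
  case less
  show ?case
  proof (cases "v = (0, n)")
    case True
    then show ?thesis using descent_root by blast
  next
    case False
    then obtain p where p: "tree_edge T v p" using parent_exists[OF T less.prems] by metis
    then have "\<not> n < snd p"
      using face_height[OF tree_face[OF T], of "fst p" "snd p"] tree_edge_monotone(3) by fastforce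
    then obtain P where "descent T p P" using less.hyps[of p] tree_edge_monotone[OF p] by blast
    then show ?thesis using descent_step p by blast
  qed
qed

lemma descent_nonempty: "descent T v P \<Longrightarrow> P \<noteq> []"
  by (erule descent.cases) auto

lemma descent_unique:
  assumes T: "nu_tree \<nu> T" and "descent T v P" "descent T v P'" shows "P = P'"
  using assms(2,3)
proof (induction arbitrary: P' rule: descent.induct)
  case descent_root
  then show ?case by cases (use root_no_parent[OF T] in auto)
next
  case (descent_step p P q)
  from descent_step.prems show ?case
  proof cases
    case descent_root
    then show ?thesis using descent_step.hyps(2) root_no_parent[OF T] by blast
  next
    case (descent_step p' P')
    then show ?thesis using parent_unique[OF T] descent_step.IH \<open>tree_edge T q p\<close> by metis
  qed
qed

lemma descent_walk:
  assumes T: "nu_tree \<nu> T" and "descent T v P"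
  shows "tree_walk T (0, n) v P"
  using assms(2)
proof (induction rule: descent.induct)
  case descent_root
  then show ?case using root_in_tree[OF T] by (simp add: tree_walk_def)
next
  case (descent_step p P q)
  then show ?case
    using tree_edge_monotone(4)[of T q p] unfolding tree_walk_def by (auto simp: successively_append_iff)
qed

text \<open>Each step of a walk changes the length of the path to the root by one, so a walk is at least as long as
  the descent to its end, and equally long only if every step descends.\<close>
lemma descent_shortest:
  assumes T: "nu_tree \<nu> T" and "tree_walk T (0, n) v W" "descent T v P"
  shows "length P \<le> length W \<and> (length W = length P \<longrightarrow> W = P)"
  using assms(2,3)
proof (induction W arbitrary: v P rule: rev_induct)
  case Nil
  then show ?case by (simp add: tree_walk_def)
next
  case (snoc x W)
  have x: "x = v" using snoc.prems(1) by (simp add: tree_walk_def)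
  show ?case
  proof (cases "W = []")
    case True
    then have "v = (0, n)" using snoc.prems(1) x by (simp add: tree_walk_def)
    then have "P = [(0, n)]" using descent_unique[OF T snoc.prems(2)] descent_root by blast
    then show ?thesis using True x \<open>v = (0, n)\<close> by simp
  next
    case False
    define u where "u = last W"
    have W: "tree_walk T (0, n) u W" and edge: "tree_edge T u v \<or> tree_edge T v u"
      using snoc.prems(1) False x unfolding tree_walk_def u_def by (auto simp: successively_append_iff)
    then have "u \<in> T" using False unfolding tree_walk_def by (metis last_in_set subsetD)
    then obtain D where D: "descent T u D" using descent_exists[OF T] by blast
    note IH = snoc.IH[OF W D]
    show ?thesis
    proof (cases "tree_edge T v u")
      case True
      then have "P = D @ [v]" using descent_unique[OF T snoc.prems(2)] descent_step[OF D] by blast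
      then show ?thesis using IH x by auto
    next
      case False
      then have "D = P @ [u]" using descent_unique[OF T D] descent_step[OF snoc.prems(2)] edge by blast
      then show ?thesis using IH by auto
    qed
  qed
qed

lemma shortest_path_descent:
  assumes T: "nu_tree \<nu> T" and P: "descent T v P"
  shows "shortest_path T (0, n) v = P"
  unfolding shortest_path_def
proof (rule the_equality)
  show "tree_walk T (0, n) v P \<and> (\<forall>P'. tree_walk T (0, n) v P' \<longrightarrow> length P \<le> length P')"
    using descent_walk[OF T P] descent_shortest[OF T _ P] by blast
  fix W assume W: "tree_walk T (0, n) v W \<and> (\<forall>P'. tree_walk T (0, n) v P' \<longrightarrow> length W \<le> length P')"
  then show "W = P" using descent_walk[OF T P] descent_shortest[OF T _ P, of W] by (metis le_antisym)
qed

section \<open>The area to the left of a path\<close>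

lemma descent_monotone:
  assumes "descent T v P"
  shows "Suc j < length P \<Longrightarrow> tree_edge T (P ! Suc j) (P ! j)"
    and "p \<in> set P \<Longrightarrow> fst p \<le> fst v \<and> snd v \<le> snd p"
    and "last P = v"
  using assms
proof (induction arbitrary: j p rule: descent.induct)
  case descent_root
  { case 1 then show ?case by simp }
  { case 2 then show ?case by simp }
  { case 3 then show ?case by simp }
next
  case (descent_step u P q)
  { case 1
    have u: "P ! (length P - 1) = u"
      using descent_step.IH(3) descent_nonempty[OF descent_step.hyps(1)] by (simp add: last_conv_nth)
    show ?case
    proof (cases "Suc j < length P")
      case True
      then show ?thesis using descent_step.IH(1) by (simp add: nth_append)
    next
      case False
      then have "length P = Suc j" using 1 by simp
      then show ?thesis using u descent_step.hyps(2) by (simp add: nth_append)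
    qed }
  { case 2
    then show ?case
      using descent_step.IH(2)[of p] tree_edge_monotone[OF descent_step.hyps(2)] by auto }
  { case 3
    then show ?case by simp }
qed

lemma descent_crosses_strip:
  assumes "descent T v P" and "snd v \<le> g" "g < n"
  shows "\<exists>j. Suc j < length P \<and> fst (P ! j) = fst (P ! Suc j) \<and> snd (P ! Suc j) \<le> g \<and> g < snd (P ! j)"
  using assms
proof (induction rule: descent.induct)
  case descent_root
  then show ?case by simp
next
  case (descent_step p P q)
  show ?case
  proof (cases "snd p \<le> g")
    case True
    then obtain j where "Suc j < length P" "fst (P ! j) = fst (P ! Suc j)" "snd (P ! Suc j) \<le> g" "g < snd (P ! j)"
      using descent_step by blast
    then show ?thesis by (intro exI[of _ j]) (simp add: nth_append)
  next
    case False
    then have "next_north T q p" using descent_step.hyps(2) descent_step.prems(1)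
      unfolding tree_edge_def next_west_def by auto
    then have "fst p = fst q" by (simp add: next_north_def)
    moreover have "P \<noteq> []" using descent_nonempty[OF descent_step.hyps(1)] .
    moreover have "P ! (length P - 1) = p"
      using descent_monotone(3)[OF descent_step.hyps(1)] last_conv_nth[OF \<open>P \<noteq> []\<close>] by simp
    ultimately show ?thesis
      using False descent_step.prems(1) by (intro exI[of _ "length P - 1"]) (simp add: nth_append)
  qed
qed

text \<open>A vertical edge of the path is a vertical edge of the staircase, because compatibility with its
  upper end keeps all nodes of the lower rows to its right.\<close>
lemma descent_strip_abscissa:
  assumes T: "nu_tree \<nu> T" and P: "descent T (l, h) P" and v: "(l, h) \<in> T"
    and j: "Suc j < length P" "fst (P ! j) = fst (P ! Suc j)" "snd (P ! Suc j) \<le> g" "g < snd (P ! j)"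
  shows "fst (P ! j) = staircase T h g"
proof -
  define c where "c = fst (P ! j)"
  have edge: "tree_edge T (P ! Suc j) (P ! j)" using descent_monotone(1)[OF P j(1)] .
  have "(c, snd (P ! j)) = P ! j" "(c, snd (P ! Suc j)) = P ! Suc j" using j(2) by (simp_all add: c_def prod_eq_iff)
  then have nodes: "(c, snd (P ! j)) \<in> T" "(c, snd (P ! Suc j)) \<in> T"
    using tree_edge_monotone(3,4)[OF edge] by simp_all
  have low: "h \<le> snd (P ! Suc j)" "c \<le> l"
    using descent_monotone(2)[OF P, of "P ! Suc j"] j(1,2) by (simp_all add: c_def)
  have hn: "h \<le> n" and A: "(c, h) \<in> A"
    using face_in_lattice[OF tree_face[OF T] v] low(2) by (simp_all add: lattice_iff)
  have hg: "h \<le> g" using low(1) j(3) by simp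
  have "staircase T h g \<le> c" using staircase_le[OF T hg hn nodes(2)] low(1) j(3) by simp
  moreover obtain m where "m \<in> {h..g}" "(staircase T h g, m) \<in> T" using staircase_attained[OF T hg hn] by blast
  then have "c \<le> staircase T h g"
    using staircase_ge_of_node_above[OF T nodes(1) A, of m] j(4) by auto
  ultimately show ?thesis by (simp add: c_def)
qed

lemma left_of_descent_iff:
  assumes T: "nu_tree \<nu> T" and P: "descent T (l, h) P" and v: "(l, h) \<in> T" and g: "h \<le> g" "g < n"
  shows "left_of_path (x, g) P \<longleftrightarrow> x < staircase T h g"
proof
  assume "left_of_path (x, g) P"
  then obtain j where j: "Suc j < length P" "fst (P ! j) = fst (P ! Suc j)"
    "min (snd (P ! j)) (snd (P ! Suc j)) \<le> g" "Suc g \<le> max (snd (P ! j)) (snd (P ! Suc j))" "Suc x \<le> fst (P ! j)"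
    unfolding left_of_path_def Let_def by auto
  have "snd (P ! Suc j) \<le> snd (P ! j)"
    using tree_edge_monotone(2)[OF descent_monotone(1)[OF P j(1)]] .
  then show "x < staircase T h g"
    using descent_strip_abscissa[OF T P v j(1,2), of g] j(3,4,5) by auto
next
  assume x: "x < staircase T h g"
  obtain j where j: "Suc j < length P" "fst (P ! j) = fst (P ! Suc j)" "snd (P ! Suc j) \<le> g" "g < snd (P ! j)"
    using descent_crosses_strip[OF P] g by auto
  then show "left_of_path (x, g) P"
    using descent_strip_abscissa[OF T P v j] x unfolding left_of_path_def Let_def by (intro exI[of _ j]) auto
qed

lemma area_line_path:
  assumes T: "nu_tree \<nu> T" and i: "i \<le> n"
  shows "area \<nu> i (line_path \<nu> T i) = staircase_area T (n - i)"
proof -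
  define h where "h = n - i"
  define l where "l = (LEAST a. (a, h) \<in> T)"
  have hn: "h \<le> n" by (simp add: h_def)
  have end_node: "(row_length h, h) \<in> T" using row_end_in_tree[OF T hn] .
  have l: "(l, h) \<in> T" unfolding l_def using end_node by (rule LeastI)
  obtain P where P: "descent T (l, h) P" using descent_exists[OF T l] by blast
  have path: "line_path \<nu> T i = P"
    unfolding line_path_def leftmost_node_def top_left_def Let_def height_nu h_def[symmetric] l_def[symmetric]
    by (rule shortest_path_descent[OF T P])
  have "{c. unit_box_in \<nu> c \<and> h \<le> snd c \<and> snd c < n \<and> left_of_path c P}
      = (\<lambda>(g, x). (x, g)) ` (SIGMA g : {h..<n}. {..<staircase T h g})" (is "?L = ?R")
  proof
    show "?L \<subseteq> ?R"
    proof
      fix c assume c: "c \<in> ?L"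
      obtain x g where xg: "c = (x, g)" by fastforce
      show "c \<in> ?R" using c left_of_descent_iff[OF T P l, of g x] unfolding xg by force
    qed
    show "?R \<subseteq> ?L"
    proof
      fix c assume c: "c \<in> ?R"
      then obtain x g where xg: "c = (x, g)" "g \<in> {h..<n}" "x < staircase T h g" by auto
      have "staircase T h g \<le> row_length h" using staircase_le[OF T _ hn end_node, of g] xg(2) by simp
      then have "(Suc x, g) \<in> A" using lattice_mono[of "Suc x" h "Suc x" g] xg(2,3) hn by (simp add: lattice_iff)
      then show "c \<in> ?L" using xg left_of_descent_iff[OF T P l, of g x] by (simp add: unit_box_iff)
    qed
  qed
  then have "area \<nu> i (line_path \<nu> T i) = card ((\<lambda>(g, x). (x, g)) ` (SIGMA g : {h..<n}. {..<staircase T h g}))"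
    unfolding area_def path by (simp add: h_def)
  also have "\<dots> = card (SIGMA g : {h..<n}. {..<staircase T h g})"
    by (rule card_image) (auto simp: inj_on_def)
  also have "\<dots> = (\<Sum>g\<in>{h..<n}. staircase T h g)" by simp
  finally show ?thesis by (simp add: staircase_area_def h_def)
qed

end

section \<open>Brick vectors as sums over prefixes\<close>

lemma sum_fun_apply: "(\<Sum>k\<in>S. f k) x = (\<Sum>k\<in>S. f k x :: 'b::comm_monoid_add)"
  by (induction S rule: infinite_finite_induct) simp_all

lemma fundamental_weight_apply: "fundamental_weight p j = of_bool (j \<in> {1..p})"
  by (simp add: fundamental_weight_def sum_fun_apply unit_vec_def)

lemma word_prod_append: "word_prod (xs @ ys) = word_prod xs \<circ> word_prod ys"
  by (induction xs) (simp_all add: word_prod_def o_assoc)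

lemma word_prod_single: "word_prod [q] = simple_refl q"
  by (simp add: word_prod_def)

lemma bij_simple_refl: "bij (simple_refl q)"
  by (simp add: simple_refl_def)

lemma bij_word_prod: "bij (word_prod xs)"
proof (induction xs)
  case Nil
  then show ?case by (simp add: word_prod_def bij_id[unfolded id_def])
next
  case (Cons q xs)
  have "word_prod (q # xs) = simple_refl q \<circ> word_prod xs" by (simp add: word_prod_def)
  then show ?case using bij_comp[OF Cons bij_simple_refl] by (simp only:)
qed

lemma nths_prefix_outside:
  "k \<le> length xs \<Longrightarrow> nths xs ({..<k} - {j. j < length xs \<and> xs ! j \<in> T}) = filter (\<lambda>x. x \<notin> T) (take k xs)"
proof (induction xs arbitrary: k)
  case Nil
  then show ?case by simp
next
  case (Cons x xs)
  show ?case
  proof (cases k)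
    case 0
    then show ?thesis by simp
  next
    case (Suc k')
    have "{j. Suc j \<in> {..<k} - {j. j < length (x # xs) \<and> (x # xs) ! j \<in> T}}
        = {..<k'} - {j. j < length xs \<and> xs ! j \<in> T}"
      using Suc by auto
    then show ?thesis using Cons.IH[of k'] Cons.prems Suc by (simp add: nths_Cons)
  qed
qed

text \<open>A sum whose terms depend on the elements read before; it splits along the columns of the
  reading order.\<close>
primrec prefix_sum :: "('a list \<Rightarrow> 'a \<Rightarrow> 'b::comm_monoid_add) \<Rightarrow> 'a list \<Rightarrow> 'a list \<Rightarrow> 'b"
  where
    "prefix_sum f pre [] = 0"
  | "prefix_sum f pre (x # xs) = f pre x + prefix_sum f (pre @ [x]) xs"

lemma prefix_sum_conv: "prefix_sum f pre xs = (\<Sum>k<length xs. f (pre @ take k xs) (xs ! k))"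
proof (induction xs arbitrary: pre)
  case Nil
  then show ?case by simp
next
  case (Cons x xs)
  then show ?case by (simp add: sum.lessThan_Suc_shift del: sum.lessThan_Suc)
qed

lemma prefix_sum_append: "prefix_sum f pre (xs @ ys) = prefix_sum f pre xs + prefix_sum f (pre @ xs) ys"
  by (induction xs arbitrary: pre) (simp_all add: add.assoc)

lemma prefix_sum_concat:
  "prefix_sum f [] (concat (map g [0..<m])) = (\<Sum>a<m. prefix_sum f (concat (map g [0..<a])) (g a))"
  by (induction m) (simp_all add: prefix_sum_append)

lemma prefix_sum_upt:
  "l \<le> m \<Longrightarrow> prefix_sum f pre (map g [l..<m]) = (\<Sum>h\<in>{l..<m}. f (pre @ map g [l..<h]) (g h))"
proof (induction m)
  case 0
  then show ?case by simp
next
  case (Suc m)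
  then show ?case by (cases "l = Suc m") (simp_all add: prefix_sum_append)
qed

lemma filter_ge_upt:
  assumes "l \<le> m" shows "filter (\<lambda>b. l \<le> b) [0..<m] = [l..<m]"
proof -
  have "[0..<m] = [0..<l] @ [l..<m]" using upt_add_eq_append[of 0 l "m - l"] assms by simp
  then show ?thesis by (simp add: filter_empty_conv filter_id_conv)
qed

context composition_path
begin

definition column_bottom :: "nat \<Rightarrow> nat"
  where "column_bottom a = (LEAST h. (a, h) \<in> A)"

definition column :: "nat \<Rightarrow> point list"
  where "column a = map (Pair a) [column_bottom a..<Suc n]"

lemma column_bottom:
  assumes "a \<le> row_length n"
  shows "(a, column_bottom a) \<in> A" "column_bottom a \<le> n" "h < column_bottom a \<Longrightarrow> (a, h) \<notin> A"
proof -
  have "(a, n) \<in> A" using assms by (simp add: lattice_iff)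
  then show *: "(a, column_bottom a) \<in> A" unfolding column_bottom_def by (rule LeastI)
  then show "column_bottom a \<le> n" by (simp add: lattice_iff)
  show "h < column_bottom a \<Longrightarrow> (a, h) \<notin> A" unfolding column_bottom_def by (rule not_less_Least)
qed

lemma in_column_iff:
  "a \<le> row_length n \<Longrightarrow> (a, h) \<in> A \<longleftrightarrow> column_bottom a \<le> h \<and> h \<le> n"
  using column_bottom[of a] lattice_mono[of a "column_bottom a" a h] lattice_iff by (meson le_refl not_le)

lemma reading_order_columns: "reading_order \<nu> = concat (map column [0..<Suc (row_length n)])"
proof -
  have "filter (\<lambda>p. p \<in> A) (map (\<lambda>b. (a, b)) [0..<Suc n]) = column a" if "a \<in> set [0..<Suc (row_length n)]" for a
  proof -
    have a: "a \<le> row_length n" using that by auto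
    have "filter (\<lambda>b. (a, b) \<in> A) [0..<Suc n] = filter (\<lambda>b. column_bottom a \<le> b) [0..<Suc n]"
    proof (rule filter_cong[OF refl])
      fix b assume "b \<in> set [0..<Suc n]"
      then have "b \<le> n" by auto
      then show "(a, b) \<in> A \<longleftrightarrow> column_bottom a \<le> b" unfolding in_column_iff[OF a] by simp
    qed
    also have "\<dots> = [column_bottom a..<Suc n]" using column_bottom(2)[OF a] by (intro filter_ge_upt) simp
    finally show ?thesis unfolding column_def filter_map o_def by simp
  qed
  then have "map (\<lambda>a. filter (\<lambda>p. p \<in> A) (map (\<lambda>b. (a, b)) [0..<Suc n])) [0..<Suc (row_length n)]
      = map column [0..<Suc (row_length n)]"
    by (rule map_cong[OF refl])
  then show ?thesis
    unfolding reading_order_def height_nu width_nu filter_concat map_map o_def by (rule arg_cong)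
qed

definition letter :: "point \<Rightarrow> nat"
  where "letter p = Suc (root_dist \<nu> p)"

lemma letter_simp: "letter (a, h) = Suc (a + (n - h))"
  by (simp add: letter_def root_dist_def)

definition prefix_perm :: "point set \<Rightarrow> point list \<Rightarrow> nat \<Rightarrow> nat"
  where "prefix_perm T pre = word_prod (map letter (filter (\<lambda>p. p \<notin> T) pre))"

lemma prefix_perm_snoc:
  "prefix_perm T (pre @ [p]) = (if p \<in> T then prefix_perm T pre else prefix_perm T pre \<circ> simple_refl (letter p))"
  by (cases "p \<in> T") (simp_all add: prefix_perm_def word_prod_append word_prod_single)

lemma bij_prefix_perm: "bij (prefix_perm T pre)"
  by (simp add: prefix_perm_def bij_word_prod)

lemma tree_brick_vector_apply:
  "tree_brick_vector \<nu> T x =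
    - prefix_sum (\<lambda>pre p. of_bool (inv (prefix_perm T pre) x \<in> {1..letter p})) [] (reading_order \<nu>)"
proof -
  let ?ro = "reading_order \<nu>"
  have w: "weight_at (Q_word \<nu>) (positions \<nu> T) k x =
      of_bool (inv (prefix_perm T (take k ?ro)) x \<in> {1..letter (?ro ! k)})" if "k < length ?ro" for k
  proof -
    have "nths (Q_word \<nu>) ({..<k} - positions \<nu> T) = map letter (filter (\<lambda>x. x \<notin> T) (take k ?ro))"
      using nths_prefix_outside[of k ?ro T] that
      by (simp add: Q_word_def positions_def nths_map letter_def)
    then show ?thesis
      using that unfolding weight_at_def perm_act_def prefix_perm_def fundamental_weight_apply
      by (simp add: Q_word_def letter_def)
  qed
  have "tree_brick_vector \<nu> T x = - (\<Sum>k<length ?ro. weight_at (Q_word \<nu>) (positions \<nu> T) k x)"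
    by (simp add: tree_brick_vector_def brick_vector_def sum_fun_apply Q_word_def)
  also have "\<dots> = - (\<Sum>k<length ?ro. of_bool (inv (prefix_perm T ([] @ take k ?ro)) x \<in> {1..letter (?ro ! k)}))"
    using w by simp
  finally show ?thesis unfolding prefix_sum_conv .
qed

text \<open>Each letter contributes the number of pipes with label in \<open>X\<close> among the positions up to that
  letter. The inverse image of \<open>X\<close> under the partial product is the set of positions of these pipes.\<close>
lemma sum_tree_brick_vector:
  assumes "finite X"
  shows "(\<Sum>x\<in>X. tree_brick_vector \<nu> T x) =
    - (\<Sum>a\<le>row_length n. \<Sum>h\<in>{column_bottom a..n}.
        real (card ({1..letter (a, h)} \<inter>
          prefix_perm T (concat (map column [0..<a]) @ map (Pair a) [column_bottom a..<h]) -` X)))"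
proof -
  define f where "f = (\<lambda>pre p. real (card ({1..letter p} \<inter> prefix_perm T pre -` X)))"
  have "(\<Sum>x\<in>X. of_bool (inv (prefix_perm T pre) x \<in> {1..letter p})) = f pre p" for pre p
  proof -
    let ?w = "prefix_perm T pre"
    have w: "inv ?w (?w y) = y" "?w (inv ?w y) = y" for y
      using bij_prefix_perm[of T pre] by (simp_all add: bij_is_inj bij_is_surj surj_f_inv_f)
    have "{x \<in> X. inv ?w x \<in> {1..letter p}} = ?w ` ({1..letter p} \<inter> ?w -` X)"
    proof
      show "{x \<in> X. inv ?w x \<in> {1..letter p}} \<subseteq> ?w ` ({1..letter p} \<inter> ?w -` X)"
      proof
        fix x assume "x \<in> {x \<in> X. inv ?w x \<in> {1..letter p}}"
        then show "x \<in> ?w ` ({1..letter p} \<inter> ?w -` X)" using w(2) by (intro image_eqI[of _ _ "inv ?w x"]) auto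
      qed
      show "?w ` ({1..letter p} \<inter> ?w -` X) \<subseteq> {x \<in> X. inv ?w x \<in> {1..letter p}}" using w(1) by auto
    qed
    moreover have "inj_on ?w ({1..letter p} \<inter> ?w -` X)"
      using bij_is_inj[OF bij_prefix_perm] inj_on_subset by blast
    ultimately have "card {x \<in> X. inv ?w x \<in> {1..letter p}} = card ({1..letter p} \<inter> ?w -` X)"
      by (simp add: card_image)
    moreover have "(\<Sum>x\<in>X. of_bool (inv ?w x \<in> {1..letter p})) = real (card {x \<in> X. inv ?w x \<in> {1..letter p}})"
      using assms by (simp add: sum_of_bool_eq Int_def)
    ultimately show ?thesis by (simp add: f_def)
  qed
  then have "(\<Sum>x\<in>X. tree_brick_vector \<nu> T x) = - prefix_sum f [] (reading_order \<nu>)"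
    unfolding tree_brick_vector_apply prefix_sum_conv sum_negf by (subst sum.swap) simp
  also have "prefix_sum f [] (reading_order \<nu>) =
    (\<Sum>a<Suc (row_length n). \<Sum>h\<in>{column_bottom a..<Suc n}. f (concat (map column [0..<a]) @ map (Pair a) [column_bottom a..<h]) (a, h))"
    unfolding reading_order_columns prefix_sum_concat
  proof (rule sum.cong)
    fix a assume "a \<in> {..<Suc (row_length n)}"
    then have "column_bottom a \<le> Suc n" using column_bottom(2)[of a] by simp
    then show "prefix_sum f (concat (map column [0..<a])) (column a) =
      (\<Sum>h\<in>{column_bottom a..<Suc n}. f (concat (map column [0..<a]) @ map (Pair a) [column_bottom a..<h]) (a, h))"
      unfolding column_def[of a] by (rule prefix_sum_upt)
  qed simp
  finally show ?thesis by (simp add: f_def lessThan_Suc_atMost atLeastLessThanSuc_atLeastAtMost)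
qed

section \<open>The projection\<close>

text \<open>The set \<open>M_tilde\<close> cuts off the top of an initial segment, of which
  \<open>j + row_length (n - j)\<close> elements remain after \<open>j\<close> steps.\<close>
definition remaining :: "nat \<Rightarrow> nat"
  where "remaining j = j + row_length (n - j)"

lemma remaining_0: "remaining 0 = row_length n"
  by (simp add: remaining_def)

lemma remaining_Suc: "j < n \<Longrightarrow> remaining j = remaining (Suc j) + (k (Suc j) - 1)"
  using row_length_Suc[of "n - Suc j"] k_pos[of "Suc j"] by (simp add: remaining_def Suc_diff_Suc)

lemma remaining_le: "j \<le> n \<Longrightarrow> remaining j \<le> row_length n"
  by (induction j) (use remaining_0 remaining_Suc in auto)

lemma last_elements_interval: "last_elements c {1..m} = {m - c<..m}"
proof -
  have "{y \<in> {1..m}. x < y} = {x<..m}" for x by auto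
  then show ?thesis unfolding last_elements_def by auto
qed

lemma M_tilde_interval:
  "1 \<le> j \<Longrightarrow> j \<le> n \<Longrightarrow> M_tilde (row_length n) k j = {remaining j<..remaining (j - 1)}"
proof (induction j rule: less_induct)
  case (less j)
  have un: "(\<Union>i\<in>{1..<Suc m}. {remaining i<..remaining (i - 1)}) = {remaining m<..row_length n}" if "m \<le> n" for m
    using that
  proof (induction m)
    case 0
    then show ?case by (simp add: remaining_0)
  next
    case (Suc m)
    have "{1..<Suc (Suc m)} = insert (Suc m) {1..<Suc m}" by auto
    moreover have "remaining (Suc m) \<le> remaining m" "remaining m \<le> row_length n"
      using remaining_Suc[of m] remaining_le[of m] Suc.prems by auto
    ultimately show ?case using Suc by auto
  qed
  obtain m where m: "j = Suc m" using less.prems(1) by (cases j) auto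
  have "(\<Union>i\<in>{1..<j}. M_tilde (row_length n) k i) = (\<Union>i\<in>{1..<Suc m}. {remaining i<..remaining (i - 1)})"
    unfolding m by (rule SUP_cong) (use less m in auto)
  also have "\<dots> = {remaining m<..row_length n}" using un[of m] less.prems m by simp
  finally have "{1..row_length n} - (\<Union>i\<in>{1..<j}. M_tilde (row_length n) k i) = {1..remaining m}"
    using remaining_le[of m] less.prems m by auto
  then have "M_tilde (row_length n) k j = {remaining m - (k j - 1)<..remaining m}"
    unfolding M_tilde.simps[of _ _ j] by (simp only: last_elements_interval)
  then show ?case using remaining_Suc[of m] less.prems m by simp
qed

lemma proj_apply:
  assumes "i \<in> {1..n - 1}"
  shows "proj n (N_dim n k) k (trim (N_dim n k) b) i =
    (\<Sum>x\<in>{2..Suc i} \<union> {Suc (Suc (remaining i))..Suc (row_length n)}. b x)"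
proof -
  let ?N = "row_length n"
  have "(\<Sum>j=1..m. \<Sum>x\<in>M_set ?N k j. trim ?N b x) = (\<Sum>x\<in>{1..m} \<union> {remaining m<..?N}. trim ?N b x)"
    if "m \<le> n" for m
    using that
  proof (induction m)
    case 0
    then show ?case by (simp add: remaining_0)
  next
    case (Suc m)
    have r: "Suc m \<le> remaining (Suc m)" "remaining (Suc m) \<le> remaining m" "remaining m \<le> ?N"
      using remaining_Suc[of m] remaining_le[of m] Suc.prems by (auto simp: remaining_def)
    have M: "M_set ?N k (Suc m) = insert (Suc m) {remaining (Suc m)<..remaining m}"
      using M_tilde_interval[of "Suc m"] Suc.prems by (simp add: M_set_def)
    have "{1..Suc m} \<union> {remaining (Suc m)<..?N} = ({1..m} \<union> {remaining m<..?N}) \<union> M_set ?N k (Suc m)"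
      unfolding M using r by auto
    moreover have "({1..m} \<union> {remaining m<..?N}) \<inter> M_set ?N k (Suc m) = {}"
      unfolding M using r by auto
    ultimately have "(\<Sum>x\<in>{1..Suc m} \<union> {remaining (Suc m)<..?N}. trim ?N b x)
        = (\<Sum>x\<in>{1..m} \<union> {remaining m<..?N}. trim ?N b x) + (\<Sum>x\<in>M_set ?N k (Suc m). trim ?N b x)"
      using sum.union_disjoint[of "{1..m} \<union> {remaining m<..?N}" "M_set ?N k (Suc m)" "trim ?N b"] by (simp add: M)
    then show ?case using Suc by simp
  qed
  moreover have "i \<le> n" using assms by auto
  ultimately have "(\<Sum>j=1..i. \<Sum>x\<in>M_set ?N k j. trim ?N b x) = (\<Sum>x\<in>{1..i} \<union> {remaining i<..?N}. trim ?N b x)"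
    by blast
  moreover have "(\<Sum>j=1..i. proj1 n ?N k (trim ?N b) j) = (\<Sum>j=1..i. \<Sum>x\<in>M_set ?N k j. trim ?N b x)"
    using assms by (intro sum.cong) (auto simp: proj1_def)
  ultimately have "proj n ?N k (trim ?N b) i = (\<Sum>x\<in>{1..i} \<union> {remaining i<..?N}. trim ?N b x)"
    using assms by (simp add: proj_def proj2_def)
  also have "\<dots> = (\<Sum>x\<in>{1..i} \<union> {remaining i<..?N}. b (Suc x))"
  proof (rule sum.cong)
    fix x assume "x \<in> {1..i} \<union> {remaining i<..?N}"
    then show "trim ?N b x = b (Suc x)"
      using \<open>i \<le> n\<close> remaining_le[of i] by (auto simp: trim_def remaining_def)
  qed simp
  also have "\<dots> = (\<Sum>x\<in>Suc ` ({1..i} \<union> {remaining i<..?N}). b x)" by (simp add: sum.reindex)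
  also have "Suc ` ({1..i} \<union> {remaining i<..?N}) = {2..Suc i} \<union> {Suc (Suc (remaining i))..Suc ?N}"
  proof -
    have "{remaining i<..?N} = {Suc (remaining i)..?N}" by auto
    then show ?thesis by (simp add: image_Un image_Suc_atLeastAtMost numeral_2_eq_2)
  qed
  finally show ?thesis by (simp add: N_dim_eq)
qed

section \<open>Pipes that cross a line\<close>

text \<open>Here rows are counted from the top. \<open>crossing T i j\<close> is the
  abscissa at which the staircase ending on line \<open>i\<close> passes from row \<open>j\<close> to row \<open>j - 1\<close>;
  beyond row \<open>i\<close> the value is the end of row \<open>i\<close>.\<close>
definition crossing :: "point set \<Rightarrow> nat \<Rightarrow> nat \<Rightarrow> nat"
  where "crossing T i j =
    (if j = 0 then 0 else if j \<le> i then staircase T (n - i) (n - j) else row_length (n - i))"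

text \<open>The edges of the grid used by the pipes numbered from \<open>i + 2\<close> to \<open>i + row_length (n - i) + 1\<close>;
  \<open>north_edge T i a j\<close> is the edge that leaves the point of column \<open>a\<close> and row \<open>j\<close> to the north, and
  \<open>west_edge T i a j\<close> the one that enters it from the west. In the rows below line \<open>i\<close> all edges are
  used whose position in the word is at most \<open>i + row_length (n - i) + 1\<close>; in the other rows, the
  horizontal edges of the staircase and, up to the end of line \<open>i\<close>, the vertical edges off it.\<close>
definition north_edge :: "point set \<Rightarrow> nat \<Rightarrow> nat \<Rightarrow> nat \<Rightarrow> bool"
  where "north_edge T i a j \<longleftrightarrow>
    (if j \<le> i then a \<le> row_length (n - i) \<and> a \<noteq> crossing T i j else a + j \<le> i + row_length (n - i))"

definition west_edge :: "point set \<Rightarrow> nat \<Rightarrow> nat \<Rightarrow> nat \<Rightarrow> bool"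
  where "west_edge T i a j \<longleftrightarrow>
    (if j \<le> i then crossing T i j < a \<and> a \<le> crossing T i (Suc j) else a + j \<le> i + row_length (n - i))"

text \<open>The positions held by these pipes when column \<open>a\<close> has been read except for its topmost \<open>r\<close>
  points. In this order they belong to: the exits of the completed columns, the edges into the points
  of the column still to be read, the edge at which the reading has stopped, and the edges into the
  next column. Edges outside the diagram stand for pipes that have not entered yet; the
  formulas for the edges are chosen so that they keep their position from column to column.\<close>
definition occupied :: "point set \<Rightarrow> nat \<Rightarrow> nat \<Rightarrow> nat \<Rightarrow> nat \<Rightarrow> bool"
  where "occupied T i a r x \<longleftrightarrow>
    (if x \<le> a then north_edge T i (x - 1) 0
     else if x \<le> a + r then west_edge T i a (x - a - 1)
     else if x = a + r + 1 then north_edge T i a r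
     else west_edge T i (Suc a) (x - a - 2))"

context
  fixes T :: "point set" and i :: nat
  assumes T: "nu_tree \<nu> T" and i: "1 \<le> i" "i \<le> n"
begin

lemma crossing_bound: "crossing T i j \<le> row_length (n - i)"
  using staircase_le[OF T, of "n - i" "n - j" "row_length (n - i)" "n - i"] row_end_in_tree[OF T, of "n - i"] i
  by (auto simp: crossing_def)

lemma crossing_attained:
  assumes "1 \<le> j" "j \<le> i" shows "\<exists>m\<in>{j..i}. (crossing T i j, n - m) \<in> T"
proof -
  obtain g where g: "g \<in> {n - i..n - j}" "(staircase T (n - i) (n - j), g) \<in> T"
    using staircase_attained[OF T, of "n - i" "n - j"] diff_le_mono2[OF assms(2)] by auto
  then show ?thesis using assms i by (intro bexI[of _ "n - g"]) (auto simp: crossing_def)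
qed

lemma crossing_le:
  assumes "(a, n - m) \<in> T" "j \<le> m" "m \<le> i" shows "crossing T i j \<le> a"
  using staircase_le[OF T, of "n - i" "n - j" a "n - m"] assms diff_le_mono2[of j m n] diff_le_mono2[of m i n]
  by (auto simp: crossing_def)

lemma crossing_mono: "j \<le> i \<Longrightarrow> crossing T i j \<le> crossing T i (Suc j)"
proof (cases "j = i")
  case True
  then show ?thesis using crossing_bound[of i] by (simp add: crossing_def)
next
  case False
  assume "j \<le> i"
  then obtain m where "m \<in> {Suc j..i}" "(crossing T i (Suc j), n - m) \<in> T"
    using crossing_attained[of "Suc j"] False by auto
  then show ?thesis using crossing_le[of "crossing T i (Suc j)" m j] by auto
qed

lemma row_i_lattice: "a \<le> row_length (n - i) \<Longrightarrow> m \<le> i \<Longrightarrow> (a, n - m) \<in> A"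
  using lattice_mono[of "row_length (n - i)" "n - i" a "n - m"] i by (auto simp: lattice_iff)

lemma node_left_of_staircase:
  assumes "(a, n - j) \<in> T" "j \<le> i" "a \<le> row_length (n - i)"
  shows "crossing T i j \<le> a \<and> a \<le> crossing T i (Suc j)"
proof
  show "crossing T i j \<le> a" using crossing_le[OF assms(1) _ assms(2)] by simp
  show "a \<le> crossing T i (Suc j)"
  proof (rule ccontr)
    assume less: "\<not> a \<le> crossing T i (Suc j)"
    then have "Suc j \<le> i" using assms(2,3) by (cases "j = i") (auto simp: crossing_def)
    then obtain m where m: "m \<in> {Suc j..i}" "(crossing T i (Suc j), n - m) \<in> T"
      using crossing_attained[of "Suc j"] by auto
    then show False
      using face_no_clash[OF tree_face[OF T] m(2) assms(1)] less row_i_lattice[OF assms(3), of m] i m(1)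
        diff_less_mono2[of j m n] by auto
  qed
qed

text \<open>The two corners of the staircase in a row are nodes: the lower end of a vertical edge
  because the minimum that defines the crossing is attained there, the upper end because it
  is the first point of its column with a node to its left.\<close>
lemma staircase_corner_west:
  assumes "j \<le> i" "crossing T i j < crossing T i (Suc j)"
  shows "(crossing T i j, n - j) \<in> T"
proof (cases "j = 0")
  case True
  then show ?thesis using root_in_tree[OF T] by (simp add: crossing_def)
next
  case False
  then obtain m where m: "m \<in> {j..i}" "(crossing T i j, n - m) \<in> T" using crossing_attained[of j] assms(1) by auto
  have "m = j"
  proof (rule ccontr)
    assume "m \<noteq> j"
    then have "crossing T i (Suc j) \<le> crossing T i j" using crossing_le[OF m(2), of "Suc j"] m(1) by auto
    then show False using assms(2) by simp
  qed
  then show ?thesis using m(2) by simp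
qed

lemma staircase_corner_east:
  assumes "j \<le> i" "crossing T i j < crossing T i (Suc j)"
  shows "(crossing T i (Suc j), n - j) \<in> T"
proof (cases "j = i")
  case True
  then show ?thesis using row_end_in_tree[OF T, of "n - i"] by (simp add: crossing_def)
next
  case False
  define c where "c = crossing T i (Suc j)"
  have "\<exists>m\<in>{Suc j..i}. (c, n - m) \<in> T" using crossing_attained[of "Suc j"] False assms(1) by (auto simp: c_def)
  then obtain m where m: "m \<in> {Suc j..i}" "(c, n - m) \<in> T" by blast
  have c: "c \<le> row_length (n - i)" using crossing_bound by (simp add: c_def)
  have "(c, n - j) \<in> T"
  proof (rule column_node[OF T row_i_lattice[OF c assms(1)] staircase_corner_west[OF assms]])
    show "crossing T i j < c" using assms(2) by (simp add: c_def)
    fix a' h' assume *: "(a', h') \<in> T" "a' < c" "h' < n - j"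
    show "(c, h') \<notin> A"
    proof (cases "n - i \<le> h'")
      case True
      then have "n - (n - h') = h'" "Suc j \<le> n - h'" "n - h' \<le> i" using * by auto
      then have "c \<le> a'" using crossing_le[of a' "n - h'" "Suc j"] *(1) by (simp add: c_def)
      then show ?thesis using *(2) by simp
    next
      case False
      then have "h' < n - m" using m(1) by auto
      then show ?thesis using face_no_clash[OF tree_face[OF T] *(1) m(2) *(2)] by blast
    qed
  qed
  then show ?thesis by (simp add: c_def)
qed

text \<open>At every point the edges obey the rule of a pipe dream: pipes cross at a point that is not a
  node, and at a node the pipe from the west turns north and the pipe from the south turns east.\<close>
lemma pipes_at_point:
  assumes A: "(a, n - j) \<in> A" "j \<le> n"
  shows "(a, n - j) \<in> T \<Longrightarrow> north_edge T i a j = west_edge T i a j \<and> west_edge T i (Suc a) j = north_edge T i a (Suc j)"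
    and "(a, n - j) \<notin> T \<Longrightarrow> north_edge T i a j = north_edge T i a (Suc j) \<and> west_edge T i (Suc a) j = west_edge T i a j"
proof -
  define L where "L = row_length (n - i)"
  define c where "c = crossing T i"
  have mono: "c j \<le> c (Suc j)" if "j \<le> i" using crossing_mono that by (simp add: c_def)
  have bound: "c j \<le> L" for j using crossing_bound by (simp add: c_def L_def)
  have last: "c (Suc i) = L" by (simp add: c_def L_def crossing_def)
  note edges = north_edge_def west_edge_def L_def[symmetric] c_def[symmetric]
  have next': "north_edge T i a (Suc j) \<longleftrightarrow> a \<noteq> c (Suc j)" if "j \<le> i" "a \<le> L"
  proof (cases "j = i")
    case True
    then show ?thesis using that last unfolding edges by auto
  next
    case False
    then show ?thesis using that unfolding edges by auto
  qed
  have outside: "\<not> north_edge T i a j \<and> \<not> north_edge T i a (Suc j) \<and> \<not> west_edge T i a j \<and> \<not> west_edge T i (Suc a) j"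
    if "j \<le> i" "\<not> a \<le> L"
    using that bound[of "Suc j"] unfolding edges by auto
  have lower: "north_edge T i a j = west_edge T i a j \<and> west_edge T i (Suc a) j = north_edge T i a (Suc j)"
    if "\<not> j \<le> i"
    using that unfolding edges by auto
  show "(a, n - j) \<in> T \<Longrightarrow> north_edge T i a j = west_edge T i a j \<and> west_edge T i (Suc a) j = north_edge T i a (Suc j)"
  proof -
    assume node: "(a, n - j) \<in> T"
    show ?thesis
    proof (cases "j \<le> i \<and> a \<le> L")
      case True
      then have "c j \<le> a" "a \<le> c (Suc j)" using node_left_of_staircase[OF node] by (auto simp: c_def L_def)
      then show ?thesis using True next' unfolding edges by auto
    next
      case False
      then show ?thesis using lower outside by blast
    qed
  qed
  show "(a, n - j) \<notin> T \<Longrightarrow> north_edge T i a j = north_edge T i a (Suc j) \<and> west_edge T i (Suc a) j = west_edge T i a j"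
  proof -
    assume node: "(a, n - j) \<notin> T"
    show ?thesis
    proof (cases "j \<le> i")
      case True
      show ?thesis
      proof (cases "a \<le> L")
        case aL: True
        have "\<not> (a = c j \<and> c j < c (Suc j))" using staircase_corner_west[OF True] node by (auto simp: c_def)
        moreover have "\<not> (a = c (Suc j) \<and> c j < c (Suc j))" using staircase_corner_east[OF True] node by (auto simp: c_def)
        ultimately show ?thesis using True aL next'[OF True aL] mono[OF True] unfolding edges by auto
      qed (use outside True in blast)
    next
      case False
      \<comment> \<open>The equality \<open>a + j = i + L\<close> is only possible at the end of a row, which is a node.\<close>
      have "a \<noteq> row_length (n - j)" using node row_end_in_tree[OF T, of "n - j"] by auto
      then have "a < row_length (n - j)" using A by (simp add: lattice_iff)
      moreover have "row_length (n - j) + (j - i) \<le> L"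
        using row_length_gap[of "n - j" "n - i"] False A(2) by (simp add: L_def)
      ultimately have "a + j < i + L" using False by linarith
      then show ?thesis using False unfolding edges by auto
    qed
  qed
qed

text \<open>Reading a point changes only the two positions of its letter.\<close>
lemma occupied_step:
  assumes A: "(a, n - j) \<in> A" "j \<le> n"
  shows "occupied T i a j x =
    (if (a, n - j) \<in> T then occupied T i a (Suc j) x else occupied T i a (Suc j) (simple_refl (a + j + 1) x))"
proof -
  note rules = pipes_at_point[OF A]
  consider "x \<le> a" | "a < x" "x < a + j + 1" | "x = a + j + 1" | "x = a + j + 2" | "a + j + 2 < x" by linarith
  then show ?thesis
  proof cases
    case 1
    then have "simple_refl (a + j + 1) x = x" by (simp add: simple_refl_def)
    then show ?thesis using 1 by (simp add: occupied_def)
  next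
    case 2
    then have "simple_refl (a + j + 1) x = x" by (simp add: simple_refl_def)
    then show ?thesis using 2 by (simp add: occupied_def)
  next
    case 3
    then have "simple_refl (a + j + 1) x = a + j + 2" by (simp add: simple_refl_def)
    then show ?thesis using 3 rules by (auto simp: occupied_def)
  next
    case 4
    then have "simple_refl (a + j + 1) x = a + j + 1" by (simp add: simple_refl_def)
    then show ?thesis using 4 rules by (auto simp: occupied_def)
  next
    case 5
    then have "simple_refl (a + j + 1) x = x" by (simp add: simple_refl_def)
    then show ?thesis using 5 by (simp add: occupied_def)
  qed
qed

lemma occupied_next_column:
  assumes a: "Suc a \<le> row_length n"
  shows "occupied T i (Suc a) (Suc n - column_bottom (Suc a)) x = occupied T i a 0 x"
proof -
  define b where "b = n - column_bottom (Suc a)"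
  define L where "L = row_length (n - i)"
  have cb: "column_bottom (Suc a) \<le> n" using column_bottom(2)[OF a] .
  have b: "Suc n - column_bottom (Suc a) = Suc b" using cb by (simp add: b_def)
  \<comment> \<open>If the column ends in a row above line \<open>i\<close>, it lies beyond the end of line \<open>i\<close>.\<close>
  have beyond: "L < Suc a" if "Suc b \<le> i"
  proof (rule ccontr)
    assume "\<not> L < Suc a"
    then have "(Suc a, n - i) \<in> A" by (simp add: L_def lattice_iff)
    moreover have "n - i < column_bottom (Suc a)" using that cb i unfolding b_def by linarith
    ultimately show False using column_bottom(3)[OF a] by blast
  qed
  have bound: "crossing T i j \<le> L" for j using crossing_bound by (simp add: L_def)
  have edge1: "north_edge T i (Suc a) (Suc b) = west_edge T i (Suc a) (Suc b)"
  proof (cases "Suc b \<le> i")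
    case True
    then show ?thesis using beyond[OF True] bound[of "Suc (Suc b)"] by (auto simp: north_edge_def west_edge_def L_def)
  next
    case False
    then show ?thesis by (simp add: north_edge_def west_edge_def)
  qed
  have edge2: "west_edge T i (Suc (Suc a)) j = west_edge T i (Suc a) (Suc j)" if "Suc b \<le> j" for j
  proof (cases "j \<le> i")
    case True
    then have "L < Suc a" using beyond that by simp
    then show ?thesis using True bound[of "Suc j"] bound[of "Suc (Suc j)"]
      by (auto simp: west_edge_def L_def)
  next
    case False
    then show ?thesis by (simp add: west_edge_def)
  qed
  consider "x \<le> a" | "x = Suc a" | "Suc a < x" "x \<le> a + b + 2" | "x = a + b + 3" | "a + b + 3 < x" by linarith
  then show ?thesis
  proof cases
    case 5
    then obtain y where y: "x = y + a + 3" "Suc b \<le> y" using le_Suc_ex[of "a + b + 4" x] by (auto simp: ac_simps)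
    show ?thesis using edge2[OF y(2)] y unfolding b occupied_def by simp
  qed (use edge1 in \<open>auto simp: b occupied_def\<close>)
qed

text \<open>The positions held by the remaining pipes. The first and the last pipe are left out: they keep
  their positions because the root and the ends of the rows are nodes.\<close>
definition free_positions :: "nat \<Rightarrow> nat \<Rightarrow> nat set"
  where "free_positions a r = {x \<in> {2..Suc (row_length n)}. \<not> occupied T i a r x}"

lemma letter_range:
  assumes A: "(a, n - j) \<in> A" "j \<le> n" and node: "(a, n - j) \<notin> T"
  shows "2 \<le> a + j + 1" "a + j + 1 \<le> row_length n"
proof -
  have "\<not> (a = 0 \<and> j = 0)" using node root_in_tree[OF T] by (intro notI) simp
  then show "2 \<le> a + j + 1" by auto
  have "a \<noteq> row_length (n - j)" using node row_end_in_tree[OF T, of "n - j"] by auto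
  then have "a < row_length (n - j)" using A by (simp add: lattice_iff)
  moreover have "row_length (n - j) + j \<le> row_length n" using row_length_gap[of "n - j" n] A(2) by simp
  ultimately show "a + j + 1 \<le> row_length n" by linarith
qed

lemma free_positions_step:
  assumes A: "(a, n - j) \<in> A" "j \<le> n"
  shows "free_positions a j =
    (if (a, n - j) \<in> T then free_positions a (Suc j) else simple_refl (a + j + 1) -` free_positions a (Suc j))"
proof (cases "(a, n - j) \<in> T")
  case True
  then show ?thesis using occupied_step[OF A] by (simp add: free_positions_def)
next
  case False
  let ?s = "simple_refl (a + j + 1)"
  have "?s x \<in> {2..Suc (row_length n)} \<longleftrightarrow> x \<in> {2..Suc (row_length n)}" for x
    using letter_range[OF A False] unfolding simple_refl_def Transposition.transpose_def by auto
  then show ?thesis using occupied_step[OF A] False by (auto simp: free_positions_def)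
qed

lemma free_positions_start:
  "free_positions 0 (Suc n) = {2..Suc i} \<union> {Suc (Suc (remaining i))..Suc (row_length n)}"
proof -
  have cr: "\<not> west_edge T i 0 j" if "j \<le> i" for j using that by (simp add: west_edge_def)
  have "occupied T i 0 (Suc n) x \<longleftrightarrow> Suc (Suc i) \<le> x \<and> x \<le> Suc (remaining i)" if "2 \<le> x" for x
  proof -
    consider "x \<le> Suc n" | "x = Suc (Suc n)" | "Suc (Suc n) < x" by linarith
    then show ?thesis
    proof cases
      case 1
      then show ?thesis using that cr[of "x - 1"] i
        by (cases "x - 1 \<le> i") (auto simp: occupied_def west_edge_def remaining_def)
    next
      case 2
      then show ?thesis using i by (auto simp: occupied_def north_edge_def remaining_def)
    next
      case 3
      then have x: "\<not> x - 2 \<le> i" "Suc 0 + (x - 2) = x - 1" using i by auto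
      have "occupied T i 0 (Suc n) x \<longleftrightarrow> west_edge T i (Suc 0) (x - 2)" using 3 by (simp add: occupied_def)
      then show ?thesis using 3 x i by (auto simp: west_edge_def remaining_def)
    qed
  qed
  then show ?thesis
    using remaining_le[OF i(2)] by (auto simp: free_positions_def remaining_def)
qed

text \<open>The pipes selected by the projection are those with a label in the set on the left.\<close>
lemma free_positions_prefix:
  assumes a: "a \<le> row_length n" and h: "column_bottom a \<le> h" "h \<le> Suc n"
  shows "prefix_perm T (concat (map column [0..<a]) @ map (Pair a) [column_bottom a..<h])
      -` ({2..Suc i} \<union> {Suc (Suc (remaining i))..Suc (row_length n)}) = free_positions a (Suc n - h)"
  using a h
proof (induction a arbitrary: h)
  case 0
  have bottom: "column_bottom 0 = 0" using column_bottom(3)[of 0 0] by (auto simp: lattice_iff)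
  have "h \<le> Suc n \<Longrightarrow> prefix_perm T (map (Pair 0) [0..<h])
      -` ({2..Suc i} \<union> {Suc (Suc (remaining i))..Suc (row_length n)}) = free_positions 0 (Suc n - h)" for h
  proof (induction h)
    case 0
    then show ?case using free_positions_start by (simp add: prefix_perm_def word_prod_def)
  next
    case (Suc h)
    have j: "n - (n - h) = h" "Suc n - h = Suc (n - h)" "n - h \<le> n" using Suc.prems by auto
    have A: "(0, n - (n - h)) \<in> A" using Suc.prems by (simp add: lattice_iff)
    show ?case
      using Suc free_positions_step[OF A j(3)] unfolding j
      by (auto simp: prefix_perm_snoc letter_simp vimage_comp[symmetric] simp del: vimage_Un)
  qed
  then show ?case using 0 bottom by simp
next
  case (Suc a)
  note cb = column_bottom(1,2)[OF Suc.prems(1)]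
  have "column_bottom (Suc a) \<le> h \<Longrightarrow> h \<le> Suc n \<Longrightarrow>
      prefix_perm T (concat (map column [0..<Suc a]) @ map (Pair (Suc a)) [column_bottom (Suc a)..<h])
      -` ({2..Suc i} \<union> {Suc (Suc (remaining i))..Suc (row_length n)}) = free_positions (Suc a) (Suc n - h)" for h
  proof (induction h rule: dec_induct)
    case base
    have "free_positions (Suc a) (Suc n - column_bottom (Suc a)) = free_positions a 0"
      using occupied_next_column[OF Suc.prems(1)] by (simp add: free_positions_def)
    moreover have "column_bottom a \<le> Suc n" using column_bottom(2)[of a] Suc.prems(1) by simp
    ultimately show ?case using Suc.IH[of "Suc n"] Suc.prems(1) by (simp add: column_def del: upt_Suc) (simp add: column_def)
  next
    case (step h)
    have j: "n - (n - h) = h" "Suc n - h = Suc (n - h)" "n - h \<le> n" using step.prems by auto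
    have A: "(Suc a, n - (n - h)) \<in> A" using lattice_mono[OF cb(1), of "Suc a" h] step j by simp
    have snoc: "concat (map column [0..<Suc a]) @ map (Pair (Suc a)) [column_bottom (Suc a)..<Suc h]
      = (concat (map column [0..<Suc a]) @ map (Pair (Suc a)) [column_bottom (Suc a)..<h]) @ [(Suc a, h)]"
      using step.hyps by simp
    show ?case
      using step free_positions_step[OF A j(3)] unfolding j snoc prefix_perm_snoc
      by (auto simp: letter_simp vimage_comp[symmetric] simp del: vimage_Un)
  qed
  then show ?case using Suc.prems by blast
qed

end

section \<open>Counting the pipes\<close>

definition free_count :: "point set \<Rightarrow> nat \<Rightarrow> nat \<Rightarrow> nat \<Rightarrow> nat"
  where "free_count T i a r = card {x \<in> {2..a + r}. \<not> occupied T i a r x}"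

lemma free_count_Suc:
  "free_count T i a (Suc r) = free_count T i a r + of_bool (\<not> (a = 0 \<and> r = 0) \<and> \<not> west_edge T i a r)"
proof -
  have occ: "occupied T i a (Suc r) x = occupied T i a r x" if "x \<le> a + r" for x
    using that by (simp add: occupied_def)
  have new: "occupied T i a (Suc r) (a + Suc r) = west_edge T i a r"
    by (simp add: occupied_def)
  have "{x \<in> {2..a + Suc r}. \<not> occupied T i a (Suc r) x} =
    {x \<in> {2..a + r}. \<not> occupied T i a r x} \<union>
    (if \<not> (a = 0 \<and> r = 0) \<and> \<not> west_edge T i a r then {a + Suc r} else {})"
    using occ new by (auto simp: le_Suc_eq)
  then show ?thesis by (simp add: free_count_def card_insert_if)
qed

text \<open>The value that \<open>free_count\<close> takes at points which do not have the staircase on their right; at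
  the others \<open>free_count\<close> is smaller by one. The value is the same for all trees.\<close>
primrec base_count :: "nat \<Rightarrow> nat \<Rightarrow> nat \<Rightarrow> nat"
  where
    "base_count i a 0 = card {x \<in> {2..a}. \<not> x - 1 \<le> row_length (n - i)}"
  | "base_count i a (Suc r) = base_count i a r +
      (if a = 0 \<and> r = 0 then 0 else if r < i then 1
       else if r = i then of_bool (a = 0 \<or> row_length (n - i) < a)
       else of_bool (\<not> a + r \<le> i + row_length (n - i)))"

text \<open>Coming down from the root, the staircase passes from the left to the right of a column in a single
  row. That row adds no free position, and from there on the staircase is on the right.\<close>
lemma free_count_eq:
  assumes T: "nu_tree \<nu> T" and i: "1 \<le> i" "i \<le> n"
  shows "free_count T i a r + of_bool (1 \<le> a \<and> r \<le> i \<and> a \<le> crossing T i r) = base_count i a r"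
proof (induction r)
  case 0
  have "{x \<in> {2..a}. \<not> occupied T i a 0 x} = {x \<in> {2..a}. \<not> x - 1 \<le> row_length (n - i)}"
    by (auto simp: occupied_def north_edge_def crossing_def)
  then show ?case by (auto simp: free_count_def crossing_def)
next
  case (Suc r)
  have bound: "crossing T i j \<le> row_length (n - i)" for j using crossing_bound[OF T i] .
  consider "r < i" | "r = i" | "i < r" by linarith
  then show ?case
  proof cases
    case 1
    then have "crossing T i r \<le> crossing T i (Suc r)" using crossing_mono[OF T i, of r] by simp
    then show ?thesis using 1 Suc
      by (cases "a = 0") (auto simp: free_count_Suc west_edge_def split: if_splits)
  next
    case 2
    have "crossing T i (Suc r) = row_length (n - i)" using 2 by (simp add: crossing_def)
    then show ?thesis using 2 Suc bound[of r] i by (auto simp: free_count_Suc west_edge_def split: if_splits)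
  next
    case 3
    then show ?thesis using Suc by (auto simp: free_count_Suc west_edge_def)
  qed
qed

text \<open>The points with the staircase on their right are the north-east corners of the unit boxes to its
  left.\<close>
lemma sum_crossing_points:
  assumes T: "nu_tree \<nu> T" and i: "1 \<le> i" "i \<le> n"
  shows "(\<Sum>a\<le>row_length n. \<Sum>h\<in>{column_bottom a..n}.
      of_bool (1 \<le> a \<and> Suc n - h \<le> i \<and> a \<le> crossing T i (Suc n - h))) = real (staircase_area T (n - i))"
proof -
  let ?S = "SIGMA a : {..row_length n}. {column_bottom a..n}"
  let ?P = "\<lambda>(a, h). 1 \<le> a \<and> Suc n - h \<le> i \<and> a \<le> crossing T i (Suc n - h)"
  let ?R = "SIGMA g : {n - i..<n}. {..<staircase T (n - i) g}"
  have crossing: "crossing T i (n - g) = staircase T (n - i) g" if "g \<in> {n - i..<n}" for g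
    using that i by (auto simp: crossing_def)
  have "{p \<in> ?S. ?P p} = (\<lambda>(g, x). (Suc x, Suc g)) ` ?R"
  proof
    show "{p \<in> ?S. ?P p} \<subseteq> (\<lambda>(g, x). (Suc x, Suc g)) ` ?R"
    proof
      fix p assume p: "p \<in> {p \<in> ?S. ?P p}"
      obtain a h where ah: "p = (a, h)" by fastforce
      have *: "1 \<le> a" "h \<le> n" "Suc n - h \<le> i" "a \<le> crossing T i (Suc n - h)" using p by (auto simp: ah)
      have h: "1 \<le> h" "h - 1 \<in> {n - i..<n}" using * i by auto
      moreover have "n - (h - 1) = Suc n - h" using * h(1) by simp
      ultimately have "a \<le> staircase T (n - i) (h - 1)" using *(4) crossing[of "h - 1"] by simp
      then have "a - 1 \<in> {..<staircase T (n - i) (h - 1)}" using *(1) by auto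
      then have "(h - 1, a - 1) \<in> ?R" using h(2) by blast
      moreover have "p = (\<lambda>(g, x). (Suc x, Suc g)) (h - 1, a - 1)" using *(1) h(1) ah by simp
      ultimately show "p \<in> (\<lambda>(g, x). (Suc x, Suc g)) ` ?R" by (rule rev_image_eqI)
    qed
    show "(\<lambda>(g, x). (Suc x, Suc g)) ` ?R \<subseteq> {p \<in> ?S. ?P p}"
    proof
      fix p assume "p \<in> (\<lambda>(g, x). (Suc x, Suc g)) ` ?R"
      then obtain g x where gx: "p = (Suc x, Suc g)" "g \<in> {n - i..<n}" "x < staircase T (n - i) g" by auto
      have "Suc x \<le> crossing T i (n - g)" using gx(2,3) crossing by simp
      moreover have "Suc x \<le> row_length (n - i)" using calculation crossing_bound[OF T i, of "n - g"] by simp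
      then have A: "(Suc x, Suc g) \<in> A"
        using lattice_mono[of "Suc x" "n - i" "Suc x" "Suc g"] gx(2) by (simp add: lattice_iff)
      then have x: "Suc x \<le> row_length n" using row_length_mono[of "Suc g" n] by (simp add: lattice_iff)
      ultimately show "p \<in> {p \<in> ?S. ?P p}"
        using gx(2) in_column_iff[OF x, of "Suc g"] A x unfolding gx(1) by auto
    qed
  qed
  moreover have "inj_on (\<lambda>(g, x). (Suc x, Suc g)) ?R" by (auto simp: inj_on_def)
  ultimately have "card {p \<in> ?S. ?P p} = card ?R" by (simp add: card_image)
  also have "\<dots> = staircase_area T (n - i)" by (simp add: staircase_area_def)
  finally have card: "card {p \<in> ?S. ?P p} = staircase_area T (n - i)" .
  have "(\<Sum>a\<le>row_length n. \<Sum>h\<in>{column_bottom a..n}.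
      of_bool (1 \<le> a \<and> Suc n - h \<le> i \<and> a \<le> crossing T i (Suc n - h))) = (\<Sum>p\<in>?S. of_bool (?P p) :: real)"
    by (subst sum.Sigma) (auto simp: case_prod_beta)
  also have "\<dots> = real (card (?S \<inter> {p. ?P p}))" by (simp add: case_prod_beta)
  also have "?S \<inter> {p. ?P p} = {p \<in> ?S. ?P p}" by blast
  finally show ?thesis using card by simp
qed

lemma proj_brick_vector:
  assumes T: "nu_tree \<nu> T" and i: "i \<in> {1..n - 1}"
  shows "proj n (N_dim n k) k (trim (N_dim n k) (tree_brick_vector \<nu> T)) i =
    real (staircase_area T (n - i)) -
      (\<Sum>a\<le>row_length n. \<Sum>h\<in>{column_bottom a..n}. real (base_count i a (Suc n - h)))"
proof -
  have i': "1 \<le> i" "i \<le> n" using i by auto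
  let ?X = "{2..Suc i} \<union> {Suc (Suc (remaining i))..Suc (row_length n)}"
  define pre where "pre = (\<lambda>a h. concat (map column [0..<a]) @ map (Pair a) [column_bottom a..<h])"
  define ind :: "nat \<Rightarrow> nat \<Rightarrow> real"
    where "ind = (\<lambda>a h. of_bool (1 \<le> a \<and> Suc n - h \<le> i \<and> a \<le> crossing T i (Suc n - h)))"
  have count: "real (card ({1..letter (a, h)} \<inter> prefix_perm T (pre a h) -` ?X))
      = real (base_count i a (Suc n - h)) - ind a h"
    if "a \<in> {..row_length n}" "h \<in> {column_bottom a..n}" for a h
  proof -
    have a: "a \<le> row_length n" and h: "column_bottom a \<le> h" "h \<le> n" using that by auto
    have "prefix_perm T (pre a h) -` ?X = free_positions T i a (Suc n - h)"
      unfolding pre_def using free_positions_prefix[OF T i' a h(1)] h(2) by simp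
    moreover have "letter (a, h) = a + (Suc n - h)" using h by (simp add: letter_simp)
    moreover have "a + (Suc n - h) \<le> Suc (row_length n)"
    proof -
      have "a \<le> row_length h" using in_column_iff[OF a, of h] h by (simp add: lattice_iff)
      then show ?thesis using row_length_gap[of h n] h by linarith
    qed
    ultimately have "{1..letter (a, h)} \<inter> prefix_perm T (pre a h) -` ?X
        = {x \<in> {2..a + (Suc n - h)}. \<not> occupied T i a (Suc n - h) x}"
      by (auto simp: free_positions_def[OF T i'])
    then have "card ({1..letter (a, h)} \<inter> prefix_perm T (pre a h) -` ?X) = free_count T i a (Suc n - h)"
      by (simp only: free_count_def)
    moreover have "real (free_count T i a (Suc n - h)) + ind a h = real (base_count i a (Suc n - h))"
      unfolding ind_def using free_count_eq[OF T i', of a "Suc n - h"] by (metis of_nat_add of_nat_of_bool)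
    ultimately show ?thesis by simp
  qed
  have "proj n (N_dim n k) k (trim (N_dim n k) (tree_brick_vector \<nu> T)) i =
      - (\<Sum>a\<le>row_length n. \<Sum>h\<in>{column_bottom a..n}. real (card ({1..letter (a, h)} \<inter> prefix_perm T (pre a h) -` ?X)))"
    unfolding proj_apply[OF i] pre_def by (rule sum_tree_brick_vector) simp
  also have "\<dots> = - (\<Sum>a\<le>row_length n. \<Sum>h\<in>{column_bottom a..n}. real (base_count i a (Suc n - h)) - ind a h)"
    using count by (intro arg_cong[of _ _ uminus] sum.cong refl) blast
  also have "\<dots> = (\<Sum>a\<le>row_length n. \<Sum>h\<in>{column_bottom a..n}. ind a h)
      - (\<Sum>a\<le>row_length n. \<Sum>h\<in>{column_bottom a..n}. real (base_count i a (Suc n - h)))"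
    by (simp add: sum_subtractf)
  also have "(\<Sum>a\<le>row_length n. \<Sum>h\<in>{column_bottom a..n}. ind a h) = real (staircase_area T (n - i))"
    unfolding ind_def by (rule sum_crossing_points[OF T i'])
  finally show ?thesis .
qed

text \<open>The part that is common to all trees cancels against the minimal tree, whose areas vanish.\<close>
lemma y_coords_tree_point:
  assumes T: "nu_tree \<nu> T" shows "y_coords n k T = tree_point T"
proof
  fix i
  have T0: "nu_tree \<nu> (min_tree \<nu>)" using bottom_min_tree by (simp add: bottom_def)
  show "y_coords n k T i = tree_point T i"
  proof (cases "i \<in> {1..n - 1}")
    case True
    then show ?thesis
      unfolding y_coords_def Let_def minus_apply proj_brick_vector[OF T True] proj_brick_vector[OF T0 True]
      using staircase_area_bottom[OF bottom_min_tree, of "n - i"] by (simp add: tree_point_def)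
  next
    case False
    then show ?thesis by (auto simp: y_coords_def Let_def proj_def proj2_def tree_point_def)
  qed
qed

lemma cell_tight_cell:
  assumes "I \<in> interior_faces \<nu>" shows "cell n k I = tight_cell I"
proof -
  have "{y_coords n k T |T. nu_tree \<nu> T \<and> I \<subseteq> T} = tree_point ` {T. nu_tree \<nu> T \<and> I \<subseteq> T}"
    unfolding setcompr_eq_image by (rule image_cong) (auto intro: y_coords_tree_point)
  then show ?thesis using tight_cell_hull[of I] assms interior_iff unfolding cell_def by simp
qed

end

theorem theorem6p3:
  fixes n :: nat and k :: "nat \<Rightarrow> nat"
  assumes "n \<ge> 1" and "\<And>i. i \<in> {1..n} \<Longrightarrow> k i \<ge> 1"
  shows "(\<forall>T. nu_tree (nu_path n k) T \<longrightarrow>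
            y_coords n k T \<in> coord_space (n - 1) \<and>
            (\<forall>i\<in>{1..n - 1}. y_coords n k T i = real (area (nu_path n k) i (line_path (nu_path n k) T i))))
       \<and> realizes_nu_associahedron (nu_path n k) (n - 1)
            (insert {} (cell n k ` interior_faces (nu_path n k))) (cell n k)"
proof -
  interpret composition_path n k using assms by unfold_locales
  show ?thesis
  proof (intro conjI allI impI ballI)
    fix T assume T: "nu_tree (nu_path n k) T"
    show "y_coords n k T \<in> coord_space (n - 1)"
      unfolding y_coords_tree_point[OF T] by (rule tree_point_in_space)
    fix i assume i: "i \<in> {1..n - 1}"
    then have "i \<le> n" by auto
    then show "y_coords n k T i = real (area (nu_path n k) i (line_path (nu_path n k) T i))"
      using i by (simp add: y_coords_tree_point[OF T] area_line_path[OF T] tree_point_def)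
  next
    show "realizes_nu_associahedron (nu_path n k) (n - 1)
        (insert {} (cell n k ` interior_faces (nu_path n k))) (cell n k)"
      using realization[of "cell n k"] cell_tight_cell by blast
  qed
qed

end
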